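(* Let $(A=\oplus_{k\in\mathbb{Z}}A^{k},[\cdot,\cdot],\wedge)$ be a Gerstenhaber algebra and let $E=\oplus_{k\in\mathbb{Z}}E_{k}$ be the graded vector space with $E_{-k}:=A^{k}$; write $|P|=-k$ for $P\in A^{k}$. For every positive integer $i$ and all homogeneous $P_1,\dots,P_i\in A$ put $\mathcal{N}_i(P_1,\dots,P_i):=P_1\wedge\cdots\wedge P_i$. Put $l_1:=0$, $l_2(P_1,P_2):=(-1)^{|P_1|}[P_1,P_2]$, and for $i>2$ $$l_i(P_1,\dots,P_i):=\iota_{l_2}\mathcal{N}_{i-1}(P_1,\dots,P_i)=\sum_{\sigma\in Sh(2,i-2)}\epsilon(\sigma)(-1)^{|P_{\sigma(1)}|}[P_{\sigma(1)},P_{\sigma(2)}]\wedge P_{\sigma(3)}\wedge\cdots\wedge P_{\sigma(i)}.$$ Then: (a) for every $n\geq 1$, $l_n$ is an $L_\infty$-structure on $E$; for all $n,m\geq 1$, $\mathcal{N}_m$ is co-boundary Nijenhuis with respect to $l_n$; and, up to a constant, $l_{n+m-1}$ is the deformed structure of $l_n$ by $\mathcal{N}_m$, that is, $[\mathcal{N}_m,l_n]_{RN}=c\,l_{n+m-1}$ for some constant $c$ depending on $n,m$; (b) the family $(l_n)_{n\geq1}$ is a pencil of $L_\infty$-structures on $E$ (i.e. they are pairwise compatible), and therefore $\mu=\sum_{i\geq1}a_i l_i$ is an $L_\infty$-structure on $E$ for all reals $a_i$; (c) for all reals $b_i$, $i\ge 1$, $\mathcal{N}:=\sum_{i\geq1}b_i\mathcal{N}_i$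 is a co-boundary Nijenhuis vector valued form with respect to $l_n$, for every $n\ge 1$; (d) for all reals $a_i,b_i$, $\mathcal{N}=\sum_{i\geq1}b_i\mathcal{N}_i$ is a weak Nijenhuis vector valued form with respect to $\mu=\sum_{i\geq1}a_il_i$.
   Context: The ground field is $\mathbb{R}$ or $\mathbb{C}$. Gerstenhaber algebra: a graded commutative associative algebra $(A=\oplus_i A^i,\wedge)$ with a graded Lie algebra bracket on $A[1]$ (where $A[1]^i=A^{i+1}$) such that for each $P\in A[1]^i$, $[P,\cdot]$ is a derivation of degree $i$ of $(A,\wedge)$. In particular, for $P\in A^p$, $Q\in A^q$: $[P,Q]\in A^{p+q-1}$, $[P,Q]=-(-1)^{(p-1)(q-1)}[Q,P]$ and $[P,Q\wedge R]=[P,Q]\wedge R+(-1)^{(p-1)q}Q\wedge[P,R]$. Vector valued forms: for a graded vector space $E$, a symmetric vector valued $k$-form is a graded symmetric $k$-linear map $K:E^{k}\to E$ (a $0$-form is an element of $E$); it has degree $\bar K$ if $|K(X_1,\dots,X_k)|=|X_1|+\cdots+|X_k|+\bar K$. Formal (possibly infinite) sums $\sum_k K_k$ with $K_k$ a $k$-form are allowed and called vector valued forms. For a $k$-form $K$ and an $l$-form $L$, $$\iota_K L(X_1,\dots,X_{k+l-1})=\sum_{\sigma\in Sh(k,l-1)}\epsilon(\sigma)L(K(X_{\sigma(1)},\dots,X_{\sigma(k)}),X_{\sigma(k+1)},\dots,X_{\sigma(k+l-1)}),$$ with $\iota_K L=0$ if $l=0$. Here $Sh(i,j)$ is the set of $(i,j)$-unshuffles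 and $\epsilon(\sigma)$ is the Koszul sign, defined by $X_{\sigma(1)}\odot\cdots\odot X_{\sigma(n)}=\epsilon(\sigma)X_1\odot\cdots\odot X_n$ in the graded symmetric algebra of $E$. The Richardson-Nijenhuis bracket is $[K,L]_{RN}=\iota_K L-(-1)^{\bar K\bar L}\iota_L K$, extended arity by arity to formal sums. An $L_\infty$-structure on $E$ is a formal sum $\mu=\sum_{i\ge1}m_i$ of symmetric vector valued $i$-forms $m_i$ of degree $1$ such that for all $n\ge1$ and homogeneous $X_1,\dots,X_n$: $\sum_{i+j=n+1}\sum_{\sigma\in Sh(i,j-1)}\epsilon(\sigma)m_j(m_i(X_{\sigma(1)},\dots,X_{\sigma(i)}),\dots,X_{\sigma(n)})=0$ (equivalently $[\mu,\mu]_{RN}=0$). Two $L_\infty$-structures $\mu,\mu'$ are compatible if $[\mu,\mu']_{RN}=0$; a pencil is a family of pairwise compatible $L_\infty$-structures. Let $\mu$ be a vector valued form of degree $1$ and $\mathcal{N}$ one of degree $0$. $\mathcal{N}$ is weak Nijenhuis with respect to $\mu$ if $[\mu,[\mathcal{N},[\mathcal{N},\mu]_{RN}]_{RN}]_{RN}=0$; it is co-boundary Nijenhuis with respect to $\mu$ if there is a vector valued form $\mathcal{K}$ of degree $0$ with $[\mathcal{N},[\mathcal{N},\mu]_{RN}]_{RN}=[\mathcal{K},\mu]_{RN}$. The deformed structure of $\mu$ by $\mathcal{N}$ is $[\mathcal{N},\mu]_{RN}$. *)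

theory Defs
  imports Complex_Main "HOL-Combinatorics.Permutations"
begin

section \<open>Graded vector spaces\<close>

text \<open>
  The ground field is a type of class \<open>real_normed_field\<close>. Up to isomorphism the
  only such fields are the reals and the complex numbers (Ostrowski, Mazur).
  Graded vector spaces are internal direct sums of subspaces \<open>V i\<close>, with \<open>i\<close> ranging over
  the integers.
\<close>

definition homogeneous_decomposition ::
    "(int \<Rightarrow> 'a::ab_group_add set) \<Rightarrow> 'a \<Rightarrow> (int \<Rightarrow> 'a) \<Rightarrow> bool" where
  "homogeneous_decomposition V x f \<longleftrightarrow>
     finite {i. f i \<noteq> 0} \<and> (\<forall>i. f i \<in> V i) \<and> x = (\<Sum>i | f i \<noteq> 0. f i)"

locale graded_vector_space = vector_space scale
  for scale :: "'k::real_normed_field \<Rightarrow> 'a::ab_group_add \<Rightarrow> 'a" +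
  fixes V :: "int \<Rightarrow> 'a set"
  assumes subspace_homogeneous: "subspace (V i)"
    and direct_sum: "\<exists>!f. homogeneous_decomposition V x f"

definition component :: "(int \<Rightarrow> 'a::ab_group_add set) \<Rightarrow> 'a \<Rightarrow> int \<Rightarrow> 'a" where
  "component V x = (THE f. homogeneous_decomposition V x f)"

definition component_degrees :: "(int \<Rightarrow> 'a::ab_group_add set) \<Rightarrow> 'a \<Rightarrow> int set" where
  "component_degrees V x = {i. component V x i \<noteq> 0}"

definition homogeneous_list :: "(int \<Rightarrow> 'a set) \<Rightarrow> int list \<Rightarrow> 'a list \<Rightarrow> bool" where
  "homogeneous_list V ds xs \<longleftrightarrow> list_all2 (\<lambda>d x. x \<in> V d) ds xs"

definition opposite_grading :: "(int \<Rightarrow> 'a set) \<Rightarrow> int \<Rightarrow> 'a set" where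
  "opposite_grading A k = A (- k)"


section \<open>Gerstenhaber algebras\<close>

definition bilinear_map ::
    "('k::real_normed_field \<Rightarrow> 'a::ab_group_add \<Rightarrow> 'a) \<Rightarrow> ('a \<Rightarrow> 'a \<Rightarrow> 'a) \<Rightarrow> bool" where
  "bilinear_map scale f \<longleftrightarrow>
     (\<forall>y. Vector_Spaces.linear scale scale (\<lambda>x. f x y)) \<and>
     (\<forall>x. Vector_Spaces.linear scale scale (f x))"

locale graded_commutative_algebra = graded_vector_space scale A
  for scale :: "'k::real_normed_field \<Rightarrow> 'a::ab_group_add \<Rightarrow> 'a" and A :: "int \<Rightarrow> 'a set" +
  fixes wedge :: "'a \<Rightarrow> 'a \<Rightarrow> 'a"
  assumes wedge_bilinear: "bilinear_map scale wedge"
    and wedge_degree: "x \<in> A p \<Longrightarrow> y \<in> A q \<Longrightarrow> wedge x y \<in> A (p + q)"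
    and wedge_assoc: "wedge (wedge x y) z = wedge x (wedge y z)"
    and wedge_commute: "x \<in> A p \<Longrightarrow> y \<in> A q \<Longrightarrow> wedge x y = scale ((-1) powi (p * q)) (wedge y x)"

locale graded_Lie_algebra = graded_vector_space scale V
  for scale :: "'k::real_normed_field \<Rightarrow> 'a::ab_group_add \<Rightarrow> 'a" and V :: "int \<Rightarrow> 'a set" +
  fixes bracket :: "'a \<Rightarrow> 'a \<Rightarrow> 'a"
  assumes bracket_bilinear: "bilinear_map scale bracket"
    and bracket_degree: "x \<in> V i \<Longrightarrow> y \<in> V j \<Longrightarrow> bracket x y \<in> V (i + j)"
    and bracket_antisym:
      "x \<in> V i \<Longrightarrow> y \<in> V j \<Longrightarrow> bracket x y = - scale ((-1) powi (i * j)) (bracket y x)"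
    and bracket_Jacobi:
      "x \<in> V i \<Longrightarrow> y \<in> V j \<Longrightarrow> z \<in> V k \<Longrightarrow>
       bracket x (bracket y z) =
         bracket (bracket x y) z + scale ((-1) powi (i * j)) (bracket y (bracket x z))"

locale Gerstenhaber_algebra =
  graded_commutative_algebra scale A wedge +
  shifted: graded_Lie_algebra scale "\<lambda>i. A (i + 1)" bracket
  for scale :: "'k::real_normed_field \<Rightarrow> 'a::ab_group_add \<Rightarrow> 'a"
    and A :: "int \<Rightarrow> 'a set"
    and wedge :: "'a \<Rightarrow> 'a \<Rightarrow> 'a"
    and bracket :: "'a \<Rightarrow> 'a \<Rightarrow> 'a" +
  assumes bracket_derivation:
    "P \<in> A (i + 1) \<Longrightarrow> Q \<in> A q \<Longrightarrow> R \<in> A r \<Longrightarrow>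
     bracket P (wedge Q R) =
       wedge (bracket P Q) R + scale ((-1) powi (i * q)) (wedge Q (bracket P R))"


section \<open>Unshuffles and the Koszul sign\<close>

text \<open>Permutations act on positions \<open>0, \<dots>, n - 1\<close>.\<close>

definition unshuffles :: "nat \<Rightarrow> nat \<Rightarrow> (nat \<Rightarrow> nat) set" where
  "unshuffles i j =
     {\<sigma>. \<sigma> permutes {..<i + j} \<and> strict_mono_on {..<i} \<sigma> \<and> strict_mono_on {i..<i + j} \<sigma>}"

definition inversions_below :: "nat \<Rightarrow> (nat \<Rightarrow> nat) \<Rightarrow> (nat \<times> nat) set" where
  "inversions_below n \<sigma> = {(i, j). i < j \<and> j < n \<and> \<sigma> j < \<sigma> i}"

text \<open>
  The sign with \<open>X\<^bsub>\<sigma>(1)\<^esub> \<odot> \<dots> \<odot> X\<^bsub>\<sigma>(n)\<^esub> = \<epsilon>(\<sigma>) X\<^sub>1 \<odot> \<dots> \<odot> X\<^sub>n\<close> for \<open>X\<^sub>i\<close> of degree \<open>ds ! i\<close>: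
  every inversion contributes the sign of exchanging the two factors involved.
  Lemma \<open>wedge_list_permute\<close> below shows that this relation holds in every graded
  commutative algebra.
\<close>

definition Koszul_sign :: "int list \<Rightarrow> (nat \<Rightarrow> nat) \<Rightarrow> 'k::real_normed_field" where
  "Koszul_sign ds \<sigma> =
     (\<Prod>(i, j)\<in>inversions_below (length ds) \<sigma>. (-1) powi (ds ! \<sigma> i * ds ! \<sigma> j))"


section \<open>Vector valued forms\<close>

text \<open>
  A formal sum \<open>K = \<Sum>\<^sub>k K\<^sub>k\<close> of vector valued \<open>k\<close>-forms is encoded as one function on lists:
  \<open>K\<^sub>k\<close> is the restriction of \<open>K\<close> to lists of length \<open>k\<close>. A single \<open>k\<close>-form is thus a function
  that vanishes on all lists of length other than \<open>k\<close>.
\<close>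

type_synonym 'a vform = "'a list \<Rightarrow> 'a"

definition multilinear ::
    "('k::real_normed_field \<Rightarrow> 'a::ab_group_add \<Rightarrow> 'a) \<Rightarrow> 'a vform \<Rightarrow> bool" where
  "multilinear scale K \<longleftrightarrow>
     (\<forall>xs. \<forall>i<length xs. Vector_Spaces.linear scale scale (\<lambda>x. K (xs[i := x])))"

definition graded_symmetric ::
    "('k::real_normed_field \<Rightarrow> 'a::ab_group_add \<Rightarrow> 'a) \<Rightarrow> (int \<Rightarrow> 'a set) \<Rightarrow> 'a vform \<Rightarrow> bool" where
  "graded_symmetric scale V K \<longleftrightarrow>
     (\<forall>ds xs \<sigma>. homogeneous_list V ds xs \<longrightarrow> \<sigma> permutes {..<length xs} \<longrightarrow>
        K (permute_list \<sigma> xs) = scale (Koszul_sign ds \<sigma>) (K xs))"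

definition vector_valued_form ::
    "('k::real_normed_field \<Rightarrow> 'a::ab_group_add \<Rightarrow> 'a) \<Rightarrow> (int \<Rightarrow> 'a set) \<Rightarrow> 'a vform \<Rightarrow> bool" where
  "vector_valued_form scale V K \<longleftrightarrow> multilinear scale K \<and> graded_symmetric scale V K"

definition has_form_degree :: "(int \<Rightarrow> 'a set) \<Rightarrow> 'a vform \<Rightarrow> int \<Rightarrow> bool" where
  "has_form_degree V K p \<longleftrightarrow>
     (\<forall>ds xs. homogeneous_list V ds xs \<longrightarrow> K xs \<in> V (sum_list ds + p))"

text \<open>
  Formulas involving Koszul signs prescribe a multilinear map on homogeneous arguments only;
  \<open>F ds xs\<close> is such a formula, for \<open>xs ! i\<close> homogeneous of degree \<open>ds ! i\<close>.
\<close>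

definition multilinear_extension ::
    "(int \<Rightarrow> 'a::ab_group_add set) \<Rightarrow> (int list \<Rightarrow> 'a list \<Rightarrow> 'a) \<Rightarrow> 'a vform" where
  "multilinear_extension V F xs =
     (\<Sum>ds\<in>listset (map (component_degrees V) xs). F ds (map2 (component V) xs ds))"

text \<open>The sum over \<open>Sh(k, n - k)\<close> in \<open>\<iota>\<^bsub>K\<^sub>k\<^esub> L\<^bsub>n-k+1\<^esub>\<close> for homogeneous arguments \<open>X\<^sub>1, \<dots>, X\<^sub>n\<close>.\<close>

definition unshuffle_insertion ::
    "('k::real_normed_field \<Rightarrow> 'a::ab_group_add \<Rightarrow> 'a) \<Rightarrow> nat \<Rightarrow> 'a vform \<Rightarrow> 'a vform \<Rightarrow>
     int list \<Rightarrow> 'a list \<Rightarrow> 'a" where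
  "unshuffle_insertion scale k K L ds xs =
     (\<Sum>\<sigma>\<in>unshuffles k (length xs - k).
        scale (Koszul_sign ds \<sigma>)
          (L (K (take k (permute_list \<sigma> xs)) # drop k (permute_list \<sigma> xs))))"

text \<open>
  In arity \<open>n\<close>, \<open>\<iota>\<^sub>K L\<close> collects all \<open>\<iota>\<^bsub>K\<^sub>k\<^esub> L\<^sub>l\<close> with \<open>k + l - 1 = n\<close>. As \<open>\<iota>\<^bsub>K\<^sub>k\<^esub> L\<^sub>0 = 0\<close>,
  only \<open>l \<ge> 1\<close>, i.e. \<open>k \<le> n\<close>, contributes.
\<close>

definition insertion ::
    "('k::real_normed_field \<Rightarrow> 'a::ab_group_add \<Rightarrow> 'a) \<Rightarrow> (int \<Rightarrow> 'a set) \<Rightarrow>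
     'a vform \<Rightarrow> 'a vform \<Rightarrow> 'a vform" where
  "insertion scale V K L =
     multilinear_extension V
       (\<lambda>ds xs. \<Sum>k\<le>length xs. unshuffle_insertion scale k K L ds xs)"

text \<open>
  \<open>RN_bracket scale V p K q L\<close> is the Richardson-Nijenhuis bracket of \<open>K\<close> of degree \<open>p\<close> and
  \<open>L\<close> of degree \<open>q\<close>. The degrees are arguments, since the zero form has every degree.
\<close>

definition RN_bracket ::
    "('k::real_normed_field \<Rightarrow> 'a::ab_group_add \<Rightarrow> 'a) \<Rightarrow> (int \<Rightarrow> 'a set) \<Rightarrow>
     int \<Rightarrow> 'a vform \<Rightarrow> int \<Rightarrow> 'a vform \<Rightarrow> 'a vform" where
  "RN_bracket scale V p K q L xs =
     insertion scale V K L xs - scale ((-1) powi (p * q)) (insertion scale V L K xs)"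

definition scale_form ::
    "('k::real_normed_field \<Rightarrow> 'a::ab_group_add \<Rightarrow> 'a) \<Rightarrow> 'k \<Rightarrow> 'a vform \<Rightarrow> 'a vform" where
  "scale_form scale c K xs = scale c (K xs)"

text \<open>The formal sum \<open>\<Sum>\<^bsub>i\<ge>1\<^esub> a\<^sub>i K\<^sub>i\<close>, for \<open>K i\<close> an \<open>i\<close>-form and real coefficients \<open>a\<^sub>i\<close>.\<close>

definition formal_sum ::
    "('k::real_normed_field \<Rightarrow> 'a::ab_group_add \<Rightarrow> 'a) \<Rightarrow> (nat \<Rightarrow> real) \<Rightarrow> (nat \<Rightarrow> 'a vform) \<Rightarrow> 'a vform"
  where
  "formal_sum scale a K xs =
     (if xs = [] then 0 else scale (of_real (a (length xs))) (K (length xs) xs))"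


section \<open>\<open>L\<^sub>\<infinity>\<close>-structures and Nijenhuis forms\<close>

definition L_infinity_structure ::
    "('k::real_normed_field \<Rightarrow> 'a::ab_group_add \<Rightarrow> 'a) \<Rightarrow> (int \<Rightarrow> 'a set) \<Rightarrow> 'a vform \<Rightarrow> bool" where
  "L_infinity_structure scale V \<mu> \<longleftrightarrow>
     vector_valued_form scale V \<mu> \<and> has_form_degree V \<mu> 1 \<and> \<mu> [] = 0 \<and>
     (\<forall>ds xs. homogeneous_list V ds xs \<longrightarrow> xs \<noteq> [] \<longrightarrow>
        (\<Sum>i = 1..length xs. unshuffle_insertion scale i \<mu> \<mu> ds xs) = 0)"

definition compatible_L_infinity ::
    "('k::real_normed_field \<Rightarrow> 'a::ab_group_add \<Rightarrow> 'a) \<Rightarrow> (int \<Rightarrow> 'a set) \<Rightarrow> 'a vform \<Rightarrow> 'a vform \<Rightarrow> bool"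
  where
  "compatible_L_infinity scale V \<mu> \<mu>' \<longleftrightarrow>
     L_infinity_structure scale V \<mu> \<and> L_infinity_structure scale V \<mu>' \<and>
     RN_bracket scale V 1 \<mu> 1 \<mu>' = (\<lambda>_. 0)"

definition L_infinity_pencil ::
    "('k::real_normed_field \<Rightarrow> 'a::ab_group_add \<Rightarrow> 'a) \<Rightarrow> (int \<Rightarrow> 'a set) \<Rightarrow> 'i set \<Rightarrow> ('i \<Rightarrow> 'a vform) \<Rightarrow> bool"
  where
  "L_infinity_pencil scale V I \<mu> \<longleftrightarrow>
     (\<forall>i\<in>I. L_infinity_structure scale V (\<mu> i)) \<and>
     (\<forall>i\<in>I. \<forall>j\<in>I. compatible_L_infinity scale V (\<mu> i) (\<mu> j))"

text \<open>In the following \<open>\<mu>\<close> has degree 1 and \<open>\<N>\<close> has degree 0.\<close>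

definition deformed_structure ::
    "('k::real_normed_field \<Rightarrow> 'a::ab_group_add \<Rightarrow> 'a) \<Rightarrow> (int \<Rightarrow> 'a set) \<Rightarrow> 'a vform \<Rightarrow> 'a vform \<Rightarrow> 'a vform"
  where
  "deformed_structure scale V \<N> \<mu> = RN_bracket scale V 0 \<N> 1 \<mu>"

definition weak_Nijenhuis ::
    "('k::real_normed_field \<Rightarrow> 'a::ab_group_add \<Rightarrow> 'a) \<Rightarrow> (int \<Rightarrow> 'a set) \<Rightarrow> 'a vform \<Rightarrow> 'a vform \<Rightarrow> bool"
  where
  "weak_Nijenhuis scale V \<mu> \<N> \<longleftrightarrow>
     vector_valued_form scale V \<mu> \<and> has_form_degree V \<mu> 1 \<and>
     vector_valued_form scale V \<N> \<and> has_form_degree V \<N> 0 \<and>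
     RN_bracket scale V 1 \<mu> 1 (RN_bracket scale V 0 \<N> 1 (RN_bracket scale V 0 \<N> 1 \<mu>)) = (\<lambda>_. 0)"

definition coboundary_Nijenhuis ::
    "('k::real_normed_field \<Rightarrow> 'a::ab_group_add \<Rightarrow> 'a) \<Rightarrow> (int \<Rightarrow> 'a set) \<Rightarrow> 'a vform \<Rightarrow> 'a vform \<Rightarrow> bool"
  where
  "coboundary_Nijenhuis scale V \<mu> \<N> \<longleftrightarrow>
     vector_valued_form scale V \<mu> \<and> has_form_degree V \<mu> 1 \<and>
     vector_valued_form scale V \<N> \<and> has_form_degree V \<N> 0 \<and>
     (\<exists>\<K>. vector_valued_form scale V \<K> \<and> has_form_degree V \<K> 0 \<and>
        RN_bracket scale V 0 \<N> 1 (RN_bracket scale V 0 \<N> 1 \<mu>) = RN_bracket scale V 0 \<K> 1 \<mu>)"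


section \<open>The forms attached to a Gerstenhaber algebra\<close>

definition wedge_list :: "('a \<Rightarrow> 'a \<Rightarrow> 'a) \<Rightarrow> 'a list \<Rightarrow> 'a" where
  "wedge_list wedge xs = foldl wedge (hd xs) (tl xs)"

definition wedge_form :: "('a \<Rightarrow> 'a \<Rightarrow> 'a::zero) \<Rightarrow> nat \<Rightarrow> 'a vform" where
  "wedge_form wedge i xs = (if i \<ge> 1 \<and> length xs = i then wedge_list wedge xs else 0)"

definition Gerstenhaber_l2 ::
    "('k::real_normed_field \<Rightarrow> 'a::ab_group_add \<Rightarrow> 'a) \<Rightarrow> (int \<Rightarrow> 'a set) \<Rightarrow> ('a \<Rightarrow> 'a \<Rightarrow> 'a) \<Rightarrow> 'a vform"
  where
  "Gerstenhaber_l2 scale A bracket =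
     multilinear_extension (opposite_grading A)
       (\<lambda>ds xs. if length xs = 2
          then scale ((-1) powi (ds ! 0)) (bracket (xs ! 0) (xs ! 1)) else 0)"

definition Gerstenhaber_l ::
    "('k::real_normed_field \<Rightarrow> 'a::ab_group_add \<Rightarrow> 'a) \<Rightarrow> (int \<Rightarrow> 'a set) \<Rightarrow>
     ('a \<Rightarrow> 'a \<Rightarrow> 'a) \<Rightarrow> ('a \<Rightarrow> 'a \<Rightarrow> 'a) \<Rightarrow> nat \<Rightarrow> 'a vform" where
  "Gerstenhaber_l scale A wedge bracket i =
     (if i \<le> 1 then (\<lambda>_. 0)
      else if i = 2 then Gerstenhaber_l2 scale A bracket
      else insertion scale (opposite_grading A)
             (Gerstenhaber_l2 scale A bracket) (wedge_form wedge (i - 1)))"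


section \<open>Basic properties\<close>

context graded_vector_space
begin

lemma component_homogeneous:
  assumes "x \<in> V d"
  shows "component V x = (\<lambda>i. if i = d then x else 0)"
proof -
  have "0 \<in> V i" for i
    using subspace_homogeneous subspace_0 by blast
  moreover have "{i. (if i = d then x else 0) \<noteq> 0} = (if x = 0 then {} else {d})"
    by auto
  ultimately have "homogeneous_decomposition V x (\<lambda>i. if i = d then x else 0)"
    unfolding homogeneous_decomposition_def using assms by simp
  then show ?thesis
    unfolding component_def by (rule the1_equality[OF direct_sum])
qed

text \<open>Zero is excluded as an argument, since it is homogeneous of every degree.\<close>

lemma multilinear_extension_homogeneous:
  assumes "homogeneous_list V ds xs" and "0 \<notin> set xs"
  shows "multilinear_extension V F xs = F ds xs"
proof -
  have hom: "list_all2 (\<lambda>d x. x \<in> V d) ds xs"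
    using assms by (simp add: homogeneous_list_def)
  have "listset (map (component_degrees V) xs) = {ds}"
    using hom assms(2)
  proof (induction rule: list_all2_induct)
    case (Cons d ds x xs)
    then have "component_degrees V x = {d}"
      by (auto simp: component_degrees_def component_homogeneous)
    with Cons show ?case
      by (auto simp: set_Cons_def)
  qed simp
  moreover have "map2 (component V) xs ds = xs"
    using hom by (induction rule: list_all2_induct) (auto simp: component_homogeneous)
  ultimately show ?thesis
    by (simp add: multilinear_extension_def)
qed

end

lemma finite_inversions_below: "finite (inversions_below n \<sigma>)"
  by (rule finite_subset[of _ "{..<n} \<times> {..<n}"]) (auto simp: inversions_below_def)

lemma transpose_Suc_less:
  fixes i a b :: nat
  assumes "a < b" and "(a, b) \<noteq> (i, Suc i)"
  shows "transpose i (Suc i) a < transpose i (Suc i) b"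
  using assms by (auto simp: transpose_def)

lemma inversions_below_transpose:
  assumes "Suc i < n" and "\<sigma> (Suc i) < \<sigma> i"
  defines "s \<equiv> transpose i (Suc i)"
  shows "bij_betw (map_prod s s) (inversions_below n (\<sigma> \<circ> s)) (inversions_below n \<sigma> - {(i, Suc i)})"
proof (rule bij_betw_byWitness[where f' = "map_prod s s"])
  have ss: "s (s x) = x" for x
    by (simp add: s_def)
  have lt: "s a < n \<longleftrightarrow> a < n" for a
    using assms(1) by (auto simp: s_def transpose_def)
  have s: "s i = Suc i" "s (Suc i) = i"
    by (simp_all add: s_def)
  show "\<forall>p\<in>inversions_below n (\<sigma> \<circ> s). map_prod s s (map_prod s s p) = p"
    "\<forall>p\<in>inversions_below n \<sigma> - {(i, Suc i)}. map_prod s s (map_prod s s p) = p"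
    by (auto simp: ss)
  show "map_prod s s ` inversions_below n (\<sigma> \<circ> s) \<subseteq> inversions_below n \<sigma> - {(i, Suc i)}"
  proof (rule image_subsetI)
    fix p assume "p \<in> inversions_below n (\<sigma> \<circ> s)"
    then obtain a b where p: "p = (a, b)" and ab: "a < b" "b < n" "\<sigma> (s b) < \<sigma> (s a)"
      by (auto simp: inversions_below_def)
    then have "(a, b) \<noteq> (i, Suc i)"
      using assms(2) s by auto
    then have "s a < s b"
      unfolding s_def using ab(1) by (rule transpose_Suc_less[rotated])
    moreover from this have "(s a, s b) \<noteq> (i, Suc i)"
      using ab(1) s ss by (metis Pair_inject not_less_iff_gr_or_eq lessI)
    ultimately show "map_prod s s p \<in> inversions_below n \<sigma> - {(i, Suc i)}"
      using p ab lt by (auto simp: inversions_below_def)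
  qed
  show "map_prod s s ` (inversions_below n \<sigma> - {(i, Suc i)}) \<subseteq> inversions_below n (\<sigma> \<circ> s)"
  proof (rule image_subsetI)
    fix p assume "p \<in> inversions_below n \<sigma> - {(i, Suc i)}"
    then obtain a b where p: "p = (a, b)"
      and ab: "a < b" "b < n" "\<sigma> b < \<sigma> a" "(a, b) \<noteq> (i, Suc i)"
      by (auto simp: inversions_below_def)
    then have "s a < s b"
      unfolding s_def by (intro transpose_Suc_less)
    then show "map_prod s s p \<in> inversions_below n (\<sigma> \<circ> s)"
      using p ab lt ss by (auto simp: inversions_below_def)
  qed
qed

lemma Koszul_sign_transpose:
  assumes "Suc i < length ds" and "\<sigma> (Suc i) < \<sigma> i"
  shows "Koszul_sign ds \<sigma> =
    (-1) powi (ds ! \<sigma> i * ds ! \<sigma> (Suc i)) * Koszul_sign ds (\<sigma> \<circ> transpose i (Suc i))"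
proof -
  let ?s = "transpose i (Suc i)" and ?I = "inversions_below (length ds)"
  let ?w = "\<lambda>\<tau> (a, b). (-1 :: 'a) powi (ds ! \<tau> a * ds ! \<tau> b)"
  have "(i, Suc i) \<in> ?I \<sigma>"
    using assms by (auto simp: inversions_below_def)
  then have "prod (?w \<sigma>) (?I \<sigma>) = ?w \<sigma> (i, Suc i) * prod (?w \<sigma>) (?I \<sigma> - {(i, Suc i)})"
    by (intro prod.remove finite_inversions_below)
  also have "prod (?w \<sigma>) (?I \<sigma> - {(i, Suc i)}) = prod (\<lambda>p. ?w \<sigma> (map_prod ?s ?s p)) (?I (\<sigma> \<circ> ?s))"
    using prod.reindex_bij_betw[OF inversions_below_transpose[OF assms]] by metis
  also have "\<dots> = prod (?w (\<sigma> \<circ> ?s)) (?I (\<sigma> \<circ> ?s))"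
    by (intro prod.cong) auto
  finally show ?thesis
    by (simp add: Koszul_sign_def)
qed

lemma no_descent_imp_id:
  assumes "\<sigma> permutes {..<n}" and "\<And>i. Suc i < n \<Longrightarrow> \<sigma> i \<le> \<sigma> (Suc i)"
  shows "\<sigma> = id"
proof -
  have "i < n \<Longrightarrow> i \<le> \<sigma> i" for i
  proof (induction i)
    case (Suc i)
    have "\<sigma> i \<noteq> \<sigma> (Suc i)"
      using permutes_inj[OF assms(1)] by (metis injD n_not_Suc_n)
    with Suc assms(2)[of i] show ?case
      by simp
  qed simp
  then show ?thesis
    using permutes_natset_ge[OF assms(1)] by simp
qed

context graded_commutative_algebra
begin

lemma wedge_scale:
  "wedge (scale c x) y = scale c (wedge x y)"
  "wedge x (scale c y) = scale c (wedge x y)"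
  using wedge_bilinear by (auto simp: bilinear_map_def linear_iff_module_hom module_hom.scale dest: module_hom.scale)

lemma foldl_wedge_scale: "foldl wedge (scale c x) xs = scale c (foldl wedge x xs)"
  by (induction xs arbitrary: x) (auto simp: wedge_scale)

lemma wedge_list_swap:
  assumes "x \<in> A p" and "y \<in> A q"
  shows "wedge_list wedge (us @ x # y # vs) =
    scale ((-1) powi (p * q)) (wedge_list wedge (us @ y # x # vs))"
proof (cases us)
  case Nil
  then show ?thesis
    using wedge_commute[OF assms] by (simp add: wedge_list_def foldl_wedge_scale)
next
  case (Cons u us')
  have "wedge (wedge w x) y = scale ((-1) powi (p * q)) (wedge (wedge w y) x)" for w
    using wedge_commute[OF assms] by (simp add: wedge_assoc wedge_scale)
  with Cons show ?thesis
    by (simp add: wedge_list_def foldl_wedge_scale)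
qed

text \<open>The defining property of the Koszul sign.\<close>

lemma wedge_list_permute:
  assumes "homogeneous_list A ds xs" and "\<sigma> permutes {..<length xs}"
  shows "wedge_list wedge (permute_list \<sigma> xs) = scale (Koszul_sign ds \<sigma>) (wedge_list wedge xs)"
  using assms(2)
proof (induction "card (inversions_below (length xs) \<sigma>)" arbitrary: \<sigma> rule: less_induct)
  case less
  let ?n = "length xs"
  have len: "length ds = ?n" and hom: "\<And>k. k < ?n \<Longrightarrow> xs ! k \<in> A (ds ! k)"
    using assms(1) by (auto simp: homogeneous_list_def list_all2_conv_all_nth)
  show ?case
  proof (cases "\<exists>i. Suc i < ?n \<and> \<sigma> (Suc i) < \<sigma> i")
    case False
    then have "\<sigma> = id"
      using no_descent_imp_id[OF less.prems] by (meson not_less)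
    moreover have "inversions_below m id = {}" for m
      by (auto simp: inversions_below_def)
    ultimately show ?thesis
      by (simp add: Koszul_sign_def)
  next
    case True
    then obtain i where i: "Suc i < ?n" "\<sigma> (Suc i) < \<sigma> i"
      by blast
    let ?s = "transpose i (Suc i)"
    let ?ys = "permute_list \<sigma> xs" and ?zs = "permute_list (\<sigma> \<circ> ?s) xs"
    have s: "?s permutes {..<?n}"
      using i by (intro permutes_swap_id) auto
    then have perm: "\<sigma> \<circ> ?s permutes {..<?n}"
      using less.prems by (rule permutes_compose)
    have "card (inversions_below ?n (\<sigma> \<circ> ?s)) = card (inversions_below ?n \<sigma> - {(i, Suc i)})"
      using bij_betw_same_card[OF inversions_below_transpose[OF i]] .
    also have "\<dots> < card (inversions_below ?n \<sigma>)"
      using i by (intro psubset_card_mono finite_inversions_below) (auto simp: inversions_below_def)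
    finally have IH: "wedge_list wedge ?zs = scale (Koszul_sign ds (\<sigma> \<circ> ?s)) (wedge_list wedge xs)"
      using less.hyps perm by blast
    let ?us = "take i ?ys" and ?vs = "drop (Suc (Suc i)) ?ys"
    have ys: "?ys = ?us @ xs ! \<sigma> i # xs ! \<sigma> (Suc i) # ?vs"
    proof -
      have "?ys = ?us @ ?ys ! i # ?ys ! Suc i # ?vs"
        using i by (simp add: Cons_nth_drop_Suc)
      then show ?thesis
        using i by (simp add: permute_list_def)
    qed
    have zs: "?zs = ?us @ xs ! \<sigma> (Suc i) # xs ! \<sigma> i # ?vs"
      using i by (intro nth_equalityI)
        (auto simp: permute_list_def nth_append nth_Cons transpose_def split: nat.splits
           intro!: arg_cong[where f = "\<lambda>k. xs ! \<sigma> k"])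
    have "\<sigma> i < ?n" "\<sigma> (Suc i) < ?n"
      using permutes_in_image[OF less.prems] i by (auto dest: Suc_lessD)
    then have "wedge_list wedge ?ys =
        scale ((-1) powi (ds ! \<sigma> i * ds ! \<sigma> (Suc i))) (wedge_list wedge ?zs)"
      using wedge_list_swap hom ys zs by metis
    then show ?thesis
      using IH Koszul_sign_transpose[of i ds \<sigma>, where 'a = 'k] i len by simp
  qed
qed

end

context graded_vector_space
begin

lemma graded_vector_space_opposite: "graded_vector_space scale (opposite_grading V)"
proof unfold_locales
  show "subspace (opposite_grading V i)" for i
    by (simp add: opposite_grading_def subspace_homogeneous)
  fix x
  have iff: "homogeneous_decomposition (opposite_grading V) x f \<longleftrightarrow>
      homogeneous_decomposition V x (f \<circ> uminus)" for f :: "int \<Rightarrow> 'a"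
  proof -
    have eq: "{i. (f \<circ> uminus) i \<noteq> 0} = uminus ` {i. f i \<noteq> 0}"
      by (auto simp: image_iff intro: exI[of _ "- _"]) (metis minus_minus)
    have "finite (uminus ` {i. f i \<noteq> 0}) \<longleftrightarrow> finite {i. f i \<noteq> 0}"
      by (rule finite_image_iff) simp
    moreover have "(\<Sum>i\<in>uminus ` {i. f i \<noteq> 0}. (f \<circ> uminus) i) = (\<Sum>i | f i \<noteq> 0. f i)"
      by (subst sum.reindex) (simp_all add: o_def)
    moreover have "(\<forall>i. f i \<in> V (- i)) \<longleftrightarrow> (\<forall>i. f (- i) \<in> V i)"
      by (metis minus_minus)
    ultimately show ?thesis
      unfolding homogeneous_decomposition_def eq by (simp add: opposite_grading_def)
  qed
  obtain g where g: "homogeneous_decomposition V x g"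
    and uniq: "\<And>h. homogeneous_decomposition V x h \<Longrightarrow> h = g"
    using direct_sum by blast
  show "\<exists>!f. homogeneous_decomposition (opposite_grading V) x f"
  proof (rule ex1I)
    show "homogeneous_decomposition (opposite_grading V) x (g \<circ> uminus)"
      using g by (simp add: iff comp_assoc o_def)
    fix f assume "homogeneous_decomposition (opposite_grading V) x f"
    then have "f \<circ> uminus = g"
      using iff uniq by blast
    then show "f = g \<circ> uminus"
      by (auto simp: o_def)
  qed
qed

end

context Gerstenhaber_algebra
begin

lemma Gerstenhaber_l2_homogeneous:
  assumes "P \<in> A (- p)" and "Q \<in> A (- q)" and "P \<noteq> 0" and "Q \<noteq> 0"
  shows "Gerstenhaber_l2 scale A bracket [P, Q] = scale ((-1) powi p) (bracket P Q)"
proof -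
  interpret E: graded_vector_space scale "opposite_grading A"
    by (rule graded_vector_space_opposite)
  have "homogeneous_list (opposite_grading A) [p, q] [P, Q]"
    using assms by (simp add: homogeneous_list_def opposite_grading_def)
  with assms show ?thesis
    unfolding Gerstenhaber_l2_def by (subst E.multilinear_extension_homogeneous) auto
qed

text \<open>The explicit formula for \<open>l\<^sub>n\<close>, \<open>n > 2\<close>, on homogeneous elements.\<close>

lemma Gerstenhaber_l_homogeneous:
  assumes hom: "homogeneous_list (opposite_grading A) ds xs" and nz: "0 \<notin> set xs"
    and n: "length xs = n" "n > 2"
  shows "Gerstenhaber_l scale A wedge bracket n xs =
    (\<Sum>\<sigma>\<in>unshuffles 2 (n - 2). scale (Koszul_sign ds \<sigma>)
       (wedge_list wedge
          (scale ((-1) powi (ds ! \<sigma> 0)) (bracket (xs ! \<sigma> 0) (xs ! \<sigma> 1)) #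
           map (\<lambda>k. xs ! \<sigma> k) [2..<n])))" (is "_ = ?rhs")
proof -
  interpret E: graded_vector_space scale "opposite_grading A"
    by (rule graded_vector_space_opposite)
  let ?l2 = "Gerstenhaber_l2 scale A bracket" and ?N = "wedge_form wedge (n - 1)"
  have "Gerstenhaber_l scale A wedge bracket n xs =
      (\<Sum>k\<le>n. unshuffle_insertion scale k ?l2 ?N ds xs)"
    using n E.multilinear_extension_homogeneous[OF hom nz]
    by (simp add: Gerstenhaber_l_def insertion_def)
  also have "\<dots> = (\<Sum>k\<in>{2}. unshuffle_insertion scale k ?l2 ?N ds xs)"
    using n by (intro sum.mono_neutral_right)
      (auto simp: unshuffle_insertion_def wedge_form_def intro!: sum.neutral)
  also have "\<dots> = unshuffle_insertion scale 2 ?l2 ?N ds xs"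
    by simp
  also have "\<dots> = ?rhs"
    unfolding unshuffle_insertion_def n(1)
  proof (intro sum.cong refl)
    fix \<sigma> assume "\<sigma> \<in> unshuffles 2 (n - 2)"
    then have perm: "\<sigma> permutes {..<n}"
      using n by (simp add: unshuffles_def del: add_2_eq_Suc)
    have "[0..<n] = [0, 1] @ [2..<n]"
      using n by (simp add: upt_conv_Cons numeral_2_eq_2)
    then have split: "take 2 (permute_list \<sigma> xs) = [xs ! \<sigma> 0, xs ! \<sigma> 1]"
      "drop 2 (permute_list \<sigma> xs) = map (\<lambda>k. xs ! \<sigma> k) [2..<n]"
      using n by (simp_all add: permute_list_def)
    have "xs ! \<sigma> k \<in> A (- (ds ! \<sigma> k)) \<and> xs ! \<sigma> k \<noteq> 0" if "k < n" for k
      using hom nz n permutes_in_image[OF perm, of k] that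
      by (auto simp: homogeneous_list_def opposite_grading_def list_all2_conv_all_nth)
        (metis nth_mem)
    then have "?l2 [xs ! \<sigma> 0, xs ! \<sigma> 1] =
        scale ((-1) powi (ds ! \<sigma> 0)) (bracket (xs ! \<sigma> 0) (xs ! \<sigma> 1))"
      using n by (intro Gerstenhaber_l2_homogeneous[where q = "ds ! \<sigma> 1"]) auto
    moreover have "Suc (n - 2) = n - 1" "n - 1 \<ge> 1"
      using n by simp_all
    ultimately show "scale (Koszul_sign ds \<sigma>)
        (?N (?l2 (take 2 (permute_list \<sigma> xs)) # drop 2 (permute_list \<sigma> xs))) =
      scale (Koszul_sign ds \<sigma>) (wedge_list wedge
          (scale ((-1) powi (ds ! \<sigma> 0)) (bracket (xs ! \<sigma> 0) (xs ! \<sigma> 1)) #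
           map (\<lambda>k. xs ! \<sigma> k) [2..<n]))"
      using n by (simp add: split wedge_form_def)
  qed
  finally show ?thesis .
qed

end

end

theory Submission
  imports Defs
begin

text \<open>
  A vector valued form is a map on words of homogeneous letters, and the Koszul-signed sums over
  unshuffles are the coproduct of the unshuffle coalgebra of words. This coproduct is coassociative
  and graded cocommutative, so forms multiply by convolution, and they inherit from the underlying
  algebra a graded commutative product and a bracket \<open>{f, g}\<close> of degree 1 that acts by derivations
  (\<open>mult_assoc\<close>, \<open>mult_commute\<close>, \<open>brac_mult\<close>).

  Let \<open>X\<close> be the identity, seen as a 1-form; it is an even element of this algebra. Then
  \<open>\<N>\<^sub>m = X\<^sup>m / m!\<close>, \<open>l\<^sub>2 = {X, X} / 2\<close> and \<open>l\<^sub>n = l\<^sub>2 X\<^sup>n\<^sup>-\<^sup>2 / (n - 2)!\<close>. Inserting a form \<open>K\<close> into a form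
  written in terms of \<open>X\<close> is differentiation in the direction \<open>K\<close>:
  \<open>\<iota>\<^sub>K \<N>\<^sub>m = K X\<^sup>m\<^sup>-\<^sup>1 / (m - 1)!\<close> (\<open>unshuffle_sum_into_wedge_form\<close>) and
  \<open>\<iota>\<^sub>K l\<^sub>n = {K, X} X\<^sup>n\<^sup>-\<^sup>2 / (n - 2)! \<plusminus> K l\<^sub>n\<^sub>-\<^sub>1\<close>, where the last term is absent for \<open>n = 2\<close>
  (\<open>unshuffle_sum_into_bracket\<close>).

  Two facts about the odd element \<open>l\<^sub>2\<close> now give everything. It squares to zero by graded
  commutativity, and \<open>{l\<^sub>2, X} = 0\<close> is the Jacobi identity. Both also hold with \<open>l\<^sub>2\<close> multiplied by
  powers of \<open>X\<close>, so already \<open>\<iota>\<close> of any \<open>l\<^sub>k\<close> in any \<open>l\<^sub>n\<close> vanishes. Hence all the \<open>l\<^sub>n\<close> and all their formal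
  linear combinations are compatible \<open>L\<^sub>\<infinity>\<close>-structures. Moreover \<open>{X\<^sup>m, X} = 2 m X\<^sup>m\<^sup>-\<^sup>1 l\<^sub>2\<close>, and counting
  coefficients gives \<open>[\<N>\<^sub>m, l\<^sub>n] = c l\<^sub>n\<^sub>+\<^sub>m\<^sub>-\<^sub>1\<close> with \<open>c\<close> the binomial coefficient of \<open>n + m - 2\<close> over \<open>m\<close>
  (\<open>unshuffle_insertion_commutator\<close>).

  So bracketing with \<open>\<Sum> b\<^sub>i \<N>\<^sub>i\<close> maps formal sums of the \<open>l\<^sub>n\<close> to formal sums of the \<open>l\<^sub>n\<close>. The weak
  Nijenhuis property follows at once. For the co-boundary property with respect to \<open>l\<^sub>n\<close>, a form
  \<open>\<Sum> \<kappa>\<^sub>i \<N>\<^sub>i\<close> with the required bracket is found by dividing by the binomial coefficients above, which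
  are nonzero unless \<open>n = 1\<close>, where \<open>l\<^sub>1 = 0\<close>.
\<close>


section \<open>Signs and the unshuffle coproduct\<close>

text \<open>
  The sign \<open>(-1)\<^sup>n\<close> as an operator on any abelian group: signs are compared through the parity of
  their exponents, without scalars.
\<close>

definition parity_sign :: "int \<Rightarrow> 'b::ab_group_add \<Rightarrow> 'b" where
  "parity_sign n x = (if even n then x else - x)"

lemma parity_sign_simps [simp]:
  "parity_sign m (parity_sign n x) = parity_sign (m + n) x"
  "parity_sign n (0 :: 'b::ab_group_add) = 0"
  "parity_sign 0 x = x"
  by (auto simp: parity_sign_def)

lemma parity_sign_add: "parity_sign n (x + y) = parity_sign n x + parity_sign n y"
  by (simp add: parity_sign_def)

lemma parity_sign_cong: "even (m - n) \<Longrightarrow> parity_sign m x = parity_sign n x"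
  by (auto simp: parity_sign_def)

lemma parity_sign_even: "even n \<Longrightarrow> parity_sign n x = x"
  by (simp add: parity_sign_def)

text \<open>
  Each letter carries a degree, because it cannot be recovered from the letter: zero is
  homogeneous of every degree.
\<close>

type_synonym 'a word = "(int \<times> 'a) list"

definition word_degree :: "'a word \<Rightarrow> int" where
  "word_degree w = sum_list (map fst w)"

lemma word_degree_simps [simp]:
  "word_degree [] = 0"
  "word_degree (x # w) = fst x + word_degree w"
  "word_degree (v @ w) = word_degree v + word_degree w"
  by (simp_all add: word_degree_def)

text \<open>
  The sum of \<open>G\<close> over the unshuffle coproduct, with blocks of all sizes. Every letter joins the left
  or the right block; a letter \<open>x\<close> that goes right is passed by the later letters that go left, which
  form the block \<open>S\<close> of the recursive call, whence the sign.
\<close>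

fun unshuffle_sum :: "'a word \<Rightarrow> ('a word \<Rightarrow> 'a word \<Rightarrow> 'b::ab_group_add) \<Rightarrow> 'b" where
  "unshuffle_sum [] G = G [] []"
| "unshuffle_sum (x # w) G =
     unshuffle_sum w (\<lambda>S R. G (x # S) R) +
     unshuffle_sum w (\<lambda>S R. parity_sign (fst x * word_degree S) (G S (x # R)))"

text \<open>
  The hypotheses on \<open>S\<close> and \<open>R\<close> are the only traces of the splitting that later signs and case
  distinctions depend on.
\<close>

lemma unshuffle_sum_cong:
  assumes "\<And>S R. set S \<union> set R = set w \<Longrightarrow> word_degree S + word_degree R = word_degree w \<Longrightarrow>
             length S + length R = length w \<Longrightarrow> G S R = H S R"
  shows "unshuffle_sum w G = unshuffle_sum w H"
  using assms
proof (induction w arbitrary: G H)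
  case (Cons x w)
  have "unshuffle_sum w (\<lambda>S R. G (x # S) R) = unshuffle_sum w (\<lambda>S R. H (x # S) R)"
    by (rule Cons.IH, rule Cons.prems) auto
  moreover have "unshuffle_sum w (\<lambda>S R. parity_sign (fst x * word_degree S) (G S (x # R))) =
      unshuffle_sum w (\<lambda>S R. parity_sign (fst x * word_degree S) (H S (x # R)))"
    by (rule Cons.IH, rule arg_cong[where f = "parity_sign _"], rule Cons.prems) auto
  ultimately show ?case
    by simp
qed simp

lemma unshuffle_sum_add:
  "unshuffle_sum w (\<lambda>S R. G S R + H S R) = unshuffle_sum w G + unshuffle_sum w H"
  by (induction w arbitrary: G H) (simp_all add: parity_sign_add)

lemma unshuffle_sum_hom:
  assumes "\<And>x y. h (x + y) = h x + h y"
  shows "h (unshuffle_sum w G) = unshuffle_sum w (\<lambda>S R. h (G S R))"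
proof -
  have "h 0 = 0"
    using assms[of 0 0] by simp
  then have "h (- x) = - h x" for x
    using assms[of x "- x"] by (simp add: eq_neg_iff_add_eq_0 add.commute)
  then have "h (parity_sign n x) = parity_sign n (h x)" for n x
    by (simp add: parity_sign_def)
  then show ?thesis
    by (induction w arbitrary: G) (simp_all add: assms)
qed

lemmas unshuffle_sum_parity_sign = unshuffle_sum_hom[where h = "parity_sign _", OF parity_sign_add]

lemma unshuffle_sum_zero [simp]: "unshuffle_sum w (\<lambda>S R. 0) = 0"
  by (induction w) simp_all

lemma unshuffle_sum_neutral:
  assumes "\<And>S R. set S \<union> set R = set w \<Longrightarrow> word_degree S + word_degree R = word_degree w \<Longrightarrow>
             length S + length R = length w \<Longrightarrow> G S R = 0"
  shows "unshuffle_sum w G = 0"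
  using unshuffle_sum_cong[of w G "\<lambda>_ _. 0"] assms by simp

lemma unshuffle_sum_right_Nil:
  "unshuffle_sum w (\<lambda>S R. if R = [] then G S else 0) = G w"
  by (induction w arbitrary: G) simp_all

lemma unshuffle_sum_sum:
  "finite I \<Longrightarrow> unshuffle_sum w (\<lambda>S R. \<Sum>i\<in>I. G i S R) = (\<Sum>i\<in>I. unshuffle_sum w (G i))"
  by (induction I rule: finite_induct) (simp_all add: unshuffle_sum_add)

lemma unshuffle_sum_by_length:
  "(\<Sum>k\<le>length w. unshuffle_sum w (\<lambda>S R. if length S = k then G S R else 0)) = unshuffle_sum w G"
proof -
  have "(\<Sum>k\<le>length w. unshuffle_sum w (\<lambda>S R. if length S = k then G S R else 0)) =
      unshuffle_sum w (\<lambda>S R. \<Sum>k\<le>length w. if length S = k then G S R else 0)"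
    by (rule unshuffle_sum_sum[symmetric]) simp
  also have "\<dots> = unshuffle_sum w G"
    by (intro unshuffle_sum_cong) (auto simp: sum.delta)
  finally show ?thesis .
qed

text \<open>
  Both sides sum over the ways to distribute the letters over three blocks, with the sign of the
  reordering.
\<close>

lemma unshuffle_sum_coassoc:
  "unshuffle_sum w (\<lambda>S R. unshuffle_sum S (\<lambda>S1 S2. G S1 S2 R)) =
   unshuffle_sum w (\<lambda>S R. unshuffle_sum R (\<lambda>R1 R2. G S R1 R2))"
proof (induction w arbitrary: G)
  case (Cons x w)
  let ?d = "\<lambda>S. fst x * word_degree S"
  have "unshuffle_sum w (\<lambda>S R. parity_sign (?d S) (unshuffle_sum S (\<lambda>S1 S2. G S1 S2 (x # R)))) =
     unshuffle_sum w (\<lambda>S R. unshuffle_sum S (\<lambda>S1 S2. parity_sign (?d S1 + ?d S2) (G S1 S2 (x # R))))"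
    unfolding unshuffle_sum_parity_sign
    by (intro unshuffle_sum_cong parity_sign_cong) (simp flip: distrib_left)
  then show ?case
    by (simp add: Cons.IH unshuffle_sum_add unshuffle_sum_parity_sign parity_sign_add add.assoc)
qed simp

text \<open>
  Exchanging the two blocks costs the sign of moving one past the other.
\<close>

lemma unshuffle_sum_cocomm:
  "unshuffle_sum w G =
   unshuffle_sum w (\<lambda>S R. parity_sign (word_degree S * word_degree R) (G R S))"
proof (induction w arbitrary: G)
  case (Cons x w)
  have "unshuffle_sum w (\<lambda>S R. G (x # S) R) =
      unshuffle_sum w (\<lambda>S R. parity_sign (fst x * word_degree S)
        (parity_sign (word_degree S * word_degree (x # R)) (G (x # R) S)))"
    by (subst Cons.IH, intro unshuffle_sum_cong, simp, intro parity_sign_cong) (simp add: algebra_simps)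
  moreover have "unshuffle_sum w (\<lambda>S R. parity_sign (fst x * word_degree S) (G S (x # R))) =
      unshuffle_sum w (\<lambda>S R. parity_sign (word_degree (x # S) * word_degree R) (G R (x # S)))"
    by (subst Cons.IH, intro unshuffle_sum_cong, simp, intro parity_sign_cong) (simp add: algebra_simps)
  ultimately show ?case
    by (simp only: unshuffle_sum.simps add.commute)
qed simp

text \<open>
  Adjacent letters that end up in different blocks contribute the same two terms to both sides,
  up to the sign; only when they stay together is the symmetry of \<open>G\<close> needed.
\<close>

lemma unshuffle_sum_swap:
  assumes x: "P x" and y: "P y" and w: "\<forall>z\<in>set us \<union> set vs. P z"
    and left: "\<And>us vs R. \<forall>z\<in>set us \<union> set vs \<union> set R. P z \<Longrightarrow>
      G (us @ x # y # vs) R = parity_sign (fst x * fst y) (G (us @ y # x # vs) R)"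
    and right: "\<And>us vs S. \<forall>z\<in>set us \<union> set vs \<union> set S. P z \<Longrightarrow>
      G S (us @ x # y # vs) = parity_sign (fst x * fst y) (G S (us @ y # x # vs))"
  shows "unshuffle_sum (us @ x # y # vs) G =
    parity_sign (fst x * fst y) (unshuffle_sum (us @ y # x # vs) G)"
  using w left right
proof (induction us arbitrary: G)
  case Nil
  let ?s = "parity_sign (fst x * fst y)"
  have P: "\<forall>z\<in>set S \<union> set R. P z" if "set S \<union> set R = set vs" for S R
    using Nil that by auto
  have 1: "unshuffle_sum vs (\<lambda>S R. G (x # y # S) R) = ?s (unshuffle_sum vs (\<lambda>S R. G (y # x # S) R))"
    unfolding unshuffle_sum_parity_sign
  proof (rule unshuffle_sum_cong)
    fix S R assume "set S \<union> set R = set vs"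
    then show "G (x # y # S) R = ?s (G (y # x # S) R)"
      using Nil(2)[of "[]" S R] P[of S R] by simp
  qed
  have 2: "unshuffle_sum vs (\<lambda>S R. parity_sign (fst x * word_degree S + fst y * word_degree S) (G S (x # y # R))) =
      ?s (unshuffle_sum vs (\<lambda>S R. parity_sign (fst y * word_degree S + fst x * word_degree S) (G S (y # x # R))))"
    unfolding unshuffle_sum_parity_sign
  proof (rule unshuffle_sum_cong)
    fix S R assume "set S \<union> set R = set vs"
    then show "parity_sign (fst x * word_degree S + fst y * word_degree S) (G S (x # y # R)) =
       ?s (parity_sign (fst y * word_degree S + fst x * word_degree S) (G S (y # x # R)))"
      using Nil(3)[of "[]" R S] P[of S R] by (simp add: algebra_simps Un_commute)
  qed
  have 3: "unshuffle_sum vs (\<lambda>S R. parity_sign (fst y * word_degree S) (G (x # S) (y # R))) =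
      ?s (unshuffle_sum vs (\<lambda>S R. parity_sign (fst y * word_degree (x # S)) (G (x # S) (y # R))))"
    unfolding unshuffle_sum_parity_sign
    by (intro unshuffle_sum_cong, simp, intro parity_sign_cong) (simp add: algebra_simps)
  have 4: "unshuffle_sum vs (\<lambda>S R. parity_sign (fst x * word_degree (y # S)) (G (y # S) (x # R))) =
      ?s (unshuffle_sum vs (\<lambda>S R. parity_sign (fst x * word_degree S) (G (y # S) (x # R))))"
    unfolding unshuffle_sum_parity_sign
    by (intro unshuffle_sum_cong, simp, intro parity_sign_cong) (simp add: algebra_simps)
  show ?case
    using 1 2 3 4 by (simp add: parity_sign_add add_ac)
next
  case (Cons u us)
  have us: "\<forall>z\<in>set us \<union> set vs. P z" and u: "P u"
    using Cons.prems(1) by auto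
  let ?G1 = "\<lambda>S R. G (u # S) R" and ?G2 = "\<lambda>S R. parity_sign (fst u * word_degree S) (G S (u # R))"
  have 1: "unshuffle_sum (us @ x # y # vs) ?G1 = parity_sign (fst x * fst y) (unshuffle_sum (us @ y # x # vs) ?G1)"
  proof (rule Cons.IH[OF us])
    fix us vs R assume "\<forall>z\<in>set us \<union> set vs \<union> set R. P z"
    then show "G (u # us @ x # y # vs) R = parity_sign (fst x * fst y) (G (u # us @ y # x # vs) R)"
      "G (u # R) (us @ x # y # vs) = parity_sign (fst x * fst y) (G (u # R) (us @ y # x # vs))"
      using Cons.prems(2)[of "u # us" vs R] Cons.prems(3)[of us vs "u # R"] u by auto
  qed
  have 2: "unshuffle_sum (us @ x # y # vs) ?G2 = parity_sign (fst x * fst y) (unshuffle_sum (us @ y # x # vs) ?G2)"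
  proof (rule Cons.IH[OF us])
    fix us vs R assume "\<forall>z\<in>set us \<union> set vs \<union> set R. P z"
    then show "?G2 (us @ x # y # vs) R = parity_sign (fst x * fst y) (?G2 (us @ y # x # vs) R)"
      "?G2 R (us @ x # y # vs) = parity_sign (fst x * fst y) (?G2 R (us @ y # x # vs))"
      using Cons.prems(2)[of us vs "u # R"] Cons.prems(3)[of "u # us" vs R] u
      by (auto intro!: parity_sign_cong simp: algebra_simps)
  qed
  show ?case
    using 1 2 by (simp add: parity_sign_add)
qed


section \<open>Unshuffles as subsets\<close>

text \<open>
  An unshuffle is determined by the set \<open>T\<close> of positions in its first block, since both blocks list
  their positions in increasing order. This turns the sum over unshuffles into a sum over subsets,
  which has the recursion of \<open>unshuffle_sum\<close>.
\<close>

lemma filter_upt_eq_map: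
  assumes "strict_mono_on {i..<j} f" and "f ` {i..<j} = T \<inter> {..<n}"
  shows "filter (\<lambda>a. a \<in> T) [0..<n] = map f [i..<j]"
proof (rule sorted_distinct_set_unique)
  show "sorted (map f [i..<j])"
    using strict_mono_on_leD[OF assms(1)] by (auto simp: sorted_iff_nth_mono)
  show "distinct (map f [i..<j])"
    using strict_mono_on_imp_inj_on[OF assms(1)] by (simp add: distinct_map)
  show "set (filter (\<lambda>a. a \<in> T) [0..<n]) = set (map f [i..<j])"
    using assms(2) by auto
qed (auto simp: sorted_wrt_filter)

lemma nths_eq_map_nth: "nths xs T = map ((!) xs) (filter (\<lambda>a. a \<in> T) [0..<length xs])"
proof -
  have "filter (\<lambda>p. snd p \<in> T) (zip xs [0..<length xs]) =
      map (\<lambda>a. (xs ! a, a)) (filter (\<lambda>a. a \<in> T) [0..<length xs])"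
  proof -
    have "zip xs [0..<length xs] = map (\<lambda>a. (xs ! a, a)) [0..<length xs]"
      by (intro nth_equalityI) auto
    then show ?thesis
      by (simp add: filter_map o_def)
  qed
  then show ?thesis
    by (simp add: nths_def o_def)
qed

lemma image_upper_unshuffle:
  assumes "\<sigma> permutes {..<n :: nat}" and "k \<le> n"
  shows "\<sigma> ` {k..<n} = - (\<sigma> ` {..<k}) \<inter> {..<n}"
proof -
  have eq: "{k..<n} = {..<n} - {..<k}"
    using assms(2) by auto
  show ?thesis
    unfolding eq image_set_diff[OF permutes_inj[OF assms(1)]] permutes_image[OF assms(1)] by auto
qed

lemma unshuffle_filter:
  assumes "\<sigma> \<in> unshuffles k (n - k)" and "k \<le> n"
  shows "filter (\<lambda>a. a \<in> \<sigma> ` {..<k}) [0..<n] = map \<sigma> [0..<k]"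
    and "filter (\<lambda>a. a \<in> - (\<sigma> ` {..<k})) [0..<n] = map \<sigma> [k..<n]"
proof -
  have \<sigma>: "\<sigma> permutes {..<n}" "strict_mono_on {0..<k} \<sigma>" "strict_mono_on {k..<n} \<sigma>"
    using assms by (auto simp: unshuffles_def atLeast0LessThan)
  show "filter (\<lambda>a. a \<in> \<sigma> ` {..<k}) [0..<n] = map \<sigma> [0..<k]"
  proof (rule filter_upt_eq_map[OF \<sigma>(2)])
    have "\<sigma> ` {..<k} \<subseteq> {..<n}"
      using image_mono[of "{..<k}" "{..<n}" \<sigma>] permutes_image[OF \<sigma>(1)] assms(2) by simp
    then show "\<sigma> ` {0..<k} = \<sigma> ` {..<k} \<inter> {..<n}"
      by (simp add: atLeast0LessThan Int_absorb2)
  qed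
  show "filter (\<lambda>a. a \<in> - (\<sigma> ` {..<k})) [0..<n] = map \<sigma> [k..<n]"
    by (rule filter_upt_eq_map[OF \<sigma>(3) image_upper_unshuffle[OF \<sigma>(1) assms(2)]])
qed

lemma unshuffle_permute_list:
  assumes "\<sigma> \<in> unshuffles k (length xs - k)" and "k \<le> length xs"
  shows "take k (permute_list \<sigma> xs) = nths xs (\<sigma> ` {..<k})"
    and "drop k (permute_list \<sigma> xs) = nths xs (- (\<sigma> ` {..<k}))"
  unfolding nths_eq_map_nth unshuffle_filter[OF assms]
  using assms(2) by (simp_all add: permute_list_def take_map drop_map)

lemma strict_mono_on_nth:
  assumes "sorted_wrt (<) (xs :: nat list)"
  shows "strict_mono_on {..<length xs} ((!) xs)"
  using assms by (auto simp: strict_mono_on_def sorted_wrt_iff_nth_less)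

lemma bij_betw_unshuffles:
  assumes "k \<le> n"
  shows "bij_betw (\<lambda>\<sigma>. \<sigma> ` {..<k}) (unshuffles k (n - k)) {T \<in> Pow {..<n}. card T = k}"
proof (rule bij_betw_imageI)
  show "inj_on (\<lambda>\<sigma>. \<sigma> ` {..<k}) (unshuffles k (n - k))"
  proof (rule inj_onI)
    fix \<sigma> \<tau> assume \<sigma>: "\<sigma> \<in> unshuffles k (n - k)" and \<tau>: "\<tau> \<in> unshuffles k (n - k)"
      and eq: "\<sigma> ` {..<k} = \<tau> ` {..<k}"
    have "map \<sigma> [0..<k] = map \<tau> [0..<k]" "map \<sigma> [k..<n] = map \<tau> [k..<n]"
      unfolding unshuffle_filter[OF \<sigma> assms, symmetric] unshuffle_filter[OF \<tau> assms, symmetric] eq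
      by (rule refl)+
    then have "\<sigma> a = \<tau> a" if "a < n" for a
      using that by (cases "a < k") auto
    moreover have "\<sigma> a = \<tau> a" if "\<not> a < n" for a
      using that \<sigma> \<tau> assms by (auto simp: unshuffles_def permutes_def)
    ultimately show "\<sigma> = \<tau>"
      by auto
  qed
  show "(\<lambda>\<sigma>. \<sigma> ` {..<k}) ` unshuffles k (n - k) = {T \<in> Pow {..<n}. card T = k}"
  proof (intro set_eqI iffI)
    fix T assume "T \<in> (\<lambda>\<sigma>. \<sigma> ` {..<k}) ` unshuffles k (n - k)"
    then obtain \<sigma> where \<sigma>: "\<sigma> permutes {..<n}" and T: "T = \<sigma> ` {..<k}"
      using assms by (auto simp: unshuffles_def)
    show "T \<in> {T \<in> Pow {..<n}. card T = k}"
      using permutes_in_image[OF \<sigma>] permutes_inj_on[OF \<sigma>] assms by (auto simp: T card_image)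
  next
    fix T assume T: "T \<in> {T \<in> Pow {..<n}. card T = k}"
    let ?P = "filter (\<lambda>a. a \<in> T) [0..<n]" and ?Q = "filter (\<lambda>a. a \<notin> T) [0..<n]"
    \<comment> \<open>The positions in \<open>T\<close> in increasing order, followed by the others.\<close>
    define \<sigma> where "\<sigma> a = (if a < n then (?P @ ?Q) ! a else a)" for a
    have len: "length ?P = k"
      using T by (subst distinct_card[symmetric]) (auto simp: Int_absorb2 subset_iff intro!: arg_cong[where f = card])
    have lenPQ: "length (?P @ ?Q) = n"
      using sum_length_filter_compl[of "\<lambda>a. a \<in> T" "[0..<n]"] by simp
    have "bij_betw ((!) (?P @ ?Q)) {..<n} {..<n}"
      by (rule bij_betw_nth) (use lenPQ in auto)
    then have "bij_betw \<sigma> {..<n} {..<n}"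
      by (rule bij_betw_cong[THEN iffD1, rotated]) (simp add: \<sigma>_def)
    then have perm: "\<sigma> permutes {..<n}"
      by (rule bij_imp_permutes) (simp add: \<sigma>_def)
    have P: "\<sigma> a = ?P ! a" if "a < k" for a
      using that assms len by (simp add: \<sigma>_def nth_append)
    have Q: "\<sigma> a = ?Q ! (a - k)" if "a \<in> {k..<n}" for a
      using that len by (simp add: \<sigma>_def nth_append)
    have sorted: "sorted_wrt (<) ?P" "sorted_wrt (<) ?Q"
      by (simp_all add: sorted_wrt_filter)
    have "strict_mono_on {..<k} \<sigma>"
      using strict_mono_on_nth[OF sorted(1)] len by (auto simp: strict_mono_on_def P)
    moreover have "strict_mono_on {k..<n} \<sigma>"
    proof (rule strict_mono_onI)
      fix a b assume ab: "a \<in> {k..<n}" "b \<in> {k..<n}" "a < b"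
      have "b - k < length ?Q" "a - k < b - k"
        using ab lenPQ len by auto
      then show "\<sigma> a < \<sigma> b"
        using sorted(2) ab by (simp add: Q sorted_wrt_iff_nth_less)
    qed
    ultimately have "\<sigma> \<in> unshuffles k (n - k)"
      using perm assms by (simp add: unshuffles_def)
    moreover have "\<sigma> ` {..<k} = set ?P"
      using len P by (auto simp: set_conv_nth)
    then have "\<sigma> ` {..<k} = T"
      using T by auto
    ultimately show "T \<in> (\<lambda>\<sigma>. \<sigma> ` {..<k}) ` unshuffles k (n - k)"
      by blast
  qed
qed

text \<open>
  The exponent of the Koszul sign of moving the letters at the positions in \<open>T\<close> to the front: each
  of them passes the earlier letters outside \<open>T\<close>.
\<close>

definition crossing_exponent :: "int list \<Rightarrow> nat set \<Rightarrow> int" where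
  "crossing_exponent ds T =
     (\<Sum>a<length ds. if a \<in> T then ds ! a * (\<Sum>b<a. if b \<in> T then 0 else ds ! b) else 0)"

lemma crossing_exponent_Cons:
  "crossing_exponent (d # ds) T =
     crossing_exponent ds {a. Suc a \<in> T} +
     (if 0 \<in> T then 0 else d * sum_list (nths ds {a. Suc a \<in> T}))"
proof -
  have "sum_list (nths ds U) = (\<Sum>a<length ds. if a \<in> U then ds ! a else 0)" for U
    by (induction ds arbitrary: U)
       (auto simp: nths_Cons sum.lessThan_Suc_shift simp del: sum.lessThan_Suc intro!: sum.cong)
  then show ?thesis
    unfolding crossing_exponent_def length_Cons sum.lessThan_Suc_shift
    by (auto simp: algebra_simps sum_distrib_left simp flip: sum.distrib intro!: sum.cong)
qed

lemma prod_minus_one_powi: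
  "finite I \<Longrightarrow> (\<Prod>i\<in>I. (-1 :: 'k::field) powi f i) = (-1) powi (\<Sum>i\<in>I. f i)"
  by (induction I rule: finite_induct) (simp_all add: power_int_add)

text \<open>
  An inversion of an unshuffle pairs a position of the first block with one of the second, so the
  inversions correspond to the crossing pairs of letters.
\<close>

lemma Koszul_sign_unshuffle:
  assumes "\<sigma> \<in> unshuffles k (length ds - k)" and "k \<le> length ds"
  shows "Koszul_sign ds \<sigma> = (-1 :: 'k::real_normed_field) powi (crossing_exponent ds (\<sigma> ` {..<k}))"
proof -
  let ?n = "length ds" and ?T = "\<sigma> ` {..<k}"
  have \<sigma>: "\<sigma> permutes {..<?n}" "strict_mono_on {..<k} \<sigma>" "strict_mono_on {k..<?n} \<sigma>"
    using assms by (auto simp: unshuffles_def)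
  note inj = permutes_inj[OF \<sigma>(1), THEN inj_eq]
  define C where "C = {(a, b). b < a \<and> a < ?n \<and> a \<in> ?T \<and> b \<notin> ?T}"
  have finC: "finite C"
    by (rule finite_subset[of _ "{..<?n} \<times> {..<?n}"]) (auto simp: C_def)
  have "bij_betw (map_prod \<sigma> \<sigma>) (inversions_below ?n \<sigma>) C"
  proof (rule bij_betw_imageI)
    show "inj_on (map_prod \<sigma> \<sigma>) (inversions_below ?n \<sigma>)"
      by (auto simp: inj_on_def inj)
    show "map_prod \<sigma> \<sigma> ` inversions_below ?n \<sigma> = C"
    proof (intro equalityI subrelI)
      fix a b assume "(a, b) \<in> map_prod \<sigma> \<sigma> ` inversions_below ?n \<sigma>"
      then obtain i j where ij: "a = \<sigma> i" "b = \<sigma> j" "i < j" "j < ?n" "\<sigma> j < \<sigma> i"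
        by (auto simp: inversions_below_def)
      have "\<not> j < k"
        using ij strict_mono_onD[OF \<sigma>(2), of i j] by auto
      moreover have "\<not> i \<ge> k"
        using ij strict_mono_onD[OF \<sigma>(3), of i j] by auto
      ultimately show "(a, b) \<in> C"
        using ij permutes_in_image[OF \<sigma>(1), of i] by (auto simp: C_def inj)
    next
      fix a b assume "(a, b) \<in> C"
      then obtain i where i: "a = \<sigma> i" "i < k" and ab: "b < a" "a < ?n" "b \<notin> ?T"
        by (auto simp: C_def)
      have "b \<in> \<sigma> ` {..<?n}"
        unfolding permutes_image[OF \<sigma>(1)] using ab by simp
      then obtain j where j: "b = \<sigma> j" "j < ?n"
        by blast
      then have "\<not> j < k"
        using ab by auto
      then have "(i, j) \<in> inversions_below ?n \<sigma>"
        using i j ab by (auto simp: inversions_below_def)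
      then show "(a, b) \<in> map_prod \<sigma> \<sigma> ` inversions_below ?n \<sigma>"
        using i j by (force simp: image_iff)
    qed
  qed
  from prod.reindex_bij_betw[OF this, of "\<lambda>(a, b). (-1 :: 'k) powi (ds ! a * ds ! b)"]
  have "Koszul_sign ds \<sigma> = (\<Prod>p\<in>C. (-1 :: 'k) powi (ds ! fst p * ds ! snd p))"
    by (simp add: Koszul_sign_def case_prod_unfold)
  also have "\<dots> = (-1) powi (\<Sum>p\<in>C. ds ! fst p * ds ! snd p)"
    by (rule prod_minus_one_powi[OF finC])
  also have "(\<Sum>p\<in>C. ds ! fst p * ds ! snd p) = crossing_exponent ds ?T"
  proof -
    have "C = Sigma {a \<in> {..<?n}. a \<in> ?T} (\<lambda>a. {b \<in> {..<a}. b \<notin> ?T})"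
      by (auto simp: C_def)
    then have "(\<Sum>p\<in>C. ds ! fst p * ds ! snd p) =
        (\<Sum>a\<in>{a \<in> {..<?n}. a \<in> ?T}. \<Sum>b\<in>{b \<in> {..<a}. b \<notin> ?T}. ds ! a * ds ! b)"
      by (simp add: sum.Sigma case_prod_unfold)
    also have "\<dots> = crossing_exponent ds ?T"
    proof -
      have "(\<Sum>b\<in>{b \<in> {..<a}. b \<notin> ?T}. ds ! a * ds ! b) =
          ds ! a * (\<Sum>b<a. if b \<in> ?T then 0 else ds ! b)" for a
        by (subst sum.inter_filter) (auto simp: sum_distrib_left intro!: sum.cong)
      then show ?thesis
        unfolding crossing_exponent_def by (simp only: sum.inter_filter[OF finite_lessThan])
    qed
    finally show ?thesis .
  qed
  finally show ?thesis .
qed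

text \<open>
  Subsets of the positions of \<open>x # w\<close> either contain 0 or not, and are otherwise subsets of the
  shifted positions of \<open>w\<close>.
\<close>

lemma unshuffle_sum_subsets:
  "unshuffle_sum w G =
     (\<Sum>T\<in>Pow {..<length w}. parity_sign (crossing_exponent (map fst w) T) (G (nths w T) (nths w (- T))))"
proof (induction w arbitrary: G)
  case Nil
  show ?case
    by (simp add: crossing_exponent_def)
next
  case (Cons x w)
  let ?P = "Pow {..<length w}"
  let ?g = "\<lambda>T. parity_sign (crossing_exponent (map fst (x # w)) T) (G (nths (x # w) T) (nths (x # w) (- T)))"
  have Pow: "Pow {..<length (x # w)} = (\<lambda>T. insert 0 (Suc ` T)) ` ?P \<union> (`) Suc ` ?P"
    using image_Pow_surj[OF refl, of Suc "{..<length w}"]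
    by (simp add: lessThan_Suc_eq_insert_0 Pow_insert image_image Un_commute flip: image_image)
  have inj: "inj_on (\<lambda>T. insert 0 (Suc ` T)) ?P" "inj_on ((`) Suc) ?P"
    by (auto intro!: inj_onI simp: inj_image_eq_iff insert_eq_iff dest!: insert_ident[THEN iffD1, rotated 2])
  have "(\<Sum>T\<in>Pow {..<length (x # w)}. ?g T) =
      (\<Sum>T\<in>?P. ?g (insert 0 (Suc ` T))) + (\<Sum>T\<in>?P. ?g (Suc ` T))"
    unfolding Pow by (subst sum.union_disjoint) (auto simp: sum.reindex[OF inj(1)] sum.reindex[OF inj(2)])
  also have "(\<Sum>T\<in>?P. ?g (insert 0 (Suc ` T))) = unshuffle_sum w (\<lambda>S R. G (x # S) R)"
  proof -
    have "{a. Suc a \<in> insert 0 (Suc ` T)} = T" "{a. Suc a \<in> - insert 0 (Suc ` T)} = - T" for T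
      by auto
    then show ?thesis
      by (simp add: Cons.IH crossing_exponent_Cons nths_Cons del: Compl_insert insert_iff)
         (simp)
  qed
  also have "(\<Sum>T\<in>?P. ?g (Suc ` T)) =
      unshuffle_sum w (\<lambda>S R. parity_sign (fst x * word_degree S) (G S (x # R)))"
  proof -
    have "{a. Suc a \<in> Suc ` T} = T" "{a. Suc a \<in> - (Suc ` T)} = - T" for T
      by auto
    then show ?thesis
      by (simp add: Cons.IH crossing_exponent_Cons nths_Cons word_degree_def nths_map add.commute)
  qed
  finally show ?case
    by simp
qed

lemma (in vector_space) scale_minus_one_powi:
  "scale ((-1) powi n) x = parity_sign n x"
proof -
  have "(-1 :: 'a) powi n = (if even n then 1 else -1)"
    by (auto simp: power_int_def even_nat_iff)
  then show ?thesis
    by (simp add: parity_sign_def)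
qed


section \<open>Multilinear maps and multilinear extensions\<close>

lemma (in graded_vector_space) linear_iff_additive_homogeneous:
  "Vector_Spaces.linear scale scale f \<longleftrightarrow>
     (\<forall>x y. f (x + y) = f x + f y) \<and> (\<forall>c x. f (scale c x) = scale c (f x))"
  using vector_space_axioms by (simp add: Vector_Spaces.linear_iff)

text \<open>
  The bridge between sums over permutations and the recursion on words; sums over unshuffles are
  handled by that recursion from here on.
\<close>

lemma (in graded_vector_space) unshuffle_insertion_eq_unshuffle_sum:
  assumes "length ds = length xs" and "k \<le> length xs"
  shows "unshuffle_insertion scale k K L ds xs =
    unshuffle_sum (zip ds xs) (\<lambda>S R. if length S = k then L (K (map snd S) # map snd R) else 0)"
proof -
  let ?n = "length xs"
  let ?g = "\<lambda>T. parity_sign (crossing_exponent ds T) (L (K (nths xs T) # nths xs (- T)))"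
  have "unshuffle_insertion scale k K L ds xs = (\<Sum>\<sigma>\<in>unshuffles k (?n - k). ?g (\<sigma> ` {..<k}))"
    unfolding unshuffle_insertion_def
  proof (rule sum.cong[OF refl])
    fix \<sigma> assume \<sigma>: "\<sigma> \<in> unshuffles k (?n - k)"
    then have "Koszul_sign ds \<sigma> = (-1 :: 'k) powi crossing_exponent ds (\<sigma> ` {..<k})"
      using assms by (intro Koszul_sign_unshuffle) simp_all
    then show "scale (Koszul_sign ds \<sigma>) (L (K (take k (permute_list \<sigma> xs)) # drop k (permute_list \<sigma> xs))) =
        ?g (\<sigma> ` {..<k})"
      by (simp add: scale_minus_one_powi unshuffle_permute_list[OF \<sigma> assms(2)])
  qed
  also have "\<dots> = (\<Sum>T | T \<in> Pow {..<?n} \<and> card T = k. ?g T)"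
    by (rule sum.reindex_bij_betw[OF bij_betw_unshuffles[OF assms(2)]])
  also have "\<dots> = (\<Sum>T\<in>Pow {..<?n}. if card T = k then ?g T else 0)"
    by (rule sum.inter_filter) simp
  also have "\<dots> = unshuffle_sum (zip ds xs) (\<lambda>S R. if length S = k then L (K (map snd S) # map snd R) else 0)"
    unfolding unshuffle_sum_subsets
  proof (rule sum.cong)
    fix T assume "T \<in> Pow {..<length (zip ds xs)}"
    then have "{i. i < ?n \<and> i \<in> T} = T"
      using assms(1) by auto
    then show "(if card T = k then ?g T else 0) =
      parity_sign (crossing_exponent (map fst (zip ds xs)) T)
        (if length (nths (zip ds xs) T) = k
         then L (K (map snd (nths (zip ds xs) T)) # map snd (nths (zip ds xs) (- T))) else 0)"
      using assms(1) by (simp add: length_nths flip: nths_map)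
  qed (use assms(1) in simp)
  finally show ?thesis .
qed

lemma permute_list_update:
  assumes "\<sigma> permutes {..<length xs}" and "i < length xs"
  shows "permute_list \<sigma> (xs[i := x]) = (permute_list \<sigma> xs)[inv \<sigma> i := x]"
proof (rule nth_equalityI)
  fix a assume "a < length (permute_list \<sigma> (xs[i := x]))"
  moreover have "\<sigma> a < length xs \<longleftrightarrow> a < length xs" "inv \<sigma> i = a \<longleftrightarrow> i = \<sigma> a"
      "inv \<sigma> (\<sigma> a) = a"
    using permutes_in_image[OF assms(1), of a] permutes_inv_eq[OF assms(1)]
      permutes_inverses(2)[OF assms(1)] by auto
  ultimately show "permute_list \<sigma> (xs[i := x]) ! a = (permute_list \<sigma> xs)[inv \<sigma> i := x] ! a"
    using assms by (cases "i = \<sigma> a") (simp_all add: permute_list_def nth_list_update)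
qed simp

lemma (in graded_vector_space) multilinear_add_scale:
  assumes "multilinear scale K" and "i < length xs"
  shows "K (xs[i := x + y]) = K (xs[i := x]) + K (xs[i := y])"
    and "K (xs[i := scale c x]) = scale c (K (xs[i := x]))"
  using assms by (auto simp: multilinear_def linear_iff_additive_homogeneous)

lemma (in graded_vector_space) multilinear_add_scale_Cons:
  assumes "multilinear scale K"
  shows "K ((x + y) # xs) = K (x # xs) + K (y # xs)"
    and "K (scale c x # xs) = scale c (K (x # xs))"
  using multilinear_add_scale[OF assms, of 0 "0 # xs"] by simp_all

lemma (in graded_vector_space) multilinear_zero:
  assumes "multilinear scale K" and "0 \<in> set xs"
  shows "K xs = 0"
proof -
  obtain i where i: "i < length xs" "xs ! i = 0"
    using assms(2) by (auto simp: in_set_conv_nth)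
  have "K (xs[i := scale 0 0]) = scale 0 (K (xs[i := 0]))"
    by (rule multilinear_add_scale[OF assms(1) i(1)])
  then show ?thesis
    using i by (metis list_update_id scale_zero_left)
qed

lemma (in graded_vector_space) unshuffle_insertion_linear:
  assumes K: "multilinear scale K" and L: "multilinear scale L"
    and k: "k \<le> length xs" and i: "i < length xs"
  shows "Vector_Spaces.linear scale scale (\<lambda>x. unshuffle_insertion scale k K L ds (xs[i := x]))"
proof -
  let ?f = "\<lambda>\<sigma> xs. L (K (take k (permute_list \<sigma> xs)) # drop k (permute_list \<sigma> xs))"
  have "Vector_Spaces.linear scale scale (\<lambda>x. ?f \<sigma> (xs[i := x]))"
    if \<sigma>: "\<sigma> \<in> unshuffles k (length xs - k)" for \<sigma>
  proof -
    have perm: "\<sigma> permutes {..<length xs}"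
      using \<sigma> k by (auto simp: unshuffles_def)
    let ?ys = "permute_list \<sigma> xs" and ?j = "inv \<sigma> i"
    have j: "?j < length xs"
      using permutes_in_image[OF permutes_inv[OF perm], of i] i by simp
    note upd = permute_list_update[OF perm i]
    show ?thesis
    proof (cases "?j < k")
      case True
      then have "?f \<sigma> (xs[i := x]) = L ((K ((take k ?ys)[?j := x]) # drop k ?ys))" for x
        by (simp add: upd take_update_swap)
      then show ?thesis
        using True j k
        by (simp add: linear_iff_additive_homogeneous multilinear_add_scale[OF K]
            multilinear_add_scale_Cons[OF L])
    next
      case False
      then have "?f \<sigma> (xs[i := x]) = L ((K (take k ?ys) # drop k ?ys)[Suc (?j - k) := x])" for x
        by (simp add: upd drop_update_swap)
      then show ?thesis
        using False j k
          L[unfolded multilinear_def, rule_format, of "Suc (?j - k)" "K (take k ?ys) # drop k ?ys"]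
        by simp
    qed
  qed
  then show ?thesis
    by (auto simp: unshuffle_insertion_def linear_iff_additive_homogeneous scale_right_distrib
        sum.distrib scale_sum_right scale_left_commute intro!: sum.cong)
qed

context graded_vector_space
begin

lemma homogeneous_decomposition_component: "homogeneous_decomposition V x (component V x)"
  unfolding component_def by (rule theI'[OF direct_sum])

lemma component_mem: "component V x i \<in> V i"
  using homogeneous_decomposition_component[of x] by (simp add: homogeneous_decomposition_def)

lemma finite_component_degrees: "finite (component_degrees V x)"
  using homogeneous_decomposition_component[of x]
  by (simp add: homogeneous_decomposition_def component_degrees_def)

lemma sum_component:
  assumes "finite I" and "component_degrees V x \<subseteq> I"
  shows "(\<Sum>i\<in>I. component V x i) = x"
proof -
  have "(\<Sum>i\<in>I. component V x i) = (\<Sum>i\<in>component_degrees V x. component V x i)"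
    using assms by (intro sum.mono_neutral_right) (auto simp: component_degrees_def)
  then show ?thesis
    using homogeneous_decomposition_component[of x]
    by (simp add: homogeneous_decomposition_def component_degrees_def)
qed

text \<open>
  Uniqueness of the homogeneous decomposition, allowing an index set larger than the support.
\<close>

lemma component_eqI:
  assumes "finite I" and "\<And>i. f i \<in> V i" and "\<And>i. i \<notin> I \<Longrightarrow> f i = 0" and "x = (\<Sum>i\<in>I. f i)"
  shows "component V x = f"
proof -
  have "{i. f i \<noteq> 0} \<subseteq> I"
    using assms(3) by auto
  then have "homogeneous_decomposition V x f"
    unfolding homogeneous_decomposition_def using assms
    by (auto intro: finite_subset sum.mono_neutral_right)
  then show ?thesis
    unfolding component_def by (rule the1_equality[OF direct_sum])
qed

lemma component_add: "component V (x + y) = (\<lambda>i. component V x i + component V y i)"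
proof (rule component_eqI)
  let ?I = "component_degrees V x \<union> component_degrees V y"
  show fin: "finite ?I"
    by (simp add: finite_component_degrees)
  show "component V x i + component V y i \<in> V i" for i
    by (intro subspace_add subspace_homogeneous component_mem)
  show "x + y = (\<Sum>i\<in>?I. component V x i + component V y i)"
    using sum_component[OF fin] by (simp add: sum.distrib)
qed (simp add: component_degrees_def)

lemma component_scale: "component V (scale c x) = (\<lambda>i. scale c (component V x i))"
proof (rule component_eqI)
  show "scale c (component V x i) \<in> V i" for i
    by (intro subspace_scale subspace_homogeneous component_mem)
  show "scale c x = (\<Sum>i\<in>component_degrees V x. scale c (component V x i))"
    using sum_component[OF finite_component_degrees order_refl] by (simp flip: scale_sum_right)
qed (simp_all add: component_degrees_def finite_component_degrees[unfolded component_degrees_def])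

lemma multilinear_extension_Cons:
  "multilinear_extension V F (x # xs) =
     (\<Sum>d\<in>component_degrees V x.
        multilinear_extension V (\<lambda>ds ys. F (d # ds) (component V x d # ys)) xs)"
proof -
  have set_Cons: "set_Cons A B = (\<lambda>(d, ds). d # ds) ` (A \<times> B)" for A :: "int set" and B
    by (auto simp: set_Cons_def)
  have inj: "inj_on (\<lambda>(d, ds). d # ds) (A \<times> B)" for A :: "int set" and B
    by (auto simp: inj_on_def)
  show ?thesis
    unfolding multilinear_extension_def list.map listset.simps set_Cons sum.reindex[OF inj]
      sum.cartesian_product
    by (simp add: case_prod_unfold)
qed

lemma multilinear_extension_Nil: "multilinear_extension V F [] = F [] []"
  by (simp add: multilinear_extension_def)

text \<open>
  Extensions are evaluated only at nonzero homogeneous components. This is the principle by which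
  identities between forms are reduced to homogeneous arguments.
\<close>

lemma multilinear_extension_cong:
  assumes "\<And>ds ys. homogeneous_list V ds ys \<Longrightarrow> 0 \<notin> set ys \<Longrightarrow> length ys = length xs \<Longrightarrow> F ds ys = G ds ys"
  shows "multilinear_extension V F xs = multilinear_extension V G xs"
  using assms
proof (induction xs arbitrary: F G)
  case Nil
  then show ?case
    by (simp add: multilinear_extension_Nil homogeneous_list_def)
next
  case (Cons x xs)
  show ?case
    unfolding multilinear_extension_Cons
  proof (intro sum.cong refl Cons.IH Cons.prems)
    fix d ds ys
    assume "d \<in> component_degrees V x" "homogeneous_list V ds ys" "0 \<notin> set ys" "length ys = length xs"
    then show "homogeneous_list V (d # ds) (component V x d # ys)" "0 \<notin> set (component V x d # ys)"
        "length (component V x d # ys) = length (x # xs)"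
      by (auto simp: homogeneous_list_def component_mem component_degrees_def)
  qed
qed

text \<open>
  A form that arises by extension is thus recovered from its values on homogeneous arguments.
\<close>

lemma multilinear_extension_idem:
  "multilinear_extension V (\<lambda>ds. multilinear_extension V F) = multilinear_extension V F"
  by (intro ext multilinear_extension_cong multilinear_extension_homogeneous)

lemma multilinear_extension_diff:
  "multilinear_extension V (\<lambda>ds xs. F ds xs - G ds xs) xs =
     multilinear_extension V F xs - multilinear_extension V G xs"
  by (simp add: multilinear_extension_def sum_subtractf)

lemma multilinear_extension_scale:
  "multilinear_extension V (\<lambda>ds xs. scale c (F ds xs)) xs = scale c (multilinear_extension V F xs)"
  by (simp add: multilinear_extension_def scale_sum_right)

lemma multilinear_extension_linear_param:
  assumes "\<And>ds ys. Vector_Spaces.linear scale scale (\<lambda>z. F z ds ys)"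
  shows "Vector_Spaces.linear scale scale (\<lambda>z. multilinear_extension V (F z) xs)"
  using assms by (simp add: linear_iff_additive_homogeneous multilinear_extension_def sum.distrib scale_sum_right)

text \<open>
  In the first argument, the sum over the components can be taken over a common finite set of
  degrees for all vectors involved, because a linear expression vanishes at zero components.
\<close>

lemma multilinear_extension_linear:
  assumes "\<And>ds ys j. j < length ys \<Longrightarrow> Vector_Spaces.linear scale scale (\<lambda>z. F ds (ys[j := z]))"
    and "i < length xs"
  shows "Vector_Spaces.linear scale scale (\<lambda>z. multilinear_extension V F (xs[i := z]))"
  using assms
proof (induction xs arbitrary: F i)
  case (Cons x xs)
  have lin: "Vector_Spaces.linear scale scale (\<lambda>z. multilinear_extension V (\<lambda>ds ys. F (d # ds) (z # ys)) xs)" for d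
    using Cons.prems(1)[of 0 "0 # ys" "d # ds" for ys ds]
    by (intro multilinear_extension_linear_param) simp
  show ?case
  proof (cases i)
    case 0
    let ?H = "\<lambda>d z. multilinear_extension V (\<lambda>ds ys. F (d # ds) (z # ys)) xs"
    have H: "?H d (u + v) = ?H d u + ?H d v" "?H d (scale c u) = scale c (?H d u)" for d u v c
      using lin by (auto simp: linear_iff_additive_homogeneous)
    have H0: "?H d 0 = 0" for d
      using H(2)[of d 0 0] by simp
    have eq: "multilinear_extension V F (z # xs) = (\<Sum>d\<in>I. ?H d (component V z d))"
      if "finite I" "component_degrees V z \<subseteq> I" for z I
      unfolding multilinear_extension_Cons using that
      by (intro sum.mono_neutral_left) (auto simp: component_degrees_def H0)
    have "multilinear_extension V F ((u + v) # xs) =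
        multilinear_extension V F (u # xs) + multilinear_extension V F (v # xs)" for u v
    proof -
      let ?I = "component_degrees V u \<union> component_degrees V v \<union> component_degrees V (u + v)"
      have "finite ?I"
        by (simp add: finite_component_degrees)
      note eq' = eq[OF this]
      show ?thesis
        by (subst (1 2 3) eq') (auto simp: component_add H sum.distrib)
    qed
    moreover have "multilinear_extension V F (scale c u # xs) =
        scale c (multilinear_extension V F (u # xs))" for c u
    proof -
      let ?I = "component_degrees V u \<union> component_degrees V (scale c u)"
      have "finite ?I"
        by (simp add: finite_component_degrees)
      note eq' = eq[OF this]
      show ?thesis
        by (subst (1 2) eq') (auto simp: component_scale H scale_sum_right)
    qed
    ultimately show ?thesis
      using 0 by (simp add: linear_iff_additive_homogeneous)
  next
    case (Suc j)
    have "Vector_Spaces.linear scale scale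
      (\<lambda>z. multilinear_extension V (\<lambda>ds ys. F (d # ds) (component V x d # ys)) (xs[j := z]))" for d
    proof (rule Cons.IH)
      show "j < length xs"
        using Suc Cons.prems(2) by simp
      fix ds j and ys :: "'a list" assume "j < length ys"
      then show "Vector_Spaces.linear scale scale (\<lambda>z. F (d # ds) (component V x d # ys[j := z]))"
        using Cons.prems(1)[of "Suc j" "component V x d # ys" "d # ds"] by simp
    qed
    then show ?thesis
      using Suc by (simp add: multilinear_extension_Cons linear_iff_additive_homogeneous sum.distrib scale_sum_right)
  qed
qed simp

end


section \<open>Graded symmetry from adjacent swaps\<close>

context graded_vector_space
begin

text \<open>
  Sorting a permutation by adjacent transpositions removes one inversion at a time, and the Koszul
  sign records exactly the factors collected on the way.
\<close>

lemma graded_symmetricI: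
  assumes swap: "\<And>us vs ds es x y p q. homogeneous_list V ds us \<Longrightarrow> homogeneous_list V es vs \<Longrightarrow>
    x \<in> V p \<Longrightarrow> y \<in> V q \<Longrightarrow> K (us @ x # y # vs) = parity_sign (p * q) (K (us @ y # x # vs))"
  shows "graded_symmetric scale V K"
  unfolding graded_symmetric_def
proof (intro allI impI)
  fix ds xs \<sigma> assume hom: "homogeneous_list V ds xs" and "\<sigma> permutes {..<length xs}"
  have len: "length ds = length xs" and nth: "\<And>k. k < length xs \<Longrightarrow> xs ! k \<in> V (ds ! k)"
    using hom by (auto simp: homogeneous_list_def list_all2_conv_all_nth)
  from \<open>\<sigma> permutes {..<length xs}\<close>
  show "K (permute_list \<sigma> xs) = scale (Koszul_sign ds \<sigma>) (K xs)"
  proof (induction "card (inversions_below (length xs) \<sigma>)" arbitrary: \<sigma> rule: less_induct)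
    case less
    let ?n = "length xs"
    show ?case
    proof (cases "\<exists>i. Suc i < ?n \<and> \<sigma> (Suc i) < \<sigma> i")
      case False
      then have "\<sigma> = id"
        using no_descent_imp_id[OF less.prems] by (meson not_less)
      moreover have "inversions_below m id = {}" for m
        by (auto simp: inversions_below_def)
      ultimately show ?thesis
        by (simp add: Koszul_sign_def)
    next
      case True
      then obtain i where i: "Suc i < ?n" "\<sigma> (Suc i) < \<sigma> i"
        by blast
      let ?s = "transpose i (Suc i)"
      let ?ys = "permute_list \<sigma> xs" and ?zs = "permute_list (\<sigma> \<circ> ?s) xs" and ?es = "permute_list \<sigma> ds"
      have perm: "\<sigma> \<circ> ?s permutes {..<?n}"
        using less.prems i by (intro permutes_compose permutes_swap_id) auto
      have "card (inversions_below ?n (\<sigma> \<circ> ?s)) = card (inversions_below ?n \<sigma> - {(i, Suc i)})"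
        using bij_betw_same_card[OF inversions_below_transpose[OF i]] .
      also have "\<dots> < card (inversions_below ?n \<sigma>)"
        using i by (intro psubset_card_mono finite_inversions_below) (auto simp: inversions_below_def)
      finally have IH: "K ?zs = scale (Koszul_sign ds (\<sigma> \<circ> ?s)) (K xs)"
        using less.hyps perm by blast
      let ?us = "take i ?ys" and ?vs = "drop (Suc (Suc i)) ?ys"
      have "?ys = ?us @ ?ys ! i # ?ys ! Suc i # ?vs"
        using i by (simp add: Cons_nth_drop_Suc)
      then have ys: "?ys = ?us @ xs ! \<sigma> i # xs ! \<sigma> (Suc i) # ?vs"
        using i by (simp add: permute_list_def)
      have zs: "?zs = ?us @ xs ! \<sigma> (Suc i) # xs ! \<sigma> i # ?vs"
        using i by (intro nth_equalityI)
          (auto simp: permute_list_def nth_append nth_Cons transpose_def split: nat.splits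
             intro!: arg_cong[where f = "\<lambda>k. xs ! \<sigma> k"])
      have \<sigma>: "\<sigma> k < ?n" if "k < ?n" for k
        using permutes_in_image[OF less.prems, of k] that by simp
      have "homogeneous_list V ?es ?ys"
        using len nth \<sigma> by (auto simp: homogeneous_list_def list_all2_conv_all_nth permute_list_def)
      then have "homogeneous_list V (take i ?es) ?us" "homogeneous_list V (drop (Suc (Suc i)) ?es) ?vs"
        by (simp_all add: homogeneous_list_def list_all2_takeI list_all2_dropI)
      then have "K ?ys = parity_sign (ds ! \<sigma> i * ds ! \<sigma> (Suc i)) (K ?zs)"
        unfolding zs using swap nth \<sigma> i ys by (metis Suc_lessD)
      then show ?thesis
        using IH Koszul_sign_transpose[of i ds \<sigma>, where 'a = 'k] i len
        by (simp flip: scale_minus_one_powi)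
    qed
  qed
qed

section \<open>Convolution of forms on words\<close>

definition homogeneous_word :: "'a word \<Rightarrow> bool" where
  "homogeneous_word w \<longleftrightarrow> (\<forall>(d, x)\<in>set w. x \<in> V d)"

lemma homogeneous_word_simps [simp]:
  "homogeneous_word []"
  "homogeneous_word (p # w) \<longleftrightarrow> snd p \<in> V (fst p) \<and> homogeneous_word w"
  by (auto simp: homogeneous_word_def)

lemma homogeneous_word_Un_iff:
  assumes "set S \<union> set R = set w"
  shows "homogeneous_word w \<longleftrightarrow> homogeneous_word S \<and> homogeneous_word R"
  unfolding homogeneous_word_def assms[symmetric] by auto

lemma homogeneous_word_zip:
  "homogeneous_list V ds xs \<Longrightarrow> homogeneous_word (zip ds xs)"
  by (auto simp: homogeneous_list_def homogeneous_word_def list_all2_iff)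

lemma homogeneous_list_map:
  "homogeneous_word w \<Longrightarrow> homogeneous_list V (map fst w) (map snd w)"
  by (induction w) (auto simp: homogeneous_list_def)

lemma parity_sign_mem: "x \<in> V d \<Longrightarrow> parity_sign n x \<in> V d"
  by (simp add: parity_sign_def subspace_neg subspace_homogeneous)

lemma unshuffle_sum_mem:
  assumes "\<And>S R. set S \<union> set R = set w \<Longrightarrow> word_degree S + word_degree R = word_degree w \<Longrightarrow>
    G S R \<in> V d"
  shows "unshuffle_sum w G \<in> V d"
  using assms
proof (induction w arbitrary: G)
  case (Cons x w)
  have "unshuffle_sum w (\<lambda>S R. G (x # S) R) \<in> V d"
    by (rule Cons.IH, rule Cons.prems) auto
  moreover have "unshuffle_sum w (\<lambda>S R. parity_sign (fst x * word_degree S) (G S (x # R))) \<in> V d"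
    by (rule Cons.IH, rule parity_sign_mem, rule Cons.prems) auto
  ultimately show ?case
    by (simp add: subspace_add subspace_homogeneous)
qed simp

text \<open>
  All words are included: the forms that occur vanish on words that are not homogeneous, and zero
  lies in every \<open>V d\<close>. Identities of such forms then hold as equations between functions.
\<close>

definition homogeneous_form :: "int \<Rightarrow> ('a word \<Rightarrow> 'a) \<Rightarrow> bool" where
  "homogeneous_form e f \<longleftrightarrow> (\<forall>w. f w \<in> V (word_degree w + e))"

lemma homogeneous_formD: "homogeneous_form e f \<Longrightarrow> f w \<in> V (word_degree w + e)"
  by (simp add: homogeneous_form_def)

definition word_form :: "'a vform \<Rightarrow> 'a word \<Rightarrow> 'a" where
  "word_form K w = (if homogeneous_word w then K (map snd w) else 0)"

text \<open>
  The identity map as a 1-form on words, called \<open>X\<close> in the introduction.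
\<close>

definition letter :: "'a word \<Rightarrow> 'a" where
  "letter = word_form (\<lambda>xs. if length xs = 1 then hd xs else 0)"

lemma letter_simps [simp]:
  "letter [] = 0"
  "snd x \<in> V (fst x) \<Longrightarrow> homogeneous_word w \<Longrightarrow> letter (x # w) = (if w = [] then snd x else 0)"
  by (simp_all add: letter_def word_form_def)

lemma letter_eq_0: "length w \<noteq> 1 \<Longrightarrow> letter w = 0"
  by (simp add: letter_def word_form_def)

lemma zero_mem: "0 \<in> V d"
  by (simp add: subspace_0 subspace_homogeneous)

lemma homogeneous_form_letter: "homogeneous_form 0 letter"
  unfolding homogeneous_form_def
proof
  fix w show "letter w \<in> V (word_degree w + 0)"
    by (cases w) (auto simp: zero_mem letter_def word_form_def)
qed

text \<open>
  The sign is that of \<open>(f \<otimes> g)(S \<otimes> R)\<close>, with \<open>e\<close> the degree of \<open>g\<close>, which passes \<open>S\<close>. The degree is an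
  argument since it is not determined by \<open>g\<close>.
\<close>

definition convolution ::
    "('a \<Rightarrow> 'a \<Rightarrow> 'a) \<Rightarrow> int \<Rightarrow> ('a word \<Rightarrow> 'a) \<Rightarrow> ('a word \<Rightarrow> 'a) \<Rightarrow> 'a word \<Rightarrow> 'a" where
  "convolution m e f g w = unshuffle_sum w (\<lambda>S R. parity_sign (e * word_degree S) (m (f S) (g R)))"

lemma bilinear_map_simps:
  assumes "bilinear_map scale m"
  shows "m (x + y) z = m x z + m y z" "m x (y + z) = m x y + m x z"
    "m (scale c x) y = scale c (m x y)" "m x (scale c y) = scale c (m x y)"
    "m 0 y = 0" "m x 0 = 0"
    "m (parity_sign n x) y = parity_sign n (m x y)" "m x (parity_sign n y) = parity_sign n (m x y)"
proof -
  show add: "m (x + y) z = m x z + m y z" "m x (y + z) = m x y + m x z" for x y z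
    using assms by (auto simp: bilinear_map_def linear_iff_additive_homogeneous)
  show scale: "m (scale c x) y = scale c (m x y)" "m x (scale c y) = scale c (m x y)" for x y c
    using assms by (auto simp: bilinear_map_def linear_iff_additive_homogeneous)
  show "m 0 y = 0" "m x 0 = 0"
    using scale(1)[of 0 0 y] scale(2)[of x 0 0] by simp_all
  show "m (parity_sign n x) y = parity_sign n (m x y)" "m x (parity_sign n y) = parity_sign n (m x y)"
    by (simp_all add: scale flip: scale_minus_one_powi)
qed

lemma scale_of_nat_Suc: "scale (of_nat (Suc n)) x = x + scale (of_nat n) x"
  by (simp add: scale_left_distrib)

lemma scale_parity_sign: "scale c (parity_sign n x) = parity_sign n (scale c x)"
  by (simp add: parity_sign_def)

lemma unshuffle_sum_bilinear:
  assumes "bilinear_map scale m"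
  shows "m (unshuffle_sum w G) z = unshuffle_sum w (\<lambda>S R. m (G S R) z)"
    and "m z (unshuffle_sum w G) = unshuffle_sum w (\<lambda>S R. m z (G S R))"
  by (rule unshuffle_sum_hom, simp add: bilinear_map_simps[OF assms])+

lemma homogeneous_form_convolution:
  assumes m: "\<And>x y p q. x \<in> V p \<Longrightarrow> y \<in> V q \<Longrightarrow> m x y \<in> V (p + q + r)"
    and f: "homogeneous_form d f" and g: "homogeneous_form d' g"
  shows "homogeneous_form (d + d' + r) (convolution m e f g)"
  unfolding homogeneous_form_def convolution_def
proof (intro allI unshuffle_sum_mem parity_sign_mem)
  fix w S R :: "'a word" assume deg: "word_degree S + word_degree R = word_degree w"
  have "m (f S) (g R) \<in> V ((word_degree S + d) + (word_degree R + d') + r)"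
    by (intro m homogeneous_formD[OF f] homogeneous_formD[OF g])
  moreover have "(word_degree S + d) + (word_degree R + d') + r = word_degree w + (d + d' + r)"
    using deg by simp
  ultimately show "m (f S) (g R) \<in> V (word_degree w + (d + d' + r))"
    by simp
qed

abbreviation scale_word_form (infixr "\<cdot>" 75) where
  "c \<cdot> f \<equiv> \<lambda>w. scale c (f w)"

lemma convolution_scale:
  assumes "bilinear_map scale m"
  shows "convolution m e (c \<cdot> f) g = c \<cdot> convolution m e f g"
    and "convolution m e f (c \<cdot> g) = c \<cdot> convolution m e f g"
  by (auto simp: convolution_def fun_eq_iff bilinear_map_simps[OF assms] unshuffle_sum_hom[where h = "scale _", OF scale_right_distrib]
      scale_parity_sign)

end

text \<open>
  A Gerstenhaber algebra after regrading: the operation \<open>(-1)\<^sup>|\<^sup>x\<^sup>| [x, y]\<close> is graded symmetric of degree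
  1, it is a derivation of the product up to the usual sign, and the Jacobi identity becomes a sum
  over the three unshuffles of type (2, 1).
\<close>

locale shifted_Poisson_algebra = graded_commutative_algebra scale V wedge
  for scale :: "'k::real_normed_field \<Rightarrow> 'a::ab_group_add \<Rightarrow> 'a" and V :: "int \<Rightarrow> 'a set"
    and wedge :: "'a \<Rightarrow> 'a \<Rightarrow> 'a" +
  fixes bracket :: "'a \<Rightarrow> 'a \<Rightarrow> 'a"
  assumes bracket_bilinear: "bilinear_map scale bracket"
    and bracket_degree: "x \<in> V p \<Longrightarrow> y \<in> V q \<Longrightarrow> bracket x y \<in> V (p + q + 1)"
    and bracket_symmetric: "x \<in> V p \<Longrightarrow> y \<in> V q \<Longrightarrow> bracket x y = parity_sign (p * q) (bracket y x)"
    and bracket_wedge: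
      "x \<in> V p \<Longrightarrow> y \<in> V q \<Longrightarrow> z \<in> V r \<Longrightarrow>
       bracket (wedge x y) z =
         parity_sign p (wedge x (bracket y z)) + parity_sign (q * r) (wedge (bracket x z) y)"
    and bracket_Jacobi:
      "x \<in> V p \<Longrightarrow> y \<in> V q \<Longrightarrow> z \<in> V r \<Longrightarrow>
       bracket (bracket x y) z + parity_sign (q * r) (bracket (bracket x z) y) +
         parity_sign (p * (q + r)) (bracket (bracket y z) x) = 0"
begin

abbreviation mult :: "int \<Rightarrow> ('a word \<Rightarrow> 'a) \<Rightarrow> ('a word \<Rightarrow> 'a) \<Rightarrow> 'a word \<Rightarrow> 'a" where
  "mult \<equiv> convolution wedge"

text \<open>
  Brackets are only taken with an even second form, so no sign arises from it.
\<close>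

abbreviation brac :: "('a word \<Rightarrow> 'a) \<Rightarrow> ('a word \<Rightarrow> 'a) \<Rightarrow> 'a word \<Rightarrow> 'a" where
  "brac \<equiv> convolution bracket 0"

lemmas wedge_simps = bilinear_map_simps[OF wedge_bilinear]
lemmas bracket_simps = bilinear_map_simps[OF bracket_bilinear]

lemma homogeneous_form_mult:
  "homogeneous_form d f \<Longrightarrow> homogeneous_form d' g \<Longrightarrow> homogeneous_form (d + d') (mult e f g)"
  using homogeneous_form_convolution[of wedge 0 d f d' g e] by (simp add: wedge_degree)

lemma wedge_commute_sign:
  "x \<in> V p \<Longrightarrow> y \<in> V q \<Longrightarrow> wedge x y = parity_sign (p * q) (wedge y x)"
  by (simp add: wedge_commute[of x p y q] scale_minus_one_powi)

text \<open>
  Coassociativity of the coproduct and associativity of the product.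
\<close>

lemma mult_assoc: "mult h (mult g f\<^sub>1 f\<^sub>2) f\<^sub>3 = mult (g + h) f\<^sub>1 (mult h f\<^sub>2 f\<^sub>3)"
proof
  fix w
  let ?G = "\<lambda>S1 S2 R. parity_sign (h * (word_degree S1 + word_degree S2) + g * word_degree S1)
      (wedge (f\<^sub>1 S1) (wedge (f\<^sub>2 S2) (f\<^sub>3 R)))"
  have "mult h (mult g f\<^sub>1 f\<^sub>2) f\<^sub>3 w = unshuffle_sum w (\<lambda>S R. unshuffle_sum S (\<lambda>S1 S2. ?G S1 S2 R))"
    unfolding convolution_def unshuffle_sum_bilinear[OF wedge_bilinear] unshuffle_sum_parity_sign
    by (intro unshuffle_sum_cong) (auto intro!: parity_sign_cong simp: wedge_simps wedge_assoc)
  also have "\<dots> = unshuffle_sum w (\<lambda>S R. unshuffle_sum R (\<lambda>R1 R2. ?G S R1 R2))"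
    by (rule unshuffle_sum_coassoc)
  also have "\<dots> = mult (g + h) f\<^sub>1 (mult h f\<^sub>2 f\<^sub>3) w"
    unfolding convolution_def unshuffle_sum_bilinear[OF wedge_bilinear] unshuffle_sum_parity_sign
    by (intro unshuffle_sum_cong) (auto intro!: parity_sign_cong simp: wedge_simps algebra_simps)
  finally show "mult h (mult g f\<^sub>1 f\<^sub>2) f\<^sub>3 w = mult (g + h) f\<^sub>1 (mult h f\<^sub>2 f\<^sub>3) w" .
qed

text \<open>
  Cocommutativity of the coproduct and commutativity of the product; the signs depending on the
  blocks cancel and leave the sign of the degrees of the two forms.
\<close>

lemma mult_commute:
  assumes f: "homogeneous_form d f" and g: "homogeneous_form e g"
  shows "mult e f g w = parity_sign (d * e) (mult d g f w)"
proof -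
  have "unshuffle_sum w (\<lambda>S R. parity_sign (e * word_degree S) (wedge (f S) (g R))) =
      unshuffle_sum w (\<lambda>S R. parity_sign (word_degree S * word_degree R)
        (parity_sign (e * word_degree R) (wedge (f R) (g S))))"
    by (rule unshuffle_sum_cocomm)
  also have "\<dots> = unshuffle_sum w (\<lambda>S R. parity_sign (d * e)
      (parity_sign (d * word_degree S) (wedge (g S) (f R))))"
  proof (rule unshuffle_sum_cong)
    fix S R
    have "wedge (f R) (g S) = parity_sign ((word_degree R + d) * (word_degree S + e)) (wedge (g S) (f R))"
      by (intro wedge_commute_sign homogeneous_formD[OF f] homogeneous_formD[OF g])
    then show "parity_sign (word_degree S * word_degree R)
        (parity_sign (e * word_degree R) (wedge (f R) (g S))) =
      parity_sign (d * e) (parity_sign (d * word_degree S) (wedge (g S) (f R)))"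
      by (auto intro!: parity_sign_cong)
  qed
  finally show ?thesis
    by (simp add: convolution_def unshuffle_sum_parity_sign)
qed

text \<open>
  The derivation property is applied letterwise. In one of the two terms the arguments of \<open>h\<close> and \<open>k\<close>
  appear in exchanged order, and cocommutativity of the coproduct restores it.
\<close>

lemma brac_mult:
  assumes g: "homogeneous_form e g" and h: "homogeneous_form 0 h" and k: "homogeneous_form 0 k"
  shows "brac (mult 0 g h) k w = parity_sign e (mult 1 g (brac h k) w) + mult 0 (brac g k) h w"
proof -
  let ?A = "\<lambda>S1 S2 R. parity_sign (word_degree S1 + e) (wedge (g S1) (bracket (h S2) (k R)))"
  let ?B = "\<lambda>S1 S2 R. parity_sign (word_degree S2 * word_degree R) (wedge (bracket (g S1) (k R)) (h S2))"
  have split: "bracket (wedge (g S1) (h S2)) (k R) = ?A S1 S2 R + ?B S1 S2 R" for S1 S2 R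
    using bracket_wedge[OF homogeneous_formD[OF g, of S1] homogeneous_formD[OF h, of S2]
        homogeneous_formD[OF k, of R]] by simp
  have "brac (mult 0 g h) k w =
      unshuffle_sum w (\<lambda>S R. unshuffle_sum S (\<lambda>S1 S2. bracket (wedge (g S1) (h S2)) (k R)))"
    by (simp add: convolution_def unshuffle_sum_bilinear[OF bracket_bilinear])
  also have "\<dots> = unshuffle_sum w (\<lambda>S R. unshuffle_sum R (\<lambda>R1 R2. bracket (wedge (g S) (h R1)) (k R2)))"
    by (rule unshuffle_sum_coassoc)
  also have "\<dots> = unshuffle_sum w (\<lambda>S R. unshuffle_sum R (\<lambda>R1 R2. ?A S R1 R2)) +
      unshuffle_sum w (\<lambda>S R. unshuffle_sum R (\<lambda>R1 R2. ?B S R1 R2))"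
    unfolding split unshuffle_sum_add by (rule refl)
  also have "unshuffle_sum w (\<lambda>S R. unshuffle_sum R (\<lambda>R1 R2. ?A S R1 R2)) =
      parity_sign e (mult 1 g (brac h k) w)"
    by (simp add: convolution_def unshuffle_sum_bilinear[OF wedge_bilinear] unshuffle_sum_parity_sign add.commute)
  also have "unshuffle_sum w (\<lambda>S R. unshuffle_sum R (\<lambda>R1 R2. ?B S R1 R2)) =
      unshuffle_sum w (\<lambda>S R. unshuffle_sum R (\<lambda>R1 R2. wedge (bracket (g S) (k R1)) (h R2)))"
  proof (rule unshuffle_sum_cong)
    fix S R :: "'a word"
    have "parity_sign (n * m + m * n) x = x" for n m and x :: 'a
      by (simp add: parity_sign_def)
    then show "unshuffle_sum R (\<lambda>R1 R2. ?B S R1 R2) =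
        unshuffle_sum R (\<lambda>R1 R2. wedge (bracket (g S) (k R1)) (h R2))"
      by (subst unshuffle_sum_cocomm) simp
  qed
  also have "\<dots> = unshuffle_sum w (\<lambda>S R. unshuffle_sum S (\<lambda>S1 S2. wedge (bracket (g S1) (k S2)) (h R)))"
    by (rule unshuffle_sum_coassoc[symmetric])
  also have "\<dots> = mult 0 (brac g k) h w"
    by (simp add: convolution_def unshuffle_sum_bilinear[OF wedge_bilinear])
  finally show ?thesis .
qed

end


section \<open>The calculus of the identity form\<close>

context shifted_Poisson_algebra
begin

text \<open>
  The bracket as a 2-form on words, called \<open>l\<^sub>2\<close> in the introduction.
\<close>

definition pairing :: "'a word \<Rightarrow> 'a" where
  "pairing = word_form (\<lambda>xs. if length xs = 2 then bracket (xs ! 0) (xs ! 1) else 0)"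

lemma pairing_eq_0: "length w \<noteq> 2 \<Longrightarrow> pairing w = 0"
  by (simp add: pairing_def word_form_def)

lemma pairing_pair:
  "homogeneous_word [p, q] \<Longrightarrow> pairing [p, q] = bracket (snd p) (snd q)"
  by (simp add: pairing_def word_form_def)

lemma pairing_Cons:
  assumes "snd p \<in> V (fst p)"
  shows "pairing (p # w) = bracket (snd p) (letter w)"
  using assms by (auto simp: pairing_def letter_def word_form_def bracket_simps length_Suc_conv numeral_2_eq_2)

lemma homogeneous_form_pairing: "homogeneous_form 1 pairing"
  unfolding homogeneous_form_def
proof
  fix w
  show "pairing w \<in> V (word_degree w + 1)"
  proof (cases "homogeneous_word w \<and> length w = 2")
    case True
    then obtain p q where "w = [p, q]"
      by (auto simp: length_Suc_conv numeral_2_eq_2)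
    with True show ?thesis
      using bracket_degree[of "snd p" "fst p" "snd q" "fst q"] by (simp add: pairing_pair)
  qed (auto simp: pairing_def word_form_def zero_mem)
qed

text \<open>
  A two-letter word splits into one-letter blocks in two ways, which contribute equally because the
  bracket is graded symmetric.
\<close>

lemma brac_letter_letter: "brac letter letter = 2 \<cdot> pairing"
proof
  fix w
  show "brac letter letter w = scale 2 (pairing w)"
  proof (cases "homogeneous_word w \<and> length w = 2")
    case True
    then obtain p q where w: "w = [p, q]" and hom: "snd p \<in> V (fst p)" "snd q \<in> V (fst q)"
      by (auto simp: length_Suc_conv numeral_2_eq_2)
    have "brac letter letter w = bracket (snd p) (snd q) + parity_sign (fst p * fst q) (bracket (snd q) (snd p))"
      using hom by (simp add: w convolution_def bracket_simps mult.commute)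
    also have "\<dots> = scale (1 + 1) (bracket (snd p) (snd q))"
      using bracket_symmetric[OF hom] unfolding scale_left_distrib by simp
    finally show ?thesis
      using True by (simp add: w pairing_pair)
  next
    case False
    then have "brac letter letter w = 0"
      unfolding convolution_def
    proof (intro unshuffle_sum_neutral)
      fix S R assume S: "set S \<union> set R = set w" "length S + length R = length w"
      show "parity_sign (0 * word_degree S) (bracket (letter S) (letter R)) = 0"
      proof (cases "length w = 2")
        case True
        then have "\<not> (homogeneous_word S \<and> homogeneous_word R)"
          using False homogeneous_word_Un_iff[OF S(1)] by blast
        then show ?thesis
          by (auto simp: letter_def word_form_def bracket_simps)
      next
        case False
        then have "length S \<noteq> 1 \<or> length R \<noteq> 1"
          using S(2) by auto
        then show ?thesis
          by (auto simp: letter_eq_0 bracket_simps)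
      qed
    qed
    then show ?thesis
      using False by (auto simp: pairing_def word_form_def)
  qed
qed

text \<open>
  On three letters the left-hand side is the sum of the Jacobi identity.
\<close>

lemma brac_pairing_letter: "brac pairing letter = (\<lambda>w. 0)"
proof
  fix w
  show "brac pairing letter w = 0"
  proof (cases "homogeneous_word w \<and> length w = 3")
    case True
    then obtain p q r where w: "w = [p, q, r]"
      and hom: "snd p \<in> V (fst p)" "snd q \<in> V (fst q)" "snd r \<in> V (fst r)"
      by (auto simp: length_Suc_conv numeral_3_eq_3)
    then show ?thesis
      using bracket_Jacobi[OF hom]
      by (simp add: convolution_def bracket_simps pairing_pair pairing_eq_0 letter_eq_0 algebra_simps)
  next
    case False
    show ?thesis
      unfolding convolution_def
    proof (intro unshuffle_sum_neutral)
      fix S R assume S: "set S \<union> set R = set w" "length S + length R = length w"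
      show "parity_sign (0 * word_degree S) (bracket (pairing S) (letter R)) = 0"
      proof (cases "length w = 3")
        case True
        then have "\<not> (homogeneous_word S \<and> homogeneous_word R)"
          using False homogeneous_word_Un_iff[OF S(1)] by blast
        then show ?thesis
          by (auto simp: letter_def pairing_def word_form_def bracket_simps)
      next
        case False
        then have "length S \<noteq> 2 \<or> length R \<noteq> 1"
          using S(2) by auto
        then show ?thesis
          by (auto simp: letter_eq_0 pairing_eq_0 bracket_simps)
      qed
    qed
  qed
qed

text \<open>
  An odd element of a graded commutative algebra squares to zero in characteristic other than 2.
\<close>

lemma mult_pairing_pairing: "mult 1 pairing pairing = (\<lambda>w. 0)"
proof
  fix w
  have "mult 1 pairing pairing w = - mult 1 pairing pairing w"
    using mult_commute[OF homogeneous_form_pairing homogeneous_form_pairing, of w] by (simp add: parity_sign_def)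
  then have "mult 1 pairing pairing w + mult 1 pairing pairing w = 0"
    by (metis add.right_inverse)
  then have "scale (1 + 1) (mult 1 pairing pairing w) = 0"
    by (subst scale_left_distrib) simp
  then show "mult 1 pairing pairing w = 0"
    by simp
qed

abbreviation mult_letter :: "('a word \<Rightarrow> 'a) \<Rightarrow> 'a word \<Rightarrow> 'a" where
  "mult_letter f \<equiv> mult 0 f letter"

text \<open>
  Multiplication by \<open>X\<^sup>a\<close>. The algebra of forms is used without a unit, so powers of \<open>X\<close> appear only
  as factors.
\<close>

primrec mult_letters :: "nat \<Rightarrow> ('a word \<Rightarrow> 'a) \<Rightarrow> 'a word \<Rightarrow> 'a" where
  "mult_letters 0 f = f"
| "mult_letters (Suc a) f = mult_letter (mult_letters a f)"

lemma mult_letters_mult_letter: "mult_letters a (mult_letter f) = mult_letter (mult_letters a f)"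
  by (induction a) simp_all

lemma mult_letters_mult_letters: "mult_letters a (mult_letters b f) = mult_letters (a + b) f"
  by (induction a) simp_all

lemma mult_zero: "mult e (\<lambda>w. 0) g = (\<lambda>w. 0)" "brac (\<lambda>w. 0) g = (\<lambda>w. 0)"
  by (auto simp: convolution_def wedge_simps bracket_simps fun_eq_iff)

lemma mult_letter_pairing: "mult 1 letter pairing = mult_letter pairing"
  using mult_commute[OF homogeneous_form_letter homogeneous_form_pairing] by (simp add: fun_eq_iff)

lemma mult_letters_scale: "mult_letters a (c \<cdot> f) = c \<cdot> mult_letters a f"
  by (induction a) (simp_all add: convolution_scale[OF wedge_bilinear])

lemma mult_letters_zero: "mult_letters a (\<lambda>w. 0) = (\<lambda>w. 0)"
  by (induction a) (simp_all add: mult_zero)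

lemma homogeneous_form_mult_letters:
  "homogeneous_form e f \<Longrightarrow> homogeneous_form e (mult_letters a f)"
proof (induction a)
  case (Suc a)
  then show ?case
    using homogeneous_form_mult[OF _ homogeneous_form_letter] by simp
qed simp

lemma mult_letters_pairing: "mult 1 (mult_letters a f) pairing = mult_letters a (mult 1 f pairing)"
proof (induction a)
  case (Suc a)
  have "mult 1 (mult_letter f) pairing = mult_letter (mult 1 f pairing)" for f
    by (simp add: mult_assoc mult_letter_pairing)
  with Suc show ?case
    by simp
qed simp

text \<open>
  Repeated use of the derivation rule gives the power rule
  \<open>{X\<^sup>a\<^sup>+\<^sup>1, X} = (a + 1) X\<^sup>a {X, X}\<close> with \<open>{X, X} = 2 l\<^sub>2\<close>.
\<close>

lemma brac_mult_letters_letter: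
  "brac (mult_letters a letter) letter = (2 * of_nat (Suc a)) \<cdot> mult_letters a pairing"
proof (induction a)
  case (Suc a)
  have "mult 1 (mult_letters a letter) pairing = mult_letters (Suc a) pairing"
    by (simp add: mult_letters_pairing mult_letter_pairing mult_letters_mult_letter)
  moreover have "brac (mult_letters (Suc a) letter) letter w =
      mult 1 (mult_letters a letter) (2 \<cdot> pairing) w + mult_letter (brac (mult_letters a letter) letter) w" for w
    using brac_mult[OF homogeneous_form_mult_letters[OF homogeneous_form_letter] homogeneous_form_letter homogeneous_form_letter]
    by (simp add: brac_letter_letter)
  ultimately have "brac (mult_letters (Suc a) letter) letter w =
      scale (2 + 2 * of_nat (Suc a)) (mult_letters (Suc a) pairing w)" for w
    unfolding Suc.IH convolution_scale[OF wedge_bilinear] scale_left_distrib by simp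
  moreover have "2 + 2 * of_nat (Suc a) = (2 * of_nat (Suc (Suc a)) :: 'k)"
    by simp
  ultimately show ?case
    by (intro ext) (simp only:)
qed (simp add: brac_letter_letter)

text \<open>
  By the derivation rule \<open>{l\<^sub>2 X\<^sup>a, X}\<close> is a combination of \<open>{l\<^sub>2, X} X\<^sup>a\<close> and \<open>l\<^sub>2 {X, X} X\<^sup>a\<^sup>-\<^sup>1\<close>; both vanish.
\<close>

lemma brac_mult_letters_pairing: "brac (mult_letters a pairing) letter = (\<lambda>w. 0)"
proof (induction a)
  case (Suc a)
  have "brac (mult_letters (Suc a) pairing) letter w =
      - mult 1 (mult_letters a pairing) (2 \<cdot> pairing) w + mult_letter (brac (mult_letters a pairing) letter) w" for w
    using brac_mult[OF homogeneous_form_mult_letters[OF homogeneous_form_pairing] homogeneous_form_letter homogeneous_form_letter]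
    by (simp add: brac_letter_letter parity_sign_def)
  then show ?case
    by (simp add: fun_eq_iff Suc.IH convolution_scale[OF wedge_bilinear] mult_letters_pairing
        mult_pairing_pairing mult_letters_zero mult_zero)
qed (simp add: brac_pairing_letter)

section \<open>Divided powers of the identity form\<close>

lemma foldl_wedge_hom:
  "foldl wedge (x + y) zs = foldl wedge x zs + foldl wedge y zs"
  "foldl wedge 0 zs = 0"
  "foldl wedge (scale c x) zs = scale c (foldl wedge x zs)"
  "foldl wedge (wedge x y) zs = wedge x (foldl wedge y zs)"
  "foldl wedge (parity_sign n x) zs = parity_sign n (foldl wedge x zs)"
proof -
  show "foldl wedge (x + y) zs = foldl wedge x zs + foldl wedge y zs"
    by (induction zs arbitrary: x y) (simp_all add: wedge_simps)
  show "foldl wedge 0 zs = 0"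
    by (induction zs) (simp_all add: wedge_simps)
  show "foldl wedge (scale c x) zs = scale c (foldl wedge x zs)"
    by (rule foldl_wedge_scale)
  show "foldl wedge (wedge x y) zs = wedge x (foldl wedge y zs)"
    by (induction zs arbitrary: y) (simp_all add: wedge_assoc)
  show "foldl wedge (parity_sign n x) zs = parity_sign n (foldl wedge x zs)"
    by (simp add: foldl_wedge_scale flip: scale_minus_one_powi)
qed

lemma wedge_foldl_wedge:
  assumes "x \<in> V d" and "homogeneous_word w"
  shows "wedge (foldl wedge z (map snd w)) x = parity_sign (d * word_degree w) (foldl wedge (wedge z x) (map snd w))"
  using assms(2)
proof (induction w arbitrary: z)
  case (Cons p w)
  have "wedge (wedge z (snd p)) x = parity_sign (fst p * d) (wedge (wedge z x) (snd p))"
    using Cons.prems assms(1) wedge_commute_sign[of "snd p" "fst p" x d]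
    by (simp add: wedge_assoc wedge_simps)
  then show ?case
    using Cons.IH[of "wedge z (snd p)"] Cons.prems
    by (simp add: foldl_wedge_hom(5)) (auto intro!: parity_sign_cong simp: algebra_simps)
qed simp

text \<open>Choosing the last factor of a product of \<open>n\<close> letters in all \<open>n\<close> ways.\<close>

lemma unshuffle_sum_foldl_wedge_letter:
  assumes "homogeneous_word w"
  shows "unshuffle_sum w (\<lambda>S R. wedge (foldl wedge z (map snd S)) (letter R)) =
    scale (of_nat (length w)) (foldl wedge z (map snd w))"
  using assms
proof (induction w arbitrary: z)
  case (Cons p w)
  have "unshuffle_sum w (\<lambda>S R. parity_sign (fst p * word_degree S)
      (wedge (foldl wedge z (map snd S)) (letter (p # R)))) =
    unshuffle_sum w (\<lambda>S R. if R = [] then parity_sign (fst p * word_degree S)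
      (wedge (foldl wedge z (map snd S)) (snd p)) else 0)"
  proof (rule unshuffle_sum_cong)
    fix S R assume "set S \<union> set R = set w"
    then have "homogeneous_word R"
      using Cons.prems by (simp add: homogeneous_word_Un_iff[of S R w])
    then show "parity_sign (fst p * word_degree S) (wedge (foldl wedge z (map snd S)) (letter (p # R))) =
      (if R = [] then parity_sign (fst p * word_degree S) (wedge (foldl wedge z (map snd S)) (snd p)) else 0)"
      using Cons.prems by (simp add: wedge_simps)
  qed
  also have "\<dots> = parity_sign (fst p * word_degree w) (wedge (foldl wedge z (map snd w)) (snd p))"
    by (rule unshuffle_sum_right_Nil)
  also have "\<dots> = foldl wedge (wedge z (snd p)) (map snd w)"
    using Cons.prems wedge_foldl_wedge[of "snd p" "fst p" w z] by (simp add: parity_sign_even)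
  finally show ?case
    using Cons by (simp add: scale_left_distrib)
qed (simp add: wedge_simps)

text \<open>
  The product \<open>f X\<^sup>a / a!\<close>. As \<open>X\<^sup>a / a!\<close> is the wedge product of \<open>a\<close> letters, it can be written down
  without dividing, and for \<open>a = 0\<close> without a unit.
\<close>

definition divided_power :: "nat \<Rightarrow> ('a word \<Rightarrow> 'a) \<Rightarrow> 'a word \<Rightarrow> 'a" where
  "divided_power a f w =
     unshuffle_sum w (\<lambda>S R. if homogeneous_word R \<and> length R = a then foldl wedge (f S) (map snd R) else 0)"

lemma divided_power_0: "divided_power 0 f = f"
proof
  fix w
  have "divided_power 0 f w = unshuffle_sum w (\<lambda>S R. if R = [] then f S else 0)"
    unfolding divided_power_def by (intro unshuffle_sum_cong) auto
  then show "divided_power 0 f w = f w"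
    by (simp add: unshuffle_sum_right_Nil)
qed

text \<open>
  By coassociativity the letter multiplied last can be split off from the block of the wedge
  product, where each of its \<open>a + 1\<close> letters gets its turn.
\<close>

lemma mult_letter_divided_power:
  "mult_letter (divided_power a f) = of_nat (Suc a) \<cdot> divided_power (Suc a) f"
proof
  fix w
  let ?H = "\<lambda>S R1 R2. if homogeneous_word R1 \<and> length R1 = a
    then wedge (foldl wedge (f S) (map snd R1)) (letter R2) else 0"
  have "mult_letter (divided_power a f) w =
      unshuffle_sum w (\<lambda>S R. unshuffle_sum S (\<lambda>S1 S2. ?H S1 S2 R))"
    by (simp add: convolution_def divided_power_def unshuffle_sum_bilinear[OF wedge_bilinear]
        if_distrib[where f = "\<lambda>x. wedge x _"] wedge_simps cong: if_cong)
  also have "\<dots> = unshuffle_sum w (\<lambda>S R. unshuffle_sum R (\<lambda>R1 R2. ?H S R1 R2))"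
    by (rule unshuffle_sum_coassoc)
  also have "\<dots> = unshuffle_sum w (\<lambda>S R. scale (of_nat (Suc a))
      (if homogeneous_word R \<and> length R = Suc a then foldl wedge (f S) (map snd R) else 0))"
  proof (rule unshuffle_sum_cong)
    fix S R :: "'a word"
    show "unshuffle_sum R (\<lambda>R1 R2. ?H S R1 R2) = scale (of_nat (Suc a))
      (if homogeneous_word R \<and> length R = Suc a then foldl wedge (f S) (map snd R) else 0)"
    proof (cases "homogeneous_word R \<and> length R = Suc a")
      case True
      have "unshuffle_sum R (\<lambda>R1 R2. ?H S R1 R2) =
          unshuffle_sum R (\<lambda>R1 R2. wedge (foldl wedge (f S) (map snd R1)) (letter R2))"
      proof (rule unshuffle_sum_cong)
        fix R1 R2 assume R: "set R1 \<union> set R2 = set R" "length R1 + length R2 = length R"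
        then have "homogeneous_word R1"
          using True homogeneous_word_Un_iff[OF R(1)] by blast
        then show "?H S R1 R2 = wedge (foldl wedge (f S) (map snd R1)) (letter R2)"
          using R(2) True letter_eq_0[of R2] by (auto simp: wedge_simps)
      qed
      then show ?thesis
        using True unshuffle_sum_foldl_wedge_letter[of R "f S"] by simp
    next
      case False
      have "unshuffle_sum R (\<lambda>R1 R2. ?H S R1 R2) = 0"
      proof (rule unshuffle_sum_neutral)
        fix R1 R2 assume R: "set R1 \<union> set R2 = set R" "length R1 + length R2 = length R"
        show "?H S R1 R2 = 0"
        proof (cases "homogeneous_word R1 \<and> length R1 = a \<and> homogeneous_word R2 \<and> length R2 = 1")
          case True
          then have "homogeneous_word R"
            using homogeneous_word_Un_iff[OF R(1)] by blast
          then show ?thesis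
            using True False R(2) by auto
        qed (auto simp: letter_def word_form_def wedge_simps)
      qed
      then show ?thesis
        using False by auto
    qed
  qed
  also have "\<dots> = scale (of_nat (Suc a)) (divided_power (Suc a) f w)"
    by (simp only: divided_power_def unshuffle_sum_hom[where h = "scale _", OF scale_right_distrib])
  finally show "mult_letter (divided_power a f) w = scale (of_nat (Suc a)) (divided_power (Suc a) f w)" .
qed

lemma mult_letters_eq_divided_power: "mult_letters a f = fact a \<cdot> divided_power a f"
proof (induction a)
  case (Suc a)
  have "mult_letters (Suc a) f = fact a \<cdot> of_nat (Suc a) \<cdot> divided_power (Suc a) f"
    unfolding mult_letters.simps Suc.IH convolution_scale[OF wedge_bilinear] mult_letter_divided_power
    by (rule refl)
  then show ?case
    unfolding scale_scale fact_Suc by (simp only: mult.commute of_nat_mult of_nat_fact)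
qed (simp add: divided_power_0)

lemma divided_power_eq_mult_letters: "divided_power a f = inverse (fact a) \<cdot> mult_letters a f"
proof
  fix w
  show "divided_power a f w = scale (inverse (fact a)) (mult_letters a f w)"
    unfolding mult_letters_eq_divided_power scale_scale by simp
qed

lemma homogeneous_form_divided_power:
  "homogeneous_form e f \<Longrightarrow> homogeneous_form e (divided_power a f)"
  unfolding divided_power_eq_mult_letters homogeneous_form_def
  by (intro allI subspace_scale subspace_homogeneous homogeneous_formD homogeneous_form_mult_letters)
    (simp add: homogeneous_form_def)

text \<open>
  This is \<open>m! \<N>\<^sub>m = X\<^sup>m\<close> for \<open>m = b + 1\<close>: the letter of the last factor \<open>X\<close> can be any letter of the word.
\<close>

lemma word_form_wedge_form:
  "fact (Suc b) \<cdot> word_form (wedge_form wedge (Suc b)) = mult_letters b letter"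
proof (induction b)
  case 0
  show ?case
    by (auto simp: word_form_def wedge_form_def letter_def wedge_list_def fun_eq_iff length_Suc_conv)
next
  case (Suc b)
  have "mult_letter (word_form (wedge_form wedge (Suc b))) =
    of_nat (Suc (Suc b)) \<cdot> word_form (wedge_form wedge (Suc (Suc b)))"
  proof
    fix w
    show "mult_letter (word_form (wedge_form wedge (Suc b))) w =
      scale (of_nat (Suc (Suc b))) (word_form (wedge_form wedge (Suc (Suc b))) w)"
    proof (cases "homogeneous_word w \<and> length w = Suc (Suc b)")
      case False
      have "mult_letter (word_form (wedge_form wedge (Suc b))) w = 0"
        unfolding convolution_def
      proof (rule unshuffle_sum_neutral)
        fix S R assume S: "set S \<union> set R = set w" "length S + length R = length w"
        then have "\<not> (homogeneous_word S \<and> length S = Suc b \<and> homogeneous_word R \<and> length R = 1)"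
          using False homogeneous_word_Un_iff[OF S(1)] S(2) by (metis Suc_eq_plus1)
        then show "parity_sign (0 * word_degree S) (wedge (word_form (wedge_form wedge (Suc b)) S) (letter R)) = 0"
          by (auto simp: letter_def word_form_def wedge_form_def wedge_simps)
      qed
      then show ?thesis
        using False by (auto simp: word_form_def wedge_form_def)
    next
      case True
      then obtain p v where w: "w = p # v" and v: "length v = Suc b" and p: "snd p \<in> V (fst p)" and hom: "homogeneous_word v"
        by (auto simp: length_Suc_conv)
      let ?W = "word_form (wedge_form wedge (Suc b))"
      have "unshuffle_sum v (\<lambda>S R. wedge (?W (p # S)) (letter R)) =
          unshuffle_sum v (\<lambda>S R. wedge (foldl wedge (snd p) (map snd S)) (letter R))"
      proof (rule unshuffle_sum_cong)
        fix S R assume S: "set S \<union> set R = set v" "length S + length R = length v"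
        then have "homogeneous_word S"
          using hom homogeneous_word_Un_iff[of S R v] by simp
        then show "wedge (?W (p # S)) (letter R) = wedge (foldl wedge (snd p) (map snd S)) (letter R)"
          using S(2) v p letter_eq_0[of R]
          by (auto simp: word_form_def wedge_form_def wedge_list_def wedge_simps)
      qed
      moreover have "unshuffle_sum v (\<lambda>S R. parity_sign (fst p * word_degree S) (wedge (?W S) (letter (p # R)))) =
          unshuffle_sum v (\<lambda>S R. if R = [] then parity_sign (fst p * word_degree S) (wedge (?W S) (snd p)) else 0)"
      proof (rule unshuffle_sum_cong)
        fix S R assume "set S \<union> set R = set v"
        then have "homogeneous_word R"
          using hom homogeneous_word_Un_iff[of S R v] by simp
        then show "parity_sign (fst p * word_degree S) (wedge (?W S) (letter (p # R))) =
            (if R = [] then parity_sign (fst p * word_degree S) (wedge (?W S) (snd p)) else 0)"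
          using p by (simp add: wedge_simps)
      qed
      moreover have "parity_sign (fst p * word_degree v) (wedge (?W v) (snd p)) = foldl wedge (snd p) (map snd v)"
      proof -
        obtain q u where u: "v = q # u"
          using v by (auto simp: length_Suc_conv)
        have "?W v = foldl wedge (snd q) (map snd u)"
          using hom v by (simp add: u word_form_def wedge_form_def wedge_list_def)
        moreover have "wedge (snd q) (snd p) = parity_sign (fst p * fst q) (wedge (snd p) (snd q))"
          using hom p wedge_commute_sign[of "snd q" "fst q" "snd p" "fst p"] by (simp add: u mult.commute)
        ultimately show ?thesis
          using hom p wedge_foldl_wedge[of "snd p" "fst p" u "snd q"]
          by (simp add: u foldl_wedge_hom(5) parity_sign_even algebra_simps)
      qed
      ultimately have "mult_letter ?W w = scale (of_nat (Suc b)) (foldl wedge (snd p) (map snd v)) + foldl wedge (snd p) (map snd v)"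
        using v by (simp add: w convolution_def unshuffle_sum_foldl_wedge_letter[OF hom] unshuffle_sum_right_Nil)
      then show ?thesis
        using True w by (simp add: word_form_def wedge_form_def wedge_list_def scale_of_nat_Suc del: of_nat_Suc)
    qed
  qed
  then show ?case
    by (simp add: Suc.IH[symmetric] convolution_scale[OF wedge_bilinear] mult.commute del: of_nat_Suc)
qed

end


section \<open>Insertions into wedge and bracket forms\<close>

context graded_vector_space
begin

lemma word_form_zip: "homogeneous_list V ds xs \<Longrightarrow> word_form K (zip ds xs) = K xs"
  by (auto simp: word_form_def homogeneous_word_zip homogeneous_list_def list_all2_lengthD)

lemma has_form_degree_word_form:
  assumes "homogeneous_form e (word_form K)"
  shows "has_form_degree V K e"
  unfolding has_form_degree_def
proof (intro allI impI)
  fix ds xs assume hom: "homogeneous_list V ds xs"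
  then have "length ds = length xs"
    by (simp add: homogeneous_list_def list_all2_lengthD)
  then show "K xs \<in> V (sum_list ds + e)"
    using homogeneous_formD[OF assms, of "zip ds xs"]
    by (simp add: word_form_zip[OF hom] word_degree_def)
qed

lemma graded_symmetric_word_form:
  assumes "\<And>us vs x y. homogeneous_word (us @ x # y # vs) \<Longrightarrow>
    word_form K (us @ x # y # vs) = parity_sign (fst x * fst y) (word_form K (us @ y # x # vs))"
  shows "graded_symmetric scale V K"
proof (rule graded_symmetricI)
  fix us vs ds es x y p q
  assume hom: "homogeneous_list V ds us" "homogeneous_list V es vs" "x \<in> V p" "y \<in> V q"
  let ?us = "zip ds us" and ?vs = "zip es vs"
  have len: "length ds = length us" "length es = length vs"
    using hom by (auto simp: homogeneous_list_def list_all2_lengthD)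
  have word: "homogeneous_word (?us @ (p, x) # (q, y) # ?vs)" "homogeneous_word (?us @ (q, y) # (p, x) # ?vs)"
    using hom homogeneous_word_zip[OF hom(1)] homogeneous_word_zip[OF hom(2)] by (auto simp: homogeneous_word_def)
  then show "K (us @ x # y # vs) = parity_sign (p * q) (K (us @ y # x # vs))"
    using assms[OF word(1)] len by (simp add: word_form_def)
qed

end

context shifted_Poisson_algebra
begin

lemma divided_power_zero: "divided_power a (\<lambda>w. 0) = (\<lambda>w. 0)"
  by (simp add: fun_eq_iff divided_power_def foldl_wedge_hom cong: if_cong)

lemma divided_power_scale: "divided_power a (c \<cdot> f) = c \<cdot> divided_power a f"
  by (simp add: divided_power_eq_mult_letters mult_letters_scale mult.commute)

text \<open>
  The divided powers of \<open>X\<close>, an even element, multiply like those of a commuting variable.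
\<close>

lemma divided_power_divided_power:
  "divided_power a (divided_power b f) = of_nat (a + b choose a) \<cdot> divided_power (a + b) f"
proof -
  have "(of_nat (a + b choose a) :: 'k) * inverse (fact (a + b)) = inverse (fact a) * inverse (fact b)"
    by (simp add: binomial_fact field_simps)
  then show ?thesis
    by (simp add: divided_power_eq_mult_letters mult_letters_scale mult_letters_mult_letters)
qed

lemma brac_divided_power_pairing: "brac (divided_power a pairing) letter = (\<lambda>w. 0)"
  by (simp add: divided_power_eq_mult_letters convolution_scale[OF bracket_bilinear] brac_mult_letters_pairing)

lemma mult_divided_power_pairing: "mult 1 (divided_power a pairing) pairing = (\<lambda>w. 0)"
  by (simp add: divided_power_eq_mult_letters convolution_scale[OF wedge_bilinear] mult_letters_pairing
      mult_pairing_pairing mult_letters_zero)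

lemma word_form_wedge_form_eq:
  "word_form (wedge_form wedge (Suc b)) = inverse (fact (Suc b)) \<cdot> mult_letters b letter"
  by (simp add: word_form_wedge_form[symmetric] del: fact_Suc)

lemma brac_wedge_form: "brac (word_form (wedge_form wedge (Suc b))) letter = 2 \<cdot> divided_power b pairing"
proof -
  have "inverse (fact (Suc b)) * (2 * of_nat (Suc b)) = 2 * inverse (fact b :: 'k)"
    by (simp add: field_simps del: of_nat_Suc)
  then show ?thesis
    unfolding word_form_wedge_form_eq convolution_scale[OF bracket_bilinear] brac_mult_letters_letter
      divided_power_eq_mult_letters scale_scale
    by (simp only:)
qed

lemma mult_wedge_form: "mult 1 (word_form (wedge_form wedge (Suc b))) pairing = divided_power (Suc b) pairing"
  unfolding word_form_wedge_form_eq convolution_scale[OF wedge_bilinear]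
  by (simp add: divided_power_eq_mult_letters mult_letters_pairing mult_letter_pairing mult_letters_mult_letter del: fact_Suc)

lemma homogeneous_form_wedge_form: "homogeneous_form 0 (word_form (wedge_form wedge (Suc b)))"
  unfolding word_form_wedge_form_eq using homogeneous_form_mult_letters[OF homogeneous_form_letter, of b]
  by (simp add: homogeneous_form_def subspace_scale subspace_homogeneous)

text \<open>
  The derivative of \<open>X\<^sup>m / m!\<close> in the direction \<open>K\<close>, for \<open>m = b + 1\<close>.
\<close>

lemma unshuffle_sum_into_wedge_form:
  assumes hom: "homogeneous_word w" and K: "\<And>xs. length xs \<noteq> k \<Longrightarrow> K xs = 0"
  shows "unshuffle_sum w (\<lambda>S R. if length S = k
      then wedge_form wedge (Suc b) (K (map snd S) # map snd R) else 0) =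
    divided_power b (word_form K) w"
  unfolding divided_power_def
proof (rule unshuffle_sum_cong)
  fix S R assume "set S \<union> set R = set w"
  then have "homogeneous_word S" "homogeneous_word R"
    using hom homogeneous_word_Un_iff[of S R w] by simp_all
  then show "(if length S = k then wedge_form wedge (Suc b) (K (map snd S) # map snd R) else 0) =
      (if homogeneous_word R \<and> length R = b then foldl wedge (word_form K S) (map snd R) else 0)"
    using K by (simp add: word_form_def wedge_form_def wedge_list_def foldl_wedge_hom)
qed

text \<open>
  The first letter either enters the pairing, together with a second one, or it is one of the
  remaining factors and is then moved to the front past the pairing, which is odd.
\<close>

lemma divided_power_pairing_Cons:
  assumes z: "z \<in> V d" and hom: "homogeneous_word w"
  shows "divided_power a pairing ((d, z) # w) =
    unshuffle_sum w (\<lambda>S R. if homogeneous_word R \<and> length R = a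
      then foldl wedge (bracket z (letter S)) (map snd R) else 0) +
    (if a = 0 then 0 else parity_sign d (unshuffle_sum w (\<lambda>S R.
       if homogeneous_word R \<and> length R = a - 1 then foldl wedge (wedge z (pairing S)) (map snd R) else 0)))"
proof -
  have "unshuffle_sum w (\<lambda>S R. parity_sign (d * word_degree S)
      (if homogeneous_word ((d, z) # R) \<and> length ((d, z) # R) = a
       then foldl wedge (pairing S) (map snd ((d, z) # R)) else 0)) =
    unshuffle_sum w (\<lambda>S R. if a = 0 then 0 else parity_sign d
      (if homogeneous_word R \<and> length R = a - 1 then foldl wedge (wedge z (pairing S)) (map snd R) else 0))"
  proof (rule unshuffle_sum_cong)
    fix S R :: "'a word"
    have "wedge (pairing S) z = parity_sign ((word_degree S + 1) * d) (wedge z (pairing S))"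
      by (intro wedge_commute_sign homogeneous_formD[OF homogeneous_form_pairing] z)
    then show "parity_sign (d * word_degree S)
        (if homogeneous_word ((d, z) # R) \<and> length ((d, z) # R) = a
         then foldl wedge (pairing S) (map snd ((d, z) # R)) else 0) =
      (if a = 0 then 0 else parity_sign d
        (if homogeneous_word R \<and> length R = a - 1 then foldl wedge (wedge z (pairing S)) (map snd R) else 0))"
      using z by (cases a) (auto simp: foldl_wedge_hom(5) algebra_simps intro!: parity_sign_cong)
  qed
  moreover have "pairing ((d, z) # S) = bracket z (letter S)" for S
    using pairing_Cons[of "(d, z)" S] z by simp
  ultimately show ?thesis
    using z by (simp add: divided_power_def unshuffle_sum_parity_sign cong: if_cong)
qed

text \<open>
  The derivative of \<open>l\<^sub>2 X\<^sup>a / a!\<close> in the direction \<open>K\<close>. The value of \<open>K\<close> is a letter of degree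
  \<open>word_degree S + e\<close> and is split off from the others; coassociativity then collects the block of \<open>K\<close>
  and the block of the pairing into a convolution.
\<close>

lemma unshuffle_sum_into_bracket:
  assumes hom: "homogeneous_word w" and K: "\<And>xs. length xs \<noteq> k \<Longrightarrow> K xs = 0"
    and e: "homogeneous_form e (word_form K)" and L: "word_form L = divided_power a pairing"
  shows "unshuffle_sum w (\<lambda>S R. if length S = k then L (K (map snd S) # map snd R) else 0) =
    divided_power a (brac (word_form K) letter) w +
    (if a = 0 then 0 else parity_sign e (divided_power (a - 1) (mult 1 (word_form K) pairing) w))"
proof -
  let ?K = "word_form K" and ?c = "\<lambda>n R. homogeneous_word R \<and> length R = n"
  let ?A = "\<lambda>S R1 R2. if ?c a R2 then foldl wedge (bracket (?K S) (letter R1)) (map snd R2) else 0"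
  let ?B = "\<lambda>S R1 R2. if a = 0 then 0 else parity_sign (word_degree S + e)
    (if ?c (a - 1) R2 then foldl wedge (wedge (?K S) (pairing R1)) (map snd R2) else 0)"
  have "unshuffle_sum w (\<lambda>S R. if length S = k then L (K (map snd S) # map snd R) else 0) =
      unshuffle_sum w (\<lambda>S R. unshuffle_sum R (?A S) + unshuffle_sum R (?B S))"
  proof (rule unshuffle_sum_cong)
    fix S R assume "set S \<union> set R = set w"
    then have SR: "homogeneous_word S" "homogeneous_word R"
      using hom homogeneous_word_Un_iff[of S R w] by simp_all
    show "(if length S = k then L (K (map snd S) # map snd R) else 0) =
      unshuffle_sum R (?A S) + unshuffle_sum R (?B S)"
    proof (cases "length S = k")
      case True
      have z: "?K S \<in> V (word_degree S + e)"
        by (rule homogeneous_formD[OF e])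
      then have "L (K (map snd S) # map snd R) = word_form L ((word_degree S + e, ?K S) # R)"
        using SR by (simp add: word_form_def)
      also have "\<dots> = unshuffle_sum R (?A S) + unshuffle_sum R (?B S)"
        unfolding L by (simp add: divided_power_pairing_Cons[OF z SR(2)] unshuffle_sum_parity_sign)
      finally show ?thesis
        using True by simp
    next
      case False
      then have "?K S = 0"
        using K by (simp add: word_form_def)
      then show ?thesis
        using False by (simp add: bracket_simps wedge_simps foldl_wedge_hom cong: if_cong)
    qed
  qed
  also have "\<dots> = unshuffle_sum w (\<lambda>S R. unshuffle_sum S (\<lambda>S1 S2. ?A S1 S2 R)) +
      unshuffle_sum w (\<lambda>S R. unshuffle_sum S (\<lambda>S1 S2. ?B S1 S2 R))"
    unfolding unshuffle_sum_add unshuffle_sum_coassoc by (rule refl)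
  also have "unshuffle_sum w (\<lambda>S R. unshuffle_sum S (\<lambda>S1 S2. ?A S1 S2 R)) =
      divided_power a (brac ?K letter) w"
    unfolding divided_power_def convolution_def
    by (intro unshuffle_sum_cong)
      (auto simp: unshuffle_sum_hom[where h = "\<lambda>x. foldl wedge x _", OF foldl_wedge_hom(1)])
  also have "unshuffle_sum w (\<lambda>S R. unshuffle_sum S (\<lambda>S1 S2. ?B S1 S2 R)) =
      (if a = 0 then 0 else parity_sign e (divided_power (a - 1) (mult 1 ?K pairing) w))"
    unfolding divided_power_def convolution_def unshuffle_sum_parity_sign
    by (auto intro!: unshuffle_sum_cong
      simp: unshuffle_sum_hom[where h = "\<lambda>x. foldl wedge x _", OF foldl_wedge_hom(1)]
        unshuffle_sum_parity_sign foldl_wedge_hom(5) add.commute)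
  finally show ?thesis .
qed

text \<open>
  For \<open>K = l\<^sub>2 X\<^sup>b / b!\<close> the derivative has one term with \<open>{l\<^sub>2 X\<^sup>b, X}\<close> and one with \<open>l\<^sub>2 X\<^sup>b l\<^sub>2\<close>. Both factors
  vanish, by the Jacobi identity and because \<open>l\<^sub>2\<close> is odd.
\<close>

lemma unshuffle_sum_bracket_into_bracket:
  assumes "homogeneous_word w" and "\<And>xs. length xs \<noteq> k \<Longrightarrow> K xs = 0"
    and K: "word_form K = divided_power b pairing" and L: "word_form L = divided_power a pairing"
  shows "unshuffle_sum w (\<lambda>S R. if length S = k then L (K (map snd S) # map snd R) else 0) = 0"
proof -
  have "homogeneous_form 1 (word_form K)"
    unfolding K by (intro homogeneous_form_divided_power homogeneous_form_pairing)
  from unshuffle_sum_into_bracket[OF assms(1,2) this L] show ?thesis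
    by (simp add: K brac_divided_power_pairing mult_divided_power_pairing divided_power_zero)
qed

text \<open>
  The coefficient counts the ways in which two given letters can be paired: one of them lies in the
  inserted product of \<open>b + 1\<close> letters and the other does not, in either of two roles, or both lie
  outside it.
\<close>

lemma unshuffle_sum_wedge_form_into_bracket:
  assumes "homogeneous_word w" and L: "word_form L = divided_power a pairing"
  shows "unshuffle_sum w (\<lambda>S R. if length S = Suc b
      then L (wedge_form wedge (Suc b) (map snd S) # map snd R) else 0) =
    scale (of_nat (2 * (a + b choose b) + (a + b choose Suc b))) (divided_power (a + b) pairing w)"
proof -
  have *: "wedge_form wedge (Suc b) xs = 0" if "length xs \<noteq> Suc b" for xs
    using that by (simp add: wedge_form_def)
  have "unshuffle_sum w (\<lambda>S R. if length S = Suc b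
      then L (wedge_form wedge (Suc b) (map snd S) # map snd R) else 0) =
    scale (of_nat (2 * (a + b choose a))) (divided_power (a + b) pairing w) +
    (if a = 0 then 0 else scale (of_nat ((a - 1) + Suc b choose (a - 1))) (divided_power (a - 1 + Suc b) pairing w))"
    by (subst unshuffle_sum_into_bracket[OF assms(1) * homogeneous_form_wedge_form L])
      (simp_all add: brac_wedge_form mult_wedge_form divided_power_scale divided_power_divided_power)
  also have "\<dots> = scale (of_nat (2 * (a + b choose b) + (a + b choose Suc b))) (divided_power (a + b) pairing w)"
  proof (cases a)
    case (Suc a')
    have "a + b choose a = a + b choose b" "a + b choose a' = a + b choose Suc b"
      using binomial_symmetric[of a "a + b"] binomial_symmetric[of a' "a + b"] Suc by simp_all
    then show ?thesis
      using Suc by (simp add: scale_left_distrib)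
  qed simp
  finally show ?thesis .
qed

text \<open>
  Here the coefficient counts the choices of the remaining \<open>a\<close> letters of the inserted block, or
  equivalently of the \<open>b\<close> letters outside it.
\<close>

lemma unshuffle_sum_bracket_into_wedge_form:
  assumes "homogeneous_word w" and "\<And>xs. length xs \<noteq> k \<Longrightarrow> K xs = 0"
    and K: "word_form K = divided_power a pairing"
  shows "unshuffle_sum w (\<lambda>S R. if length S = k
      then wedge_form wedge (Suc b) (K (map snd S) # map snd R) else 0) =
    scale (of_nat (a + b choose b)) (divided_power (a + b) pairing w)"
  by (subst unshuffle_sum_into_wedge_form[OF assms(1,2)])
    (simp_all add: K divided_power_divided_power add.commute)

lemma divided_power_pairing_swap:
  assumes "homogeneous_word (us @ x # y # vs)"
  shows "divided_power a pairing (us @ x # y # vs) =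
    parity_sign (fst x * fst y) (divided_power a pairing (us @ y # x # vs))"
  unfolding divided_power_def
proof (rule unshuffle_sum_swap[where P = "\<lambda>(d, x). x \<in> V d"])
  show x: "case x of (d, x) \<Rightarrow> x \<in> V d" and y: "case y of (d, x) \<Rightarrow> x \<in> V d"
    and "\<forall>z\<in>set us \<union> set vs. case z of (d, x) \<Rightarrow> x \<in> V d"
    using assms by (auto simp: homogeneous_word_def)
  fix us vs S R :: "'a word"
  have hom: "homogeneous_word (us @ x # y # vs) \<longleftrightarrow> homogeneous_word (us @ y # x # vs)"
    by (auto simp: homogeneous_word_def)
  have "pairing (us @ x # y # vs) = parity_sign (fst x * fst y) (pairing (us @ y # x # vs))"
  proof (cases "us = [] \<and> vs = []")
    case True
    then show ?thesis
      using x y bracket_symmetric[of "snd x" "fst x" "snd y" "fst y"] by (simp add: pairing_pair split_beta)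
  next
    case False
    then have "length (us @ v # v' # vs) \<noteq> 2" for v v'
      by auto
    then show ?thesis
      by (simp add: pairing_eq_0 del: length_append)
  qed
  then show "(if homogeneous_word R \<and> length R = a then foldl wedge (pairing (us @ x # y # vs)) (map snd R) else 0) =
     parity_sign (fst x * fst y)
      (if homogeneous_word R \<and> length R = a then foldl wedge (pairing (us @ y # x # vs)) (map snd R) else 0)"
    by (simp add: foldl_wedge_hom(5))
  have "wedge (wedge z (snd x)) (snd y) = parity_sign (fst x * fst y) (wedge (wedge z (snd y)) (snd x))" for z
    using x y wedge_commute_sign[of "snd x" "fst x" "snd y" "fst y"]
    by (simp add: wedge_assoc wedge_simps split_beta)
  then show "(if homogeneous_word (us @ x # y # vs) \<and> length (us @ x # y # vs) = a
      then foldl wedge (pairing S) (map snd (us @ x # y # vs)) else 0) =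
     parity_sign (fst x * fst y)
      (if homogeneous_word (us @ y # x # vs) \<and> length (us @ y # x # vs) = a
       then foldl wedge (pairing S) (map snd (us @ y # x # vs)) else 0)"
    by (simp add: hom foldl_wedge_hom(5))
qed

lemma multilinear_wedge_form: "multilinear scale (wedge_form wedge m)"
  unfolding multilinear_def
proof (intro allI impI)
  fix xs :: "'a list" and i assume i: "i < length xs"
  have "wedge_list wedge (xs[i := x]) =
      (if i = 0 then foldl wedge x (drop (Suc i) xs)
       else foldl wedge (wedge (wedge_list wedge (take i xs)) x) (drop (Suc i) xs))" for x
    using i by (cases xs; cases i) (simp_all add: upd_conv_take_nth_drop wedge_list_def)
  then show "Vector_Spaces.linear scale scale (\<lambda>x. wedge_form wedge m (xs[i := x]))"
    by (cases "m \<ge> 1 \<and> length xs = m"; cases "i = 0")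
      (auto simp: linear_iff_additive_homogeneous wedge_form_def wedge_simps foldl_wedge_hom(1-3))
qed

lemma vector_valued_form_wedge_form: "vector_valued_form scale V (wedge_form wedge m)"
  unfolding vector_valued_form_def graded_symmetric_def
proof (intro conjI allI impI multilinear_wedge_form)
  fix ds xs \<sigma> assume "homogeneous_list V ds xs" "\<sigma> permutes {..<length xs}"
  then show "wedge_form wedge m (permute_list \<sigma> xs) = scale (Koszul_sign ds \<sigma>) (wedge_form wedge m xs)"
    using wedge_list_permute[of ds xs \<sigma>] by (simp add: wedge_form_def)
qed

lemma has_form_degree_wedge_form: "has_form_degree V (wedge_form wedge m) 0"
proof (cases m)
  case 0
  then show ?thesis
    by (simp add: has_form_degree_def wedge_form_def zero_mem)
next
  case (Suc b)
  then show ?thesis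
    using has_form_degree_word_form[OF homogeneous_form_wedge_form] by simp
qed

end


section \<open>Formal sums\<close>

context graded_vector_space
begin

lemma multilinear_insertion:
  assumes "multilinear scale K" and "multilinear scale L"
  shows "multilinear scale (insertion scale V K L)"
  unfolding multilinear_def insertion_def
proof (intro allI impI multilinear_extension_linear)
  fix ds and ys :: "'a list" and j assume j: "j < length ys"
  have "Vector_Spaces.linear scale scale (\<lambda>z. unshuffle_insertion scale k K L ds (ys[j := z]))"
    if "k \<le> length ys" for k
    by (rule unshuffle_insertion_linear[OF assms that j])
  then show "Vector_Spaces.linear scale scale
      (\<lambda>z. \<Sum>k\<le>length (ys[j := z]). unshuffle_insertion scale k K L ds (ys[j := z]))"
    by (simp add: linear_iff_additive_homogeneous sum.distrib scale_sum_right)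
qed

text \<open>
  Inserting a form of arity \<open>k\<close> leaves \<open>length xs + 1 - k\<close> arguments to the outer form. For \<open>k = 0\<close> the
  inserted value is the zero constant term of the formal sum.
\<close>

lemma unshuffle_insertion_formal_sum:
  assumes G: "\<And>j. multilinear scale (G j)" and k: "k \<le> length xs"
  shows "unshuffle_insertion scale k (formal_sum scale a F) (formal_sum scale b G) ds xs =
    (if k = 0 then 0
     else scale (of_real (a k * b (length xs + 1 - k)))
       (unshuffle_insertion scale k (F k) (G (length xs + 1 - k)) ds xs))"
proof (cases "k = 0")
  case True
  have "G j (0 # ys) = 0" for j ys
    by (rule multilinear_zero[OF G]) simp
  then show ?thesis
    using True by (simp add: unshuffle_insertion_def formal_sum_def)
next
  case False
  then have "permute_list \<sigma> xs \<noteq> []" "Suc (length xs - k) = Suc (length xs) - k" for \<sigma>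
    using k by (auto simp flip: length_0_conv)
  then show ?thesis
    using False k
    by (simp add: unshuffle_insertion_def formal_sum_def min_def multilinear_add_scale_Cons[OF G]
        scale_sum_right mult.commute scale_left_commute)
qed

lemma insertion_formal_sum:
  assumes "\<And>j. multilinear scale (G j)"
  shows "insertion scale V (formal_sum scale a F) (formal_sum scale b G) xs =
    multilinear_extension V (\<lambda>ds ys. \<Sum>k = 1..length ys. scale (of_real (a k * b (length ys + 1 - k)))
       (unshuffle_insertion scale k (F k) (G (length ys + 1 - k)) ds ys)) xs"
  unfolding insertion_def
proof (rule multilinear_extension_cong)
  fix ds and ys :: "'a list"
  have "{..length ys} = insert 0 {1..length ys}"
    by auto
  then show "(\<Sum>k\<le>length ys. unshuffle_insertion scale k (formal_sum scale a F) (formal_sum scale b G) ds ys) =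
      (\<Sum>k = 1..length ys. scale (of_real (a k * b (length ys + 1 - k)))
         (unshuffle_insertion scale k (F k) (G (length ys + 1 - k)) ds ys))"
    by (simp add: unshuffle_insertion_formal_sum[OF assms])
qed

lemma formal_sum_eq_multilinear_extension:
  assumes "\<And>n. F n = multilinear_extension V (\<lambda>ds. F n)"
  shows "formal_sum scale c F xs = multilinear_extension V (\<lambda>ds. formal_sum scale c F) xs"
proof (cases "xs = []")
  case False
  then have "formal_sum scale c F xs = multilinear_extension V (\<lambda>ds ys. scale (of_real (c (length xs))) (F (length xs) ys)) xs"
    by (simp add: formal_sum_def multilinear_extension_scale flip: assms)
  also have "\<dots> = multilinear_extension V (\<lambda>ds. formal_sum scale c F) xs"
    using False by (intro multilinear_extension_cong) (auto simp: formal_sum_def)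
  finally show ?thesis .
qed (simp add: multilinear_extension_Nil)

lemma vector_valued_form_formal_sum:
  assumes "\<And>n. vector_valued_form scale V (F n)"
  shows "vector_valued_form scale V (formal_sum scale c F)"
proof -
  have "permute_list \<sigma> xs = [] \<longleftrightarrow> xs = []" for \<sigma> and xs :: "'a list"
    by (simp flip: length_0_conv)
  then show ?thesis
    using assms
    by (auto simp: vector_valued_form_def multilinear_def graded_symmetric_def formal_sum_def
        linear_iff_additive_homogeneous scale_right_distrib scale_left_commute)
qed

lemma has_form_degree_formal_sum:
  assumes "\<And>n. has_form_degree V (F n) p"
  shows "has_form_degree V (formal_sum scale c F) p"
  using assms by (auto simp: has_form_degree_def formal_sum_def zero_mem intro!: subspace_scale subspace_homogeneous)

lemma formal_sum_single:
  assumes "n \<ge> 1" and "\<And>xs. length xs \<noteq> n \<Longrightarrow> F n xs = 0"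
  shows "formal_sum scale (\<lambda>i. if i = n then 1 else 0) F = F n"
  using assms by (auto simp: formal_sum_def fun_eq_iff)

end

section \<open>The bracket forms of a Gerstenhaber algebra\<close>

context Gerstenhaber_algebra
begin

abbreviation (input) E :: "int \<Rightarrow> 'a set" where
  "E \<equiv> opposite_grading A"

interpretation E: graded_vector_space scale E
  by (rule graded_vector_space_opposite)

abbreviation l2 :: "'a vform" where
  "l2 \<equiv> Gerstenhaber_l2 scale A bracket"

abbreviation l :: "nat \<Rightarrow> 'a vform" where
  "l \<equiv> Gerstenhaber_l scale A wedge bracket"

lemmas wedge_simps = bilinear_map_simps[OF wedge_bilinear]
lemmas bracket_simps = bilinear_map_simps[OF shifted.bracket_bilinear]

lemma Gerstenhaber_l2_eq_extension: "l2 = multilinear_extension E (\<lambda>ds. l2)"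
  unfolding Gerstenhaber_l2_def by (rule E.multilinear_extension_idem[symmetric])

lemma multilinear_Gerstenhaber_l2: "multilinear scale l2"
  unfolding multilinear_def Gerstenhaber_l2_def
proof (intro allI impI E.multilinear_extension_linear)
  fix ds and ys :: "'a list" and j assume "j < length ys"
  then show "Vector_Spaces.linear scale scale (\<lambda>z. if length (ys[j := z]) = 2
      then scale ((- 1) powi ds ! 0) (bracket (ys[j := z] ! 0) (ys[j := z] ! 1)) else 0)"
    by (cases "j = 0"; cases "j = 1")
      (auto simp: E.linear_iff_additive_homogeneous bracket_simps scale_right_distrib scale_left_commute)
qed

lemma Gerstenhaber_l2_length: "length xs \<noteq> 2 \<Longrightarrow> l2 xs = 0"
proof -
  assume "length xs \<noteq> 2"
  then have "l2 xs = multilinear_extension E (\<lambda>ds ys. 0) xs"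
    unfolding Gerstenhaber_l2_def by (intro E.multilinear_extension_cong) simp
  then show ?thesis
    by (simp add: multilinear_extension_def)
qed

lemma Gerstenhaber_l2_pair:
  assumes "x \<in> E p" and "y \<in> E q"
  shows "l2 [x, y] = parity_sign p (bracket x y)"
proof (cases "x = 0 \<or> y = 0")
  case True
  then show ?thesis
    using E.multilinear_zero[OF multilinear_Gerstenhaber_l2, of "[x, y]"] by (auto simp: bracket_simps)
next
  case False
  then show ?thesis
    using assms Gerstenhaber_l2_homogeneous[of x p y q]
    by (simp add: opposite_grading_def scale_minus_one_powi)
qed

text \<open>
  An element of degree \<open>p\<close> in the opposite grading has degree \<open>- p - 1\<close> in the shifted Lie algebra, so
  the parity of its Lie degree is that of \<open>p + 1\<close>.
\<close>

lemma bracket_degree_opposite: "x \<in> E p \<Longrightarrow> y \<in> E q \<Longrightarrow> bracket x y \<in> E (p + q + 1)"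
  using shifted.bracket_degree[of x "- p - 1" y "- q - 1"] by (simp add: opposite_grading_def algebra_simps)

lemma bracket_antisym_opposite:
  "x \<in> E p \<Longrightarrow> y \<in> E q \<Longrightarrow> bracket x y = - parity_sign ((p + 1) * (q + 1)) (bracket y x)"
  using shifted.bracket_antisym[of x "- p - 1" y "- q - 1"]
  by (simp add: opposite_grading_def scale_minus_one_powi algebra_simps)

lemma bracket_Jacobi_opposite:
  "x \<in> E p \<Longrightarrow> y \<in> E q \<Longrightarrow> z \<in> E r \<Longrightarrow>
   bracket x (bracket y z) = bracket (bracket x y) z + parity_sign ((p + 1) * (q + 1)) (bracket y (bracket x z))"
  using shifted.bracket_Jacobi[of x "- p - 1" y "- q - 1" z "- r - 1"]
  by (simp add: opposite_grading_def scale_minus_one_powi algebra_simps)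

lemma bracket_derivation_opposite:
  "x \<in> E p \<Longrightarrow> y \<in> E q \<Longrightarrow> z \<in> E r \<Longrightarrow>
   bracket x (wedge y z) = wedge (bracket x y) z + parity_sign ((p + 1) * q) (wedge y (bracket x z))"
  using bracket_derivation[of x "- p - 1" y "- q" z "- r"]
  by (simp add: opposite_grading_def scale_minus_one_powi algebra_simps)

text \<open>
  All signs depend only on the parities of the degrees involved, so each identity is one of the
  Gerstenhaber algebra in every one of at most eight cases.
\<close>

lemma shifted_Poisson_algebra_opposite:
  "shifted_Poisson_algebra scale E wedge (\<lambda>x y. l2 [x, y])"
proof unfold_locales
  have degree: "wedge x y \<in> E (p + q)" if "x \<in> E p" "y \<in> E q" for x y p q
    using that wedge_degree[of x "- p" y "- q"] by (simp add: opposite_grading_def algebra_simps)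
  show "bilinear_map scale wedge"
    by (rule wedge_bilinear)
  show "wedge x y \<in> E (p + q)" if "x \<in> E p" "y \<in> E q" for x y p q
    using that by (rule degree)
  show "wedge (wedge x y) z = wedge x (wedge y z)" for x y z
    by (rule wedge_assoc)
  show "wedge x y = scale ((- 1) powi (p * q)) (wedge y x)" if "x \<in> E p" "y \<in> E q" for x y p q
    using that wedge_commute[of x "- p" y "- q"] by (simp add: opposite_grading_def)
  show "bilinear_map scale (\<lambda>x y. l2 [x, y])"
    using multilinear_Gerstenhaber_l2[unfolded multilinear_def, rule_format, of 0 "[x, y]" for x y]
      multilinear_Gerstenhaber_l2[unfolded multilinear_def, rule_format, of 1 "[x, y]" for x y]
    by (simp add: bilinear_map_def)
  show "l2 [x, y] \<in> E (p + q + 1)" if "x \<in> E p" "y \<in> E q" for x y p q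
    using that by (simp add: Gerstenhaber_l2_pair bracket_degree_opposite E.parity_sign_mem)
  show symmetric: "l2 [x, y] = parity_sign (p * q) (l2 [y, x])" if "x \<in> E p" "y \<in> E q" for x y p q
    using Gerstenhaber_l2_pair[OF that] Gerstenhaber_l2_pair[OF that(2,1)] bracket_antisym_opposite[OF that]
    by (auto simp: parity_sign_def)
  show "l2 [wedge x y, z] = parity_sign p (wedge x (l2 [y, z])) + parity_sign (q * r) (wedge (l2 [x, z]) y)"
    if xyz: "x \<in> E p" "y \<in> E q" "z \<in> E r" for x y z p q r
    using Gerstenhaber_l2_pair[OF degree[OF xyz(1,2)] xyz(3)] Gerstenhaber_l2_pair[OF xyz(2,3)]
      Gerstenhaber_l2_pair[OF xyz(1,3)] bracket_antisym_opposite[OF degree[OF xyz(1,2)] xyz(3)]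
      bracket_derivation_opposite[OF xyz(3,1,2)] bracket_antisym_opposite[OF xyz(2,3)]
      bracket_antisym_opposite[OF xyz(1,3)]
    by (cases "even p"; cases "even q"; cases "even r")
      (simp_all add: parity_sign_def wedge_simps bilinear_map_simps(7,8)[OF wedge_bilinear, where n = 1, unfolded parity_sign_def, simplified])
  show "l2 [l2 [x, y], z] + parity_sign (q * r) (l2 [l2 [x, z], y]) +
      parity_sign (p * (q + r)) (l2 [l2 [y, z], x]) = 0"
    if xyz: "x \<in> E p" "y \<in> E q" "z \<in> E r" for x y z p q r
  proof -
    have pair: "l2 [l2 [x, y], z] = parity_sign (q + 1) (bracket (bracket x y) z)"
      if xyz: "x \<in> E p" "y \<in> E q" "z \<in> E r" for x y z p q r
      using Gerstenhaber_l2_pair[OF E.parity_sign_mem[OF bracket_degree_opposite[OF xyz(1,2)], of p] xyz(3)]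
        Gerstenhaber_l2_pair[OF xyz(1,2)]
      by (simp add: bracket_simps) (auto intro!: parity_sign_cong)
    show ?thesis
      using bracket_Jacobi_opposite[OF xyz]
        bracket_antisym_opposite[OF bracket_degree_opposite[OF xyz(2,3)] xyz(1)]
        bracket_antisym_opposite[OF bracket_degree_opposite[OF xyz(1,3)] xyz(2)]
      unfolding pair[OF xyz] pair[OF xyz(1,3,2)] pair[OF xyz(2,3,1)]
      by (cases "even p"; cases "even q"; cases "even r") (simp_all add: parity_sign_def)
  qed
qed

interpretation P: shifted_Poisson_algebra scale E wedge "\<lambda>x y. l2 [x, y]"
  by (rule shifted_Poisson_algebra_opposite)

lemma pairing_eq_word_form: "P.pairing = E.word_form l2"
proof -
  have "(if length xs = 2 then l2 [xs ! 0, xs ! 1] else 0) = l2 xs" for xs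
    using Gerstenhaber_l2_length[of xs] by (auto simp: length_Suc_conv numeral_2_eq_2)
  then show ?thesis
    by (simp add: P.pairing_def)
qed

lemma multilinear_Gerstenhaber_l: "multilinear scale (l n)"
  using E.multilinear_insertion[OF multilinear_Gerstenhaber_l2 P.multilinear_wedge_form]
  by (simp add: Gerstenhaber_l_def multilinear_Gerstenhaber_l2)
    (simp add: multilinear_def E.linear_iff_additive_homogeneous)

lemma Gerstenhaber_l_eq_extension: "l n = multilinear_extension E (\<lambda>ds. l n)"
proof -
  have "multilinear_extension E (\<lambda>ds xs. 0) = (\<lambda>xs. 0)"
    by (simp add: multilinear_extension_def fun_eq_iff)
  then show ?thesis
    by (auto simp: Gerstenhaber_l_def insertion_def E.multilinear_extension_idem Gerstenhaber_l2_eq_extension[symmetric])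
qed

text \<open>
  Inserting \<open>l\<^sub>2\<close> into \<open>\<N>\<^sub>a\<^sub>+\<^sub>1\<close> gives \<open>l\<^sub>2 X\<^sup>a / a!\<close>. Words with a zero letter need an argument of their own,
  because the multilinear extension is defined through nonzero components.
\<close>

lemma word_form_Gerstenhaber_l: "E.word_form (l (a + 2)) = P.divided_power a P.pairing"
proof (cases "a = 0")
  case True
  then show ?thesis
    by (simp add: Gerstenhaber_l_def P.divided_power_0 pairing_eq_word_form)
next
  case False
  show ?thesis
  proof
    fix w
    show "E.word_form (l (a + 2)) w = P.divided_power a P.pairing w"
    proof (cases "E.homogeneous_word w")
      case False
      have "P.divided_power a P.pairing w = 0"
        unfolding P.divided_power_def
      proof (rule unshuffle_sum_neutral)
        fix S R assume "set S \<union> set R = set w"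
        then have "\<not> (E.homogeneous_word S \<and> E.homogeneous_word R)"
          using False E.homogeneous_word_Un_iff by simp
        then show "(if E.homogeneous_word R \<and> length R = a then foldl wedge (P.pairing S) (map snd R) else 0) = 0"
          by (auto simp: P.pairing_def E.word_form_def P.foldl_wedge_hom)
      qed
      then show ?thesis
        using False by (simp add: E.word_form_def)
    next
      case True
      let ?N = "wedge_form wedge (Suc a)"
      let ?G = "\<lambda>S R. ?N (l2 (map snd S) # map snd R)"
      have G: "?G S R = 0" if "length S \<noteq> 2 \<or> 0 \<in> snd ` (set S \<union> set R)" for S R
      proof -
        have "l2 (map snd S) = 0 \<or> 0 \<in> set (map snd R)"
          using that Gerstenhaber_l2_length[of "map snd S"]
            E.multilinear_zero[OF multilinear_Gerstenhaber_l2, of "map snd S"] by auto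
        then show ?thesis
          by (intro E.multilinear_zero[OF P.multilinear_wedge_form]) auto
      qed
      have sum: "P.divided_power a P.pairing w = unshuffle_sum w ?G"
      proof -
        have "P.divided_power a (E.word_form l2) w = unshuffle_sum w (\<lambda>S R. if length S = 2 then ?G S R else 0)"
          by (rule P.unshuffle_sum_into_wedge_form[symmetric]) (simp_all add: True Gerstenhaber_l2_length)
        also have "\<dots> = unshuffle_sum w ?G"
          by (intro unshuffle_sum_cong) (simp add: G)
        finally show ?thesis
          by (simp add: pairing_eq_word_form)
      qed
      show ?thesis
      proof (cases "0 \<in> snd ` set w")
        case True
        have "unshuffle_sum w ?G = 0"
          by (intro unshuffle_sum_neutral G) (use True in auto)
        moreover have "l (a + 2) (map snd w) = 0"
          by (rule E.multilinear_zero[OF multilinear_Gerstenhaber_l]) (use True in simp)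
        ultimately show ?thesis
          by (simp add: sum E.word_form_def)
      next
        case nonzero: False
        have "l (a + 2) (map snd w) = (\<Sum>k\<le>length w. unshuffle_insertion scale k l2 ?N (map fst w) (map snd w))"
          using False E.multilinear_extension_homogeneous[OF E.homogeneous_list_map[OF True]] nonzero
          by (simp add: Gerstenhaber_l_def insertion_def)
        also have "\<dots> = (\<Sum>k\<le>length w. unshuffle_sum w (\<lambda>S R. if length S = k then ?G S R else 0))"
          by (intro sum.cong refl) (simp add: E.unshuffle_insertion_eq_unshuffle_sum zip_map_fst_snd)
        also have "\<dots> = P.divided_power a P.pairing w"
          by (simp only: unshuffle_sum_by_length sum)
        finally show ?thesis
          using True by (simp add: E.word_form_def)
      qed
    qed
  qed
qed


lemma word_form_Gerstenhaber_l_ge_2: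
  assumes "n \<ge> 2"
  shows "E.word_form (l n) = P.divided_power (n - 2) P.pairing"
  using word_form_Gerstenhaber_l[of "n - 2"] unfolding le_add_diff_inverse2[OF assms] .

lemma Gerstenhaber_l_length: "length xs \<noteq> n \<Longrightarrow> l n xs = 0"
proof (cases "n \<le> 1")
  case False
  assume len: "length xs \<noteq> n"
  have "l n xs = multilinear_extension E (\<lambda>ds. l n) xs"
    by (simp flip: Gerstenhaber_l_eq_extension)
  also have "\<dots> = multilinear_extension E (\<lambda>ds ys. 0) xs"
  proof (rule E.multilinear_extension_cong)
    fix ds ys assume hom: "homogeneous_list E ds ys" and "length ys = length xs"
    then have "length (zip ds ys) \<noteq> n"
      using len by (auto simp: homogeneous_list_def list_all2_lengthD)
    then have "P.divided_power (n - 2) P.pairing (zip ds ys) = 0"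
      unfolding P.divided_power_def using False
      by (intro unshuffle_sum_neutral) (auto simp: P.pairing_eq_0 P.foldl_wedge_hom)
    then show "l n ys = 0"
      using word_form_Gerstenhaber_l_ge_2[of n] E.word_form_zip[OF hom, of "l n"] False by simp
  qed
  also have "\<dots> = 0"
    by (simp add: multilinear_extension_def)
  finally show ?thesis .
qed (simp add: Gerstenhaber_l_def)

lemma Gerstenhaber_l_eq_0: "n \<le> 1 \<Longrightarrow> l n xs = 0"
  by (simp add: Gerstenhaber_l_def)

lemma vector_valued_form_Gerstenhaber_l:
  "vector_valued_form scale E (l n)" and has_form_degree_Gerstenhaber_l: "has_form_degree E (l n) 1"
proof -
  have "graded_symmetric scale E (l n) \<and> has_form_degree E (l n) 1"
  proof (cases "n \<le> 1")
    case True
    then show ?thesis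
      by (simp add: Gerstenhaber_l_eq_0 graded_symmetric_def has_form_degree_def E.zero_mem)
  next
    case False
    then have word: "E.word_form (l n) = P.divided_power (n - 2) P.pairing"
      by (intro word_form_Gerstenhaber_l_ge_2) simp
    have "E.homogeneous_form 1 (E.word_form (l n))"
      unfolding word by (intro P.homogeneous_form_divided_power P.homogeneous_form_pairing)
    moreover have "graded_symmetric scale E (l n)"
      by (rule E.graded_symmetric_word_form) (simp add: word P.divided_power_pairing_swap)
    ultimately show ?thesis
      by (simp add: E.has_form_degree_word_form)
  qed
  then show "vector_valued_form scale E (l n)" "has_form_degree E (l n) 1"
    by (simp_all add: vector_valued_form_def multilinear_Gerstenhaber_l)
qed

lemma unshuffle_insertion_l_l:
  assumes hom: "homogeneous_list E ds xs" and k: "k \<le> length xs"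
  shows "unshuffle_insertion scale k (l k) (l j) ds xs = 0"
proof -
  have len: "length ds = length xs"
    using hom by (simp add: homogeneous_list_def list_all2_lengthD)
  consider "j \<le> 1" | "k \<le> 1" | "j \<ge> 2" "k \<ge> 2"
    by linarith
  then show ?thesis
  proof cases
    case 1
    then show ?thesis
      by (simp add: unshuffle_insertion_def Gerstenhaber_l_eq_0)
  next
    case 2
    then show ?thesis
      using E.multilinear_zero[OF multilinear_Gerstenhaber_l]
      by (simp add: unshuffle_insertion_def Gerstenhaber_l_eq_0)
  next
    case 3
    show ?thesis
      unfolding E.unshuffle_insertion_eq_unshuffle_sum[OF len k]
      by (rule P.unshuffle_sum_bracket_into_bracket[where b = "k - 2" and a = "j - 2"])
        (use 3 in \<open>simp_all add: word_form_Gerstenhaber_l_ge_2 E.homogeneous_word_zip[OF hom]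
           Gerstenhaber_l_length\<close>)
  qed
qed

text \<open>
  For \<open>j = a + 2\<close> and \<open>k = b + 1\<close> the two insertions have the coefficients
  \<open>2 (a + b choose b) + (a + b choose b + 1)\<close> and \<open>(a + b choose b)\<close>; Pascal's rule gives their difference.
  For \<open>j = 1\<close> both sides vanish.
\<close>

lemma unshuffle_insertion_commutator:
  assumes hom: "homogeneous_list E ds xs" and k: "k \<ge> 1" and j: "j \<ge> 1" and n: "k + j = length xs + 1"
  shows "unshuffle_insertion scale k (wedge_form wedge k) (l j) ds xs -
      unshuffle_insertion scale j (l j) (wedge_form wedge k) ds xs =
    scale (of_nat (length xs - 1 choose k)) (l (length xs) xs)"
proof (cases "j = 1")
  case True
  then have "unshuffle_insertion scale k (wedge_form wedge k) (l j) ds xs = 0"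
      "unshuffle_insertion scale j (l j) (wedge_form wedge k) ds xs = 0"
    using E.multilinear_zero[OF P.multilinear_wedge_form]
    by (simp_all add: unshuffle_insertion_def Gerstenhaber_l_eq_0)
  then show ?thesis
    using True n k by (auto simp: binomial_eq_0)
next
  case False
  have len: "length ds = length xs"
    using hom by (simp add: homogeneous_list_def list_all2_lengthD)
  obtain a b where a: "j = a + 2" and b: "k = Suc b"
    using k j False by (metis One_nat_def Suc_pred add_2_eq_Suc' le_add_diff_inverse2 le_neq_implies_less less_eq_Suc_le
        numeral_2_eq_2 Suc_1)
  have N: "length xs = a + b + 2"
    using n a b by simp
  let ?Q = "P.divided_power (a + b) P.pairing (zip ds xs)"
  have "unshuffle_insertion scale k (wedge_form wedge k) (l j) ds xs =
      scale (of_nat (2 * (a + b choose b) + (a + b choose Suc b))) ?Q"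
    unfolding b a by (subst E.unshuffle_insertion_eq_unshuffle_sum[OF len])
      (simp_all add: N P.unshuffle_sum_wedge_form_into_bracket[OF E.homogeneous_word_zip[OF hom] word_form_Gerstenhaber_l])
  moreover have "unshuffle_insertion scale j (l j) (wedge_form wedge k) ds xs = scale (of_nat (a + b choose b)) ?Q"
    unfolding b a by (subst E.unshuffle_insertion_eq_unshuffle_sum[OF len])
      (simp_all add: N P.unshuffle_sum_bracket_into_wedge_form[OF E.homogeneous_word_zip[OF hom]
         Gerstenhaber_l_length word_form_Gerstenhaber_l])
  moreover have "of_nat (2 * (a + b choose b) + (a + b choose Suc b)) - of_nat (a + b choose b) =
      (of_nat (a + b + 1 choose Suc b) :: 'k)"
    by simp
  moreover have "?Q = l (length xs) xs"
    using E.word_form_zip[OF hom, of "l (length xs)"] word_form_Gerstenhaber_l[of "a + b"] N by simp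
  ultimately show ?thesis
    using N b by (simp del: of_nat_add add: scale_left_diff_distrib[symmetric])
qed

section \<open>Brackets of formal sums\<close>

text \<open>
  The coefficient of \<open>l\<^sub>n\<close> in the bracket of \<open>\<Sum> b\<^sub>i \<N>\<^sub>i\<close> with \<open>\<Sum> a\<^sub>i l\<^sub>i\<close>: the contributions to arity \<open>n\<close> come
  from \<open>\<N>\<^sub>k\<close> and \<open>l\<^sub>n\<^sub>+\<^sub>1\<^sub>-\<^sub>k\<close>.
\<close>

definition deformation :: "(nat \<Rightarrow> real) \<Rightarrow> (nat \<Rightarrow> real) \<Rightarrow> nat \<Rightarrow> real" where
  "deformation b a n = (\<Sum>k = 1..n. b k * a (n + 1 - k) * of_nat (n - 1 choose k))"

text \<open>
  The two insertions of the bracket are matched by exchanging the arity \<open>k\<close> of the inserted form with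
  the arity \<open>n + 1 - k\<close> of the outer one.
\<close>

lemma RN_bracket_wedge_forms_l:
  "RN_bracket scale E 0 (formal_sum scale b (wedge_form wedge)) 1 (formal_sum scale a l) =
     formal_sum scale (deformation b a) l"
proof
  fix xs
  let ?N = "wedge_form wedge" and ?U = "unshuffle_insertion scale"
  have "RN_bracket scale E 0 (formal_sum scale b ?N) 1 (formal_sum scale a l) xs =
    multilinear_extension E (\<lambda>ds ys.
      (\<Sum>k = 1..length ys. scale (of_real (b k * a (length ys + 1 - k))) (?U k (?N k) (l (length ys + 1 - k)) ds ys)) -
      (\<Sum>k = 1..length ys. scale (of_real (a k * b (length ys + 1 - k))) (?U k (l k) (?N (length ys + 1 - k)) ds ys))) xs"
    by (simp add: RN_bracket_def E.insertion_formal_sum[OF multilinear_Gerstenhaber_l]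
        E.insertion_formal_sum[OF P.multilinear_wedge_form] E.multilinear_extension_diff)
  also have "\<dots> = multilinear_extension E (\<lambda>ds. formal_sum scale (deformation b a) l) xs"
  proof (rule E.multilinear_extension_cong)
    fix ds ys assume hom: "homogeneous_list E ds ys"
    let ?n = "length ys"
    have "(\<Sum>k = 1..?n. scale (of_real (a k * b (?n + 1 - k))) (?U k (l k) (?N (?n + 1 - k)) ds ys)) =
        (\<Sum>k = 1..?n. scale (of_real (b k * a (?n + 1 - k))) (?U (?n + 1 - k) (l (?n + 1 - k)) (?N k) ds ys))"
      by (rule sum.reindex_bij_witness[of _ "\<lambda>k. ?n + 1 - k" "\<lambda>k. ?n + 1 - k"]) (auto simp: mult.commute)
    then have "(\<Sum>k = 1..?n. scale (of_real (b k * a (?n + 1 - k))) (?U k (?N k) (l (?n + 1 - k)) ds ys)) -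
        (\<Sum>k = 1..?n. scale (of_real (a k * b (?n + 1 - k))) (?U k (l k) (?N (?n + 1 - k)) ds ys)) =
      (\<Sum>k = 1..?n. scale (of_real (b k * a (?n + 1 - k)))
        (?U k (?N k) (l (?n + 1 - k)) ds ys - ?U (?n + 1 - k) (l (?n + 1 - k)) (?N k) ds ys))"
      by (simp only: sum_subtractf scale_right_diff_distrib)
    also have "\<dots> = (\<Sum>k = 1..?n. scale (of_real (b k * a (?n + 1 - k)))
        (scale (of_nat (?n - 1 choose k)) (l ?n ys)))"
      by (intro sum.cong refl arg_cong[where f = "scale _"] unshuffle_insertion_commutator[OF hom]) auto
    also have "\<dots> = scale (of_real (deformation b a ?n)) (l ?n ys)"
      by (simp add: deformation_def scale_sum_left)
    also have "\<dots> = formal_sum scale (deformation b a) l ys"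
      by (simp add: formal_sum_def deformation_def)
    finally show "(\<Sum>k = 1..?n. scale (of_real (b k * a (?n + 1 - k))) (?U k (?N k) (l (?n + 1 - k)) ds ys)) -
        (\<Sum>k = 1..?n. scale (of_real (a k * b (?n + 1 - k))) (?U k (l k) (?N (?n + 1 - k)) ds ys)) =
      formal_sum scale (deformation b a) l ys" .
  qed
  also have "\<dots> = formal_sum scale (deformation b a) l xs"
    using E.formal_sum_eq_multilinear_extension[of l] Gerstenhaber_l_eq_extension by metis
  finally show "RN_bracket scale E 0 (formal_sum scale b ?N) 1 (formal_sum scale a l) xs =
    formal_sum scale (deformation b a) l xs" .
qed

lemma insertion_l_l: "insertion scale E (formal_sum scale a l) (formal_sum scale a' l) = (\<lambda>_. 0)"
proof
  fix xs
  have "insertion scale E (formal_sum scale a l) (formal_sum scale a' l) xs =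
      multilinear_extension E (\<lambda>ds ys. 0) xs"
    unfolding E.insertion_formal_sum[OF multilinear_Gerstenhaber_l]
    by (intro E.multilinear_extension_cong sum.neutral) (simp add: unshuffle_insertion_l_l)
  then show "insertion scale E (formal_sum scale a l) (formal_sum scale a' l) xs = 0"
    by (simp add: multilinear_extension_def)
qed

lemma RN_bracket_l_l: "RN_bracket scale E 1 (formal_sum scale a l) 1 (formal_sum scale a' l) = (\<lambda>_. 0)"
  by (simp add: RN_bracket_def insertion_l_l fun_eq_iff)

lemma L_infinity_structure_formal_sum: "L_infinity_structure scale E (formal_sum scale a l)"
  unfolding L_infinity_structure_def
proof (intro conjI allI impI)
  show "vector_valued_form scale E (formal_sum scale a l)"
    by (rule E.vector_valued_form_formal_sum[OF vector_valued_form_Gerstenhaber_l])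
  show "has_form_degree E (formal_sum scale a l) 1"
    by (rule E.has_form_degree_formal_sum[OF has_form_degree_Gerstenhaber_l])
  fix ds xs assume hom: "homogeneous_list E ds xs"
  show "(\<Sum>i = 1..length xs. unshuffle_insertion scale i (formal_sum scale a l) (formal_sum scale a l) ds xs) = 0"
    by (intro sum.neutral)
      (simp add: E.unshuffle_insertion_formal_sum[OF multilinear_Gerstenhaber_l] unshuffle_insertion_l_l[OF hom])
qed (simp add: formal_sum_def)

definition unit_at :: "nat \<Rightarrow> nat \<Rightarrow> real" where
  "unit_at n i = (if i = n then 1 else 0)"

lemma formal_sum_unit_at:
  assumes "n \<ge> 1"
  shows "formal_sum scale (unit_at n) l = l n"
    and "formal_sum scale (unit_at n) (wedge_form wedge) = wedge_form wedge n"
  using assms E.formal_sum_single[of n l] E.formal_sum_single[of n "wedge_form wedge"]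
  by (simp_all add: unit_at_def[abs_def] Gerstenhaber_l_length wedge_form_def)

lemma deformation_unit_at:
  "deformation b (unit_at n) N = (if N \<ge> n \<and> n \<ge> 1 then b (N + 1 - n) * of_nat (N - 1 choose (N + 1 - n)) else 0)"
proof (cases "N \<ge> n \<and> n \<ge> 1")
  case True
  have "deformation b (unit_at n) N = (\<Sum>k = 1..N. if k = N + 1 - n then b k * of_nat (N - 1 choose k) else 0)"
    unfolding deformation_def using True by (intro sum.cong) (auto simp: unit_at_def)
  then show ?thesis
    using True by (auto simp: sum.delta)
next
  case False
  then show ?thesis
    unfolding deformation_def by (auto simp: unit_at_def intro!: sum.neutral)
qed

text \<open>
  Deforming \<open>l\<^sub>n\<close> by \<open>\<Sum> \<kappa>\<^sub>k \<N>\<^sub>k\<close> multiplies \<open>\<kappa>\<^sub>k\<close> by a binomial coefficient and puts it at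
  arity \<open>k + n - 1\<close>. For \<open>n \<ge> 2\<close> this diagonal system can be solved for any target supported in
  arities at least \<open>n\<close>, and the twofold deformation of \<open>l\<^sub>n\<close> is such a target.
\<close>

lemma coboundary_Nijenhuis_wedge_forms:
  assumes n: "n \<ge> 1"
  shows "coboundary_Nijenhuis scale E (l n) (formal_sum scale b (wedge_form wedge))"
proof -
  let ?N = "wedge_form wedge"
  let ?d = "deformation b (deformation b (unit_at n))"
  define \<kappa> where "\<kappa> k = ?d (k + n - 1) / of_nat (k + n - 2 choose k)" for k
  have "deformation \<kappa> (unit_at n) N = ?d N" for N
  proof (cases "N \<ge> n")
    case False
    then show ?thesis
      by (auto simp: deformation_unit_at deformation_def[of b "deformation b _"] intro!: sum.neutral)
  next
    case True
    show ?thesis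
    proof (cases "n = 1")
      case True
      \<comment> \<open>Here the divisors in \<open>\<kappa>\<close> are zero, but so is everything to be divided.\<close>
      then have "deformation c (unit_at n) M = 0" for c M
        by (auto simp: deformation_unit_at binomial_eq_0)
      then show ?thesis
        by (simp add: deformation_def[of b "deformation b _"])
    next
      case False
      then have "N + 1 - n \<le> N - 1" "N + 1 - n + n - 1 = N" "N + 1 - n + n - 2 = N - 1"
        using True n by auto
      then show ?thesis
        using True n by (simp add: deformation_unit_at[of \<kappa>] \<kappa>_def)
    qed
  qed
  then have "deformation \<kappa> (unit_at n) = ?d"
    by blast
  then have "RN_bracket scale E 0 (formal_sum scale b ?N) 1 (RN_bracket scale E 0 (formal_sum scale b ?N) 1 (l n)) =
      RN_bracket scale E 0 (formal_sum scale \<kappa> ?N) 1 (l n)"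
    by (simp only: formal_sum_unit_at(1)[OF n, symmetric] RN_bracket_wedge_forms_l)
  then show ?thesis
    unfolding coboundary_Nijenhuis_def
    by (intro conjI exI[of _ "formal_sum scale \<kappa> ?N"] vector_valued_form_Gerstenhaber_l
        has_form_degree_Gerstenhaber_l E.vector_valued_form_formal_sum E.has_form_degree_formal_sum
        P.vector_valued_form_wedge_form P.has_form_degree_wedge_form)
qed

lemma deformed_structure_l:
  assumes n: "n \<ge> 1" and m: "m \<ge> 1"
  shows "deformed_structure scale E (wedge_form wedge m) (l n) =
    scale_form scale (of_nat (n + m - 2 choose m)) (l (n + m - 1))"
proof -
  have "deformed_structure scale E (wedge_form wedge m) (l n) =
      formal_sum scale (deformation (unit_at m) (unit_at n)) l"
    by (simp only: deformed_structure_def RN_bracket_wedge_forms_l[symmetric] formal_sum_unit_at[OF n]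
        formal_sum_unit_at[OF m])
  also have "\<dots> = scale_form scale (of_nat (n + m - 2 choose m)) (l (n + m - 1))"
  proof
    fix xs :: "'a list"
    show "formal_sum scale (deformation (unit_at m) (unit_at n)) l xs =
        scale_form scale (of_nat (n + m - 2 choose m)) (l (n + m - 1)) xs"
    proof (cases "length xs = n + m - 1")
      case True
      then have "deformation (unit_at m) (unit_at n) (length xs) = of_nat (n + m - 2 choose m)"
        using n m by (simp add: deformation_unit_at unit_at_def numeral_2_eq_2)
      then show ?thesis
        using True n m by (auto simp: formal_sum_def scale_form_def)
    next
      case False
      then have "deformation (unit_at m) (unit_at n) (length xs) = 0"
        using n m by (auto simp: deformation_unit_at unit_at_def)
      then show ?thesis
        using False by (simp add: formal_sum_def scale_form_def Gerstenhaber_l_length)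
    qed
  qed
  finally show ?thesis .
qed

lemma weak_Nijenhuis_wedge_forms:
  "weak_Nijenhuis scale E (formal_sum scale a l) (formal_sum scale b (wedge_form wedge))"
  unfolding weak_Nijenhuis_def RN_bracket_wedge_forms_l RN_bracket_l_l
  by (intro conjI refl E.vector_valued_form_formal_sum E.has_form_degree_formal_sum
      vector_valued_form_Gerstenhaber_l has_form_degree_Gerstenhaber_l
      P.vector_valued_form_wedge_form P.has_form_degree_wedge_form)

end

theorem theorem2p3:
  fixes scale :: "'k::real_normed_field \<Rightarrow> 'a::ab_group_add \<Rightarrow> 'a"
    and A E :: "int \<Rightarrow> 'a set"
    and wedge bracket :: "'a \<Rightarrow> 'a \<Rightarrow> 'a"
    and \<N> l :: "nat \<Rightarrow> 'a vform"
  assumes "Gerstenhaber_algebra scale A wedge bracket"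
    and "E = opposite_grading A"
    and "\<N> = wedge_form wedge"
    and "l = Gerstenhaber_l scale A wedge bracket"
  shows
    "(\<forall>n\<ge>1. L_infinity_structure scale E (l n)) \<and>
     (\<forall>n\<ge>1. \<forall>m\<ge>1. coboundary_Nijenhuis scale E (l n) (\<N> m)) \<and>
     (\<forall>n\<ge>1. \<forall>m\<ge>1. \<exists>c::'k.
        deformed_structure scale E (\<N> m) (l n) = scale_form scale c (l (n + m - 1))) \<and>
     L_infinity_pencil scale E {1..} l \<and>
     (\<forall>a::nat \<Rightarrow> real. L_infinity_structure scale E (formal_sum scale a l)) \<and>
     (\<forall>b::nat \<Rightarrow> real. \<forall>n\<ge>1. coboundary_Nijenhuis scale E (l n) (formal_sum scale b \<N>)) \<and>
     (\<forall>(a::nat \<Rightarrow> real) (b::nat \<Rightarrow> real).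
        weak_Nijenhuis scale E (formal_sum scale a l) (formal_sum scale b \<N>))"
proof -
  interpret Gerstenhaber_algebra scale A wedge bracket
    by fact
  note single = formal_sum_unit_at[folded assms(3,4)]
  have L: "L_infinity_structure scale E (formal_sum scale a l)" for a
    unfolding assms(2,4) by (rule L_infinity_structure_formal_sum)
  then have L1: "L_infinity_structure scale E (l n)" if "n \<ge> 1" for n
    by (metis single(1)[OF that])
  have cob: "coboundary_Nijenhuis scale E (l n) (formal_sum scale b \<N>)" if "n \<ge> 1" for n b
    unfolding assms(2-4) by (rule coboundary_Nijenhuis_wedge_forms[OF that])
  then have cob1: "coboundary_Nijenhuis scale E (l n) (\<N> m)" if "n \<ge> 1" "m \<ge> 1" for n m
    using that by (metis single(2))
  have def: "\<exists>c. deformed_structure scale E (\<N> m) (l n) = scale_form scale c (l (n + m - 1))"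
    if "n \<ge> 1" "m \<ge> 1" for n m
    using deformed_structure_l[OF that] unfolding assms(2-4) by blast
  have weak: "weak_Nijenhuis scale E (formal_sum scale a l) (formal_sum scale b \<N>)" for a b
    unfolding assms(2-4) by (rule weak_Nijenhuis_wedge_forms)
  have "RN_bracket scale E 1 (l i) 1 (l j) = (\<lambda>_. 0)" if "i \<ge> 1" "j \<ge> 1" for i j
    using RN_bracket_l_l[of "unit_at i" "unit_at j", folded assms(2,4)] that by (simp add: single)
  then have "L_infinity_pencil scale E {1..} l"
    by (simp add: L_infinity_pencil_def compatible_L_infinity_def L1)
  then show ?thesis
    using L L1 cob cob1 def weak by blast
qed

end
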